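(* Let $(\mathcal{M},\otimes,\mathbf{1})$ be a monoidal category. Assume that $\mathcal{M}$ has denumerable coproducts and that the tensor functors $M\otimes(-)$ and $(-)\otimes M$ preserve such coproducts for every object $M$ in $\mathcal{M}$. Then the forgetful functor $\Omega_{\mathrm{Br}}:\mathrm{BrAlg}_{\mathcal{M}}\to\mathrm{Br}_{\mathcal{M}}$ has a left adjoint $$T_{\mathrm{Br}}:\mathrm{Br}_{\mathcal{M}}\to\mathrm{BrAlg}_{\mathcal{M}}.$$ Given $(V,c)\in\mathrm{Br}_{\mathcal{M}}$ one has $T_{\mathrm{Br}}(V,c)=(TV,c_T)$, where $c_T=c_{\Omega TV}:\Omega TV\otimes\Omega TV\to\Omega TV\otimes\Omega TV$ is uniquely determined by $$c_T\circ(\alpha_mV\otimes\alpha_nV)=(\alpha_nV\otimes\alpha_mV)\circ c_T^{m,n}\quad\text{for all }m,n\in\mathbb{N}.$$ For $f$ a morphism in $\mathrm{Br}_{\mathcal{M}}$ one has $T_{\mathrm{Br}}(f)=T(f)$. The unit $\eta_{\mathrm{Br}}$ and the counit $\epsilon_{\mathrm{Br}}$ of this adjunction are uniquely determined by $$H\eta_{\mathrm{Br}}=\eta H,\qquad H_{\mathrm{Alg}}\epsilon_{\mathrm{Br}}=\epsilon H_{\mathrm{Alg}}.$$ Moreover the following equalities of functors hold: $$H\circ\Omega_{\mathrm{Br}}=\Omega\circ H_{\mathrm{Alg}},\qquad H_{\mathrm{Alg}}\circ T_{\mathrm{Br}}=T\circ H.$$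
   Context: Associativity constraints of $\mathcal M$ are suppressed in formulas; $l_X:\mathbf 1\otimes X\to X$ and $r_X:X\otimes\mathbf 1\to X$ are the unit constraints; an object also denotes its identity morphism. $V^{\otimes 0}=\mathbf 1$, $V^{\otimes 1}=V$, $V^{\otimes n}=V^{\otimes(n-1)}\otimes V$ for $n\ge 2$. A braided object in $\mathcal M$ is a pair $(V,c)$ with $c:V\otimes V\to V\otimes V$ invertible such that $(c\otimes V)(V\otimes c)(c\otimes V)=(V\otimes c)(c\otimes V)(V\otimes c)$; a morphism $(V,c_V)\to(W,c_W)$ is $f:V\to W$ with $c_W(f\otimes f)=(f\otimes f)c_V$. These form $\mathrm{Br}_{\mathcal M}$. A braided algebra is $(A,m,u,c)$ with $(A,m,u)$ an algebra in $\mathcal M$, $(A,c)$ a braided object, and $c(m\otimes A)=(A\otimes m)(c\otimes A)(A\otimes c)$, $c(A\otimes m)=(m\otimes A)(A\otimes c)(c\otimes A)$, $c(u\otimes A)l_A^{-1}=(A\otimes u)r_A^{-1}$, $c(A\otimes u)r_A^{-1}=(u\otimes A)l_A^{-1}$. Morphisms are algebra morphisms that are morphisms of braided objects; category $\mathrm{BrAlg}_{\mathcal M}$. Forgetful functors: $H:\mathrm{Br}_{\mathcal M}\to\mathcal M$, $\Omega:\mathrm{Alg}_{\mathcal M}\to\mathcal M$ ($\mathrm{Alg}_{\mathcal M}$ = algebras in $\mathcal M$), $H_{\mathrm{Alg}}:\mathrm{BrAlg}_{\mathcal M}\to\mathrm{Alg}_{\mathcal M}$, $\Omega_{\mathrm{Br}}:\mathrm{BrAlg}_{\mathcal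 M}\to\mathrm{Br}_{\mathcal M}$. Tensor algebra: under the stated hypotheses $\Omega$ has a left adjoint $T$ with $\Omega TV=\oplus_{n\in\mathbb N}V^{\otimes n}$ and canonical injections $\alpha_nV:V^{\otimes n}\to\Omega TV$; $Tf$ is determined by $\Omega Tf\circ\alpha_nV=\alpha_nW\circ f^{\otimes n}$ for $f:V\to W$; $m_{\Omega TV}\circ(\alpha_mV\otimes\alpha_nV)=\alpha_{m+n}V$, $u_{\Omega TV}=\alpha_0V$. The unit $\eta$ and counit $\epsilon$ of $(T,\Omega)$ are $\eta V=\alpha_1V$ and $\Omega\epsilon(A,m_A,u_A)\circ\alpha_nA=m_A^{n-1}$, where $m_A^{-1}=u_A$, $m_A^0=\mathrm{Id}_A$, $m_A^{n-1}=m_A(m_A^{n-2}\otimes A)$ for $n\ge2$. For $(V,c)\in\mathrm{Br}_{\mathcal M}$, $c_T^{a,b}:V^{\otimes a}\otimes V^{\otimes b}\to V^{\otimes b}\otimes V^{\otimes a}$ ($a,b\in\mathbb N$) is the unique family of morphisms such that for all $l,m,n\in\mathbb N$ (identifying $V^{\otimes l}\otimes V^{\otimes m}$ with $V^{\otimes(l+m)}$ via the constraints): $(V^{\otimes n}\otimes c_T^{l,m})(c_T^{l,n}\otimes V^{\otimes m})(V^{\otimes l}\otimes c_T^{m,n})=(c_T^{m,n}\otimes V^{\otimes l})(V^{\otimes m}\otimes c_T^{l,n})(c_T^{l,m}\otimes V^{\otimes n})$; $(c_T^{l,n}\otimes V^{\otimes m})(V^{\otimes l}\otimes c_T^{m,n})=c_T^{l+m,n}$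 for $l,m\ne0$; $(V^{\otimes m}\otimes c_T^{l,n})(c_T^{l,m}\otimes V^{\otimes n})=c_T^{l,m+n}$ for $m,n\ne0$; $c_T^{0,n}\circ l_{V^{\otimes n}}^{-1}=r_{V^{\otimes n}}^{-1}$; $c_T^{n,0}\circ r_{V^{\otimes n}}^{-1}=l_{V^{\otimes n}}^{-1}$; $c_T^{1,1}=c$. *)

theory Defs
  imports Main
begin

section \<open>Categories, functors, adjunctions, coproducts\<close>

text \<open>In a composite \<open>g \<cdot> f\<close> the arrow \<open>f\<close> is applied first. Values of the operations outside
  their domains are irrelevant.\<close>

record ('o, 'a) category =
  Ob :: "'o set"
  Ar :: "'a set"
  Src :: "'a \<Rightarrow> 'o"
  Tgt :: "'a \<Rightarrow> 'o"
  Idn :: "'o \<Rightarrow> 'a"  ("\<I>\<index>")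
  Cmp :: "'a \<Rightarrow> 'a \<Rightarrow> 'a"  ("(_ \<cdot>\<index>/ _)" [61, 60] 60)

definition hom :: "('o, 'a, 'm) category_scheme \<Rightarrow> 'o \<Rightarrow> 'o \<Rightarrow> 'a set" where
  "hom C X Y = {f \<in> Ar C. Src C f = X \<and> Tgt C f = Y}"

locale category =
  fixes C :: "('o, 'a, 'm) category_scheme" (structure)
  assumes Src_Ob: "f \<in> Ar C \<Longrightarrow> Src C f \<in> Ob C"
    and Tgt_Ob: "f \<in> Ar C \<Longrightarrow> Tgt C f \<in> Ob C"
    and Idn_hom: "X \<in> Ob C \<Longrightarrow> \<I> X \<in> hom C X X"
    and Cmp_hom: "f \<in> hom C X Y \<Longrightarrow> g \<in> hom C Y Z \<Longrightarrow> g \<cdot> f \<in> hom C X Z"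
    and Cmp_Idn: "f \<in> hom C X Y \<Longrightarrow> f \<cdot> \<I> X = f"
    and Idn_Cmp: "f \<in> hom C X Y \<Longrightarrow> \<I> Y \<cdot> f = f"
    and Cmp_assoc: "f \<in> hom C W X \<Longrightarrow> g \<in> hom C X Y \<Longrightarrow> h \<in> hom C Y Z \<Longrightarrow>
      (h \<cdot> g) \<cdot> f = h \<cdot> (g \<cdot> f)"

definition inverse_arrows :: "('o, 'a, 'm) category_scheme \<Rightarrow> 'a \<Rightarrow> 'a \<Rightarrow> bool" where
  "inverse_arrows C f g \<longleftrightarrow>
     f \<in> Ar C \<and> g \<in> hom C (Tgt C f) (Src C f) \<and>
     g \<cdot> f = \<I> (Src C f) \<and> f \<cdot> g = \<I> (Tgt C f)"
  for C (structure)

definition is_iso :: "('o, 'a, 'm) category_scheme \<Rightarrow> 'a \<Rightarrow> bool" where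
  "is_iso C f \<longleftrightarrow> (\<exists>g. inverse_arrows C f g)"

definition inv_ar :: "('o, 'a, 'm) category_scheme \<Rightarrow> 'a \<Rightarrow> 'a" where
  "inv_ar C f = (THE g. inverse_arrows C f g)"

record ('o1, 'a1, 'o2, 'a2) cfunctor =
  FO :: "'o1 \<Rightarrow> 'o2"
  FA :: "'a1 \<Rightarrow> 'a2"

definition is_functor ::
  "('o1, 'a1, 'm1) category_scheme \<Rightarrow> ('o2, 'a2, 'm2) category_scheme \<Rightarrow>
   ('o1, 'a1, 'o2, 'a2) cfunctor \<Rightarrow> bool" where
  "is_functor C D F \<longleftrightarrow> category C \<and> category D \<and>
     (\<forall>X\<in>Ob C. FO F X \<in> Ob D) \<and>
     (\<forall>X Y. \<forall>f\<in>hom C X Y. FA F f \<in> hom D (FO F X) (FO F Y)) \<and>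
     (\<forall>X\<in>Ob C. FA F (\<I>\<^bsub>C\<^esub> X) = \<I>\<^bsub>D\<^esub> (FO F X)) \<and>
     (\<forall>X Y Z. \<forall>f\<in>hom C X Y. \<forall>g\<in>hom C Y Z. FA F (g \<cdot>\<^bsub>C\<^esub> f) = FA F g \<cdot>\<^bsub>D\<^esub> FA F f)"

definition id_functor :: "('o, 'a, 'o, 'a) cfunctor" where
  "id_functor = \<lparr>FO = (\<lambda>X. X), FA = (\<lambda>f. f)\<rparr>"

definition fcomp ::
  "('o2, 'a2, 'o3, 'a3) cfunctor \<Rightarrow> ('o1, 'a1, 'o2, 'a2) cfunctor \<Rightarrow> ('o1, 'a1, 'o3, 'a3) cfunctor"
  (infixr "\<circ>\<^sub>F" 55) where
  "G \<circ>\<^sub>F F = \<lparr>FO = (\<lambda>X. FO G (FO F X)), FA = (\<lambda>f. FA G (FA F f))\<rparr>"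

text \<open>Equality of functors is equality on the objects and arrows of the source category, as the
  underlying functions are total.\<close>

definition functor_eq ::
  "('o1, 'a1, 'm1) category_scheme \<Rightarrow> ('o2, 'a2, 'm2) category_scheme \<Rightarrow>
   ('o1, 'a1, 'o2, 'a2) cfunctor \<Rightarrow> ('o1, 'a1, 'o2, 'a2) cfunctor \<Rightarrow> bool" where
  "functor_eq C D F G \<longleftrightarrow> is_functor C D F \<and> is_functor C D G \<and>
     (\<forall>X\<in>Ob C. FO F X = FO G X) \<and> (\<forall>f\<in>Ar C. FA F f = FA G f)"

definition nat_trans ::
  "('o1, 'a1, 'm1) category_scheme \<Rightarrow> ('o2, 'a2, 'm2) category_scheme \<Rightarrow>
   ('o1, 'a1, 'o2, 'a2) cfunctor \<Rightarrow> ('o1, 'a1, 'o2, 'a2) cfunctor \<Rightarrow> ('o1 \<Rightarrow> 'a2) \<Rightarrow> bool" where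
  "nat_trans C D F G \<tau> \<longleftrightarrow> is_functor C D F \<and> is_functor C D G \<and>
     (\<forall>X\<in>Ob C. \<tau> X \<in> hom D (FO F X) (FO G X)) \<and>
     (\<forall>X Y. \<forall>f\<in>hom C X Y. \<tau> Y \<cdot>\<^bsub>D\<^esub> FA F f = FA G f \<cdot>\<^bsub>D\<^esub> \<tau> X)"

text \<open>\<open>adjunction C D L R \<eta> \<epsilon>\<close>: the functor \<open>L : C \<rightarrow> D\<close> is left adjoint to \<open>R : D \<rightarrow> C\<close>, with
  unit \<open>\<eta>\<close> and counit \<open>\<epsilon>\<close>.\<close>

definition adjunction ::
  "('o1, 'a1, 'm1) category_scheme \<Rightarrow> ('o2, 'a2, 'm2) category_scheme \<Rightarrow>
   ('o1, 'a1, 'o2, 'a2) cfunctor \<Rightarrow> ('o2, 'a2, 'o1, 'a1) cfunctor \<Rightarrow>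
   ('o1 \<Rightarrow> 'a1) \<Rightarrow> ('o2 \<Rightarrow> 'a2) \<Rightarrow> bool" where
  "adjunction C D L R \<eta> \<epsilon> \<longleftrightarrow>
     is_functor C D L \<and> is_functor D C R \<and>
     nat_trans C C id_functor (R \<circ>\<^sub>F L) \<eta> \<and> nat_trans D D (L \<circ>\<^sub>F R) id_functor \<epsilon> \<and>
     (\<forall>X\<in>Ob C. \<epsilon> (FO L X) \<cdot>\<^bsub>D\<^esub> FA L (\<eta> X) = \<I>\<^bsub>D\<^esub> (FO L X)) \<and>
     (\<forall>Y\<in>Ob D. FA R (\<epsilon> Y) \<cdot>\<^bsub>C\<^esub> \<eta> (FO R Y) = \<I>\<^bsub>C\<^esub> (FO R Y))"

definition is_coproduct ::
  "('o, 'a, 'm) category_scheme \<Rightarrow> ('i \<Rightarrow> 'o) \<Rightarrow> 'o \<Rightarrow> ('i \<Rightarrow> 'a) \<Rightarrow> bool" where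
  "is_coproduct C X S j \<longleftrightarrow>
     S \<in> Ob C \<and> (\<forall>i. j i \<in> hom C (X i) S) \<and>
     (\<forall>Y\<in>Ob C. \<forall>g. (\<forall>i. g i \<in> hom C (X i) Y) \<longrightarrow>
        (\<exists>!h. h \<in> hom C S Y \<and> (\<forall>i. h \<cdot> j i = g i)))"
  for C (structure)

definition has_denumerable_coproducts :: "('o, 'a, 'm) category_scheme \<Rightarrow> bool" where
  "has_denumerable_coproducts C \<longleftrightarrow>
     (\<forall>X :: nat \<Rightarrow> 'o. (\<forall>n. X n \<in> Ob C) \<longrightarrow> (\<exists>S j. is_coproduct C X S j))"

definition preserves_denumerable_coproducts ::
  "('o1, 'a1, 'm1) category_scheme \<Rightarrow> ('o2, 'a2, 'm2) category_scheme \<Rightarrow>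
   ('o1, 'a1, 'o2, 'a2) cfunctor \<Rightarrow> bool" where
  "preserves_denumerable_coproducts C D F \<longleftrightarrow>
     (\<forall>(X :: nat \<Rightarrow> 'o1) S j. is_coproduct C X S j \<longrightarrow>
        is_coproduct D (\<lambda>n. FO F (X n)) (FO F S) (\<lambda>n. FA F (j n)))"


section \<open>Monoidal categories\<close>

record ('o, 'a) monoidal = "('o, 'a) category" +
  TenO :: "'o \<Rightarrow> 'o \<Rightarrow> 'o"  ("(_ \<odot>\<index>/ _)" [71, 72] 71)
  TenA :: "'a \<Rightarrow> 'a \<Rightarrow> 'a"  ("(_ \<otimes>\<index>/ _)" [71, 72] 71)
  Unt :: "'o"  ("\<one>\<index>")
  Asc :: "'o \<Rightarrow> 'o \<Rightarrow> 'o \<Rightarrow> 'a"  ("\<a>\<index>")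
  Lun :: "'o \<Rightarrow> 'a"  ("\<l>\<index>")
  Run :: "'o \<Rightarrow> 'a"  ("\<r>\<index>")

definition Asc_inv :: "('o, 'a, 'm) monoidal_scheme \<Rightarrow> 'o \<Rightarrow> 'o \<Rightarrow> 'o \<Rightarrow> 'a"  ("\<a>\<inverse>\<index>")
  where "\<a>\<inverse>\<^bsub>M\<^esub> X Y Z = inv_ar M (\<a>\<^bsub>M\<^esub> X Y Z)"

definition Lun_inv :: "('o, 'a, 'm) monoidal_scheme \<Rightarrow> 'o \<Rightarrow> 'a"  ("\<l>\<inverse>\<index>")
  where "\<l>\<inverse>\<^bsub>M\<^esub> X = inv_ar M (\<l>\<^bsub>M\<^esub> X)"

definition Run_inv :: "('o, 'a, 'm) monoidal_scheme \<Rightarrow> 'o \<Rightarrow> 'a"  ("\<r>\<inverse>\<index>")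
  where "\<r>\<inverse>\<^bsub>M\<^esub> X = inv_ar M (\<r>\<^bsub>M\<^esub> X)"

locale monoidal_category = category M
  for M :: "('o, 'a, 'm) monoidal_scheme" (structure) +
  assumes TenO_Ob: "X \<in> Ob M \<Longrightarrow> Y \<in> Ob M \<Longrightarrow> X \<odot> Y \<in> Ob M"
    and TenA_hom: "f \<in> hom M X X' \<Longrightarrow> g \<in> hom M Y Y' \<Longrightarrow> f \<otimes> g \<in> hom M (X \<odot> Y) (X' \<odot> Y')"
    and TenA_Idn: "X \<in> Ob M \<Longrightarrow> Y \<in> Ob M \<Longrightarrow> \<I> X \<otimes> \<I> Y = \<I> (X \<odot> Y)"
    and TenA_Cmp: "f \<in> hom M X X' \<Longrightarrow> f' \<in> hom M X' X'' \<Longrightarrow> g \<in> hom M Y Y' \<Longrightarrow> g' \<in> hom M Y' Y'' \<Longrightarrow>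
      (f' \<cdot> f) \<otimes> (g' \<cdot> g) = (f' \<otimes> g') \<cdot> (f \<otimes> g)"
    and Unt_Ob: "\<one> \<in> Ob M"
    and Asc_hom: "X \<in> Ob M \<Longrightarrow> Y \<in> Ob M \<Longrightarrow> Z \<in> Ob M \<Longrightarrow>
      \<a> X Y Z \<in> hom M ((X \<odot> Y) \<odot> Z) (X \<odot> (Y \<odot> Z))"
    and Asc_iso: "X \<in> Ob M \<Longrightarrow> Y \<in> Ob M \<Longrightarrow> Z \<in> Ob M \<Longrightarrow> is_iso M (\<a> X Y Z)"
    and Asc_nat: "f \<in> hom M X X' \<Longrightarrow> g \<in> hom M Y Y' \<Longrightarrow> h \<in> hom M Z Z' \<Longrightarrow>
      \<a> X' Y' Z' \<cdot> ((f \<otimes> g) \<otimes> h) = (f \<otimes> (g \<otimes> h)) \<cdot> \<a> X Y Z"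
    and Lun_hom: "X \<in> Ob M \<Longrightarrow> \<l> X \<in> hom M (\<one> \<odot> X) X"
    and Lun_iso: "X \<in> Ob M \<Longrightarrow> is_iso M (\<l> X)"
    and Lun_nat: "f \<in> hom M X X' \<Longrightarrow> \<l> X' \<cdot> (\<I> \<one> \<otimes> f) = f \<cdot> \<l> X"
    and Run_hom: "X \<in> Ob M \<Longrightarrow> \<r> X \<in> hom M (X \<odot> \<one>) X"
    and Run_iso: "X \<in> Ob M \<Longrightarrow> is_iso M (\<r> X)"
    and Run_nat: "f \<in> hom M X X' \<Longrightarrow> \<r> X' \<cdot> (f \<otimes> \<I> \<one>) = f \<cdot> \<r> X"
    and pentagon: "W \<in> Ob M \<Longrightarrow> X \<in> Ob M \<Longrightarrow> Y \<in> Ob M \<Longrightarrow> Z \<in> Ob M \<Longrightarrow>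
      (\<I> W \<otimes> \<a> X Y Z) \<cdot> \<a> W (X \<odot> Y) Z \<cdot> (\<a> W X Y \<otimes> \<I> Z) = \<a> W X (Y \<odot> Z) \<cdot> \<a> (W \<odot> X) Y Z"
    and triangle: "X \<in> Ob M \<Longrightarrow> Y \<in> Ob M \<Longrightarrow>
      (\<I> X \<otimes> \<l> Y) \<cdot> \<a> X \<one> Y = \<r> X \<otimes> \<I> Y"

definition tensor_left :: "('o, 'a, 'm) monoidal_scheme \<Rightarrow> 'o \<Rightarrow> ('o, 'a, 'o, 'a) cfunctor" where
  "tensor_left M X = \<lparr>FO = (\<lambda>Y. X \<odot> Y), FA = (\<lambda>f. \<I> X \<otimes> f)\<rparr>"
  for M (structure)

definition tensor_right :: "('o, 'a, 'm) monoidal_scheme \<Rightarrow> 'o \<Rightarrow> ('o, 'a, 'o, 'a) cfunctor" where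
  "tensor_right M X = \<lparr>FO = (\<lambda>Y. Y \<odot> X), FA = (\<lambda>f. f \<otimes> \<I> X)\<rparr>"
  for M (structure)

fun tpow :: "('o, 'a, 'm) monoidal_scheme \<Rightarrow> 'o \<Rightarrow> nat \<Rightarrow> 'o" where
  "tpow M V 0 = \<one>\<^bsub>M\<^esub>"
| "tpow M V (Suc 0) = V"
| "tpow M V (Suc (Suc n)) = tpow M V (Suc n) \<odot>\<^bsub>M\<^esub> V"

fun tpow_ar :: "('o, 'a, 'm) monoidal_scheme \<Rightarrow> 'a \<Rightarrow> nat \<Rightarrow> 'a" where
  "tpow_ar M f 0 = \<I>\<^bsub>M\<^esub> \<one>\<^bsub>M\<^esub>"
| "tpow_ar M f (Suc 0) = f"
| "tpow_ar M f (Suc (Suc n)) = tpow_ar M f (Suc n) \<otimes>\<^bsub>M\<^esub> f"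

text \<open>The canonical isomorphism, composed of constraints, from the tensor product of the powers
  \<open>m\<close> and \<open>n\<close> of \<open>V\<close> to the power \<open>m + n\<close>.\<close>

fun tpow_iso :: "('o, 'a, 'm) monoidal_scheme \<Rightarrow> 'o \<Rightarrow> nat \<Rightarrow> nat \<Rightarrow> 'a" where
  "tpow_iso M V 0 n = \<l>\<^bsub>M\<^esub> (tpow M V n)"
| "tpow_iso M V (Suc m) 0 = \<r>\<^bsub>M\<^esub> (tpow M V (Suc m))"
| "tpow_iso M V (Suc m) (Suc 0) = \<I>\<^bsub>M\<^esub> (tpow M V (Suc m) \<odot>\<^bsub>M\<^esub> V)"
| "tpow_iso M V (Suc m) (Suc (Suc n)) =
     (tpow_iso M V (Suc m) (Suc n) \<otimes>\<^bsub>M\<^esub> \<I>\<^bsub>M\<^esub> V) \<cdot>\<^bsub>M\<^esub>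
     \<a>\<inverse>\<^bsub>M\<^esub> (tpow M V (Suc m)) (tpow M V (Suc n)) V"


section \<open>Categories of objects with structure\<close>

text \<open>One arrow of the base category may underlie morphisms between several structured objects, so a
  morphism of structured objects records its source and target.\<close>

datatype ('s, 'a) marr = MArr (msrc: 's) (und: 'a) (mtgt: 's)

definition structured_cat ::
  "('o, 'a, 'm) category_scheme \<Rightarrow> 's set \<Rightarrow> ('s \<Rightarrow> 'o) \<Rightarrow> ('s \<Rightarrow> 'a \<Rightarrow> 's \<Rightarrow> bool) \<Rightarrow>
   ('s, ('s, 'a) marr) category" where
  "structured_cat C \<O> U P =
     \<lparr>Ob = \<O>,
      Ar = {MArr X f Y | X f Y. X \<in> \<O> \<and> Y \<in> \<O> \<and> f \<in> hom C (U X) (U Y) \<and> P X f Y},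
      Src = msrc,
      Tgt = mtgt,
      Idn = (\<lambda>X. MArr X (\<I> (U X)) X),
      Cmp = (\<lambda>g f. MArr (msrc f) (und g \<cdot> und f) (mtgt g))\<rparr>"
  for C (structure)

definition is_algebra :: "('o, 'a, 'm) monoidal_scheme \<Rightarrow> 'o \<times> 'a \<times> 'a \<Rightarrow> bool" where
  "is_algebra M = (\<lambda>(A, m, u).
     A \<in> Ob M \<and> m \<in> hom M (A \<odot> A) A \<and> u \<in> hom M \<one> A \<and>
     m \<cdot> (m \<otimes> \<I> A) = m \<cdot> (\<I> A \<otimes> m) \<cdot> \<a> A A A \<and>
     m \<cdot> (u \<otimes> \<I> A) = \<l> A \<and>
     m \<cdot> (\<I> A \<otimes> u) = \<r> A)"
  for M (structure)

definition is_algebra_mor ::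
  "('o, 'a, 'm) monoidal_scheme \<Rightarrow> 'o \<times> 'a \<times> 'a \<Rightarrow> 'a \<Rightarrow> 'o \<times> 'a \<times> 'a \<Rightarrow> bool" where
  "is_algebra_mor M = (\<lambda>(A, m, u) f (A', m', u').
     f \<cdot> m = m' \<cdot> (f \<otimes> f) \<and> f \<cdot> u = u')"
  for M (structure)

definition is_braided_object :: "('o, 'a, 'm) monoidal_scheme \<Rightarrow> 'o \<times> 'a \<Rightarrow> bool" where
  "is_braided_object M = (\<lambda>(V, c).
     V \<in> Ob M \<and> c \<in> hom M (V \<odot> V) (V \<odot> V) \<and> is_iso M c \<and>
     (c \<otimes> \<I> V) \<cdot> \<a>\<inverse> V V V \<cdot> (\<I> V \<otimes> c) \<cdot> \<a> V V V \<cdot> (c \<otimes> \<I> V) =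
     \<a>\<inverse> V V V \<cdot> (\<I> V \<otimes> c) \<cdot> \<a> V V V \<cdot> (c \<otimes> \<I> V) \<cdot> \<a>\<inverse> V V V \<cdot> (\<I> V \<otimes> c) \<cdot> \<a> V V V)"
  for M (structure)

definition is_braided_mor ::
  "('o, 'a, 'm) monoidal_scheme \<Rightarrow> 'o \<times> 'a \<Rightarrow> 'a \<Rightarrow> 'o \<times> 'a \<Rightarrow> bool" where
  "is_braided_mor M = (\<lambda>(V, c) f (W, d). d \<cdot> (f \<otimes> f) = (f \<otimes> f) \<cdot> c)"
  for M (structure)

definition is_braided_algebra :: "('o, 'a, 'm) monoidal_scheme \<Rightarrow> 'o \<times> 'a \<times> 'a \<times> 'a \<Rightarrow> bool" where
  "is_braided_algebra M = (\<lambda>(A, m, u, c).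
     is_algebra M (A, m, u) \<and> is_braided_object M (A, c) \<and>
     c \<cdot> (m \<otimes> \<I> A) = (\<I> A \<otimes> m) \<cdot> \<a> A A A \<cdot> (c \<otimes> \<I> A) \<cdot> \<a>\<inverse> A A A \<cdot> (\<I> A \<otimes> c) \<cdot> \<a> A A A \<and>
     c \<cdot> (\<I> A \<otimes> m) = (m \<otimes> \<I> A) \<cdot> \<a>\<inverse> A A A \<cdot> (\<I> A \<otimes> c) \<cdot> \<a> A A A \<cdot> (c \<otimes> \<I> A) \<cdot> \<a>\<inverse> A A A \<and>
     c \<cdot> (u \<otimes> \<I> A) \<cdot> \<l>\<inverse> A = (\<I> A \<otimes> u) \<cdot> \<r>\<inverse> A \<and>
     c \<cdot> (\<I> A \<otimes> u) \<cdot> \<r>\<inverse> A = (u \<otimes> \<I> A) \<cdot> \<l>\<inverse> A)"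
  for M (structure)

definition is_braided_algebra_mor ::
  "('o, 'a, 'm) monoidal_scheme \<Rightarrow> 'o \<times> 'a \<times> 'a \<times> 'a \<Rightarrow> 'a \<Rightarrow> 'o \<times> 'a \<times> 'a \<times> 'a \<Rightarrow> bool" where
  "is_braided_algebra_mor M = (\<lambda>(A, m, u, c) f (A', m', u', c').
     is_algebra_mor M (A, m, u) f (A', m', u') \<and> is_braided_mor M (A, c) f (A', c'))"

definition Alg_cat ::
  "('o, 'a, 'm) monoidal_scheme \<Rightarrow> ('o \<times> 'a \<times> 'a, ('o \<times> 'a \<times> 'a, 'a) marr) category" where
  "Alg_cat M = structured_cat M (Collect (is_algebra M)) fst (is_algebra_mor M)"

definition Br_cat ::
  "('o, 'a, 'm) monoidal_scheme \<Rightarrow> ('o \<times> 'a, ('o \<times> 'a, 'a) marr) category" where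
  "Br_cat M = structured_cat M (Collect (is_braided_object M)) fst (is_braided_mor M)"

definition BrAlg_cat ::
  "('o, 'a, 'm) monoidal_scheme \<Rightarrow>
   ('o \<times> 'a \<times> 'a \<times> 'a, ('o \<times> 'a \<times> 'a \<times> 'a, 'a) marr) category" where
  "BrAlg_cat M = structured_cat M (Collect (is_braided_algebra M)) fst (is_braided_algebra_mor M)"

definition H_Br :: "('o \<times> 'a, ('o \<times> 'a, 'a) marr, 'o, 'a) cfunctor" where
  "H_Br = \<lparr>FO = fst, FA = und\<rparr>"

definition Omega :: "('o \<times> 'a \<times> 'a, ('o \<times> 'a \<times> 'a, 'a) marr, 'o, 'a) cfunctor" where
  "Omega = \<lparr>FO = fst, FA = und\<rparr>"

definition H_Alg ::
  "('o \<times> 'a \<times> 'a \<times> 'a, ('o \<times> 'a \<times> 'a \<times> 'a, 'a) marr,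
    'o \<times> 'a \<times> 'a, ('o \<times> 'a \<times> 'a, 'a) marr) cfunctor" where
  "H_Alg = (let U = (\<lambda>(A, m, u, c). (A, m, u)) in
     \<lparr>FO = U, FA = (\<lambda>f. MArr (U (msrc f)) (und f) (U (mtgt f)))\<rparr>)"

definition Omega_Br ::
  "('o \<times> 'a \<times> 'a \<times> 'a, ('o \<times> 'a \<times> 'a \<times> 'a, 'a) marr, 'o \<times> 'a, ('o \<times> 'a, 'a) marr) cfunctor" where
  "Omega_Br = (let U = (\<lambda>(A, m, u, c). (A, c)) in
     \<lparr>FO = U, FA = (\<lambda>f. MArr (U (msrc f)) (und f) (U (mtgt f)))\<rparr>)"


section \<open>The tensor algebra\<close>

text \<open>A choice, for every object \<open>V\<close>, of a coproduct \<open>S V\<close> of the tensor powers of \<open>V\<close> with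
  injections \<open>\<alpha> V n\<close>. The tensor algebra functor and its adjunction depend on this choice.\<close>

definition tensor_power_coproducts ::
  "('o, 'a, 'm) monoidal_scheme \<Rightarrow> ('o \<Rightarrow> 'o) \<Rightarrow> ('o \<Rightarrow> nat \<Rightarrow> 'a) \<Rightarrow> bool" where
  "tensor_power_coproducts M S \<alpha> \<longleftrightarrow> (\<forall>V\<in>Ob M. is_coproduct M (tpow M V) (S V) (\<alpha> V))"

lemma ex_tensor_power_coproducts:
  assumes "monoidal_category M" and "has_denumerable_coproducts M"
  shows "\<exists>S \<alpha>. tensor_power_coproducts M S \<alpha>"
proof -
  interpret monoidal_category M by fact
  have "tpow M V n \<in> Ob M" if "V \<in> Ob M" for V n
    using that
  proof (induction n)
    case (Suc n)
    then show ?case by (cases n) (auto intro: TenO_Ob)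
  qed (simp add: Unt_Ob)
  with assms(2) have "\<forall>V\<in>Ob M. \<exists>S j. is_coproduct M (tpow M V) S j"
    unfolding has_denumerable_coproducts_def by blast
  then show ?thesis
    unfolding tensor_power_coproducts_def by metis
qed

definition T_mult ::
  "('o, 'a, 'm) monoidal_scheme \<Rightarrow> ('o \<Rightarrow> 'o) \<Rightarrow> ('o \<Rightarrow> nat \<Rightarrow> 'a) \<Rightarrow> 'o \<Rightarrow> 'a" where
  "T_mult M S \<alpha> V = (THE \<mu>. \<mu> \<in> hom M (S V \<odot> S V) (S V) \<and>
     (\<forall>m n. \<mu> \<cdot> (\<alpha> V m \<otimes> \<alpha> V n) = \<alpha> V (m + n) \<cdot> tpow_iso M V m n))"
  for M (structure)

definition T_ob ::
  "('o, 'a, 'm) monoidal_scheme \<Rightarrow> ('o \<Rightarrow> 'o) \<Rightarrow> ('o \<Rightarrow> nat \<Rightarrow> 'a) \<Rightarrow> 'o \<Rightarrow> 'o \<times> 'a \<times> 'a" where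
  "T_ob M S \<alpha> V = (S V, T_mult M S \<alpha> V, \<alpha> V 0)"

definition T_functor ::
  "('o, 'a, 'm) monoidal_scheme \<Rightarrow> ('o \<Rightarrow> 'o) \<Rightarrow> ('o \<Rightarrow> nat \<Rightarrow> 'a) \<Rightarrow>
   ('o, 'a, 'o \<times> 'a \<times> 'a, ('o \<times> 'a \<times> 'a, 'a) marr) cfunctor" where
  "T_functor M S \<alpha> =
     \<lparr>FO = T_ob M S \<alpha>,
      FA = (\<lambda>f. let V = Src M f; W = Tgt M f in
        MArr (T_ob M S \<alpha> V)
          (THE g. g \<in> hom M (S V) (S W) \<and> (\<forall>n. g \<cdot> \<alpha> V n = \<alpha> W n \<cdot> tpow_ar M f n))
          (T_ob M S \<alpha> W))\<rparr>"
  for M (structure)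

text \<open>\<open>iter_mult M (A, m, u) n\<close> is the iterated multiplication from the \<open>n\<close>-th power of \<open>A\<close>, that
  is, the arrow usually written with exponent \<open>n - 1\<close>.\<close>

fun iter_mult :: "('o, 'a, 'm) monoidal_scheme \<Rightarrow> 'o \<times> 'a \<times> 'a \<Rightarrow> nat \<Rightarrow> 'a" where
  "iter_mult M (A, m, u) 0 = u"
| "iter_mult M (A, m, u) (Suc 0) = \<I>\<^bsub>M\<^esub> A"
| "iter_mult M (A, m, u) (Suc (Suc n)) = m \<cdot>\<^bsub>M\<^esub> (iter_mult M (A, m, u) (Suc n) \<otimes>\<^bsub>M\<^esub> \<I>\<^bsub>M\<^esub> A)"

definition T_unit :: "('o \<Rightarrow> nat \<Rightarrow> 'a) \<Rightarrow> 'o \<Rightarrow> 'a" where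
  "T_unit \<alpha> V = \<alpha> V 1"

definition T_counit ::
  "('o, 'a, 'm) monoidal_scheme \<Rightarrow> ('o \<Rightarrow> 'o) \<Rightarrow> ('o \<Rightarrow> nat \<Rightarrow> 'a) \<Rightarrow>
   'o \<times> 'a \<times> 'a \<Rightarrow> ('o \<times> 'a \<times> 'a, 'a) marr" where
  "T_counit M S \<alpha> B = (let A = FO Omega B in
     MArr (T_ob M S \<alpha> A)
       (THE g. g \<in> hom M (S A) A \<and> (\<forall>n. g \<cdot> \<alpha> A n = iter_mult M B n))
       B)"
  for M (structure)


section \<open>The braiding of tensor powers\<close>

text \<open>The identification of a tensor product of two powers of \<open>V\<close> with a power of \<open>V\<close> is
  \<^const>\<open>tpow_iso\<close>; the three-strand equations are read on fixed bracketings, with the associativity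
  constraints written out.\<close>

definition is_graded_braiding ::
  "('o, 'a, 'm) monoidal_scheme \<Rightarrow> 'o \<Rightarrow> 'a \<Rightarrow> (nat \<Rightarrow> nat \<Rightarrow> 'a) \<Rightarrow> bool" where
  "is_graded_braiding M V c \<gamma> \<longleftrightarrow> (let P = tpow M V; \<phi> = tpow_iso M V in
     (\<forall>a b. \<gamma> a b \<in> hom M (P a \<odot> P b) (P b \<odot> P a)) \<and>
     (\<forall>l m n.
        \<a>\<inverse> (P n) (P m) (P l) \<cdot> (\<I> (P n) \<otimes> \<gamma> l m) \<cdot> \<a> (P n) (P l) (P m) \<cdot> (\<gamma> l n \<otimes> \<I> (P m)) \<cdot>
          \<a>\<inverse> (P l) (P n) (P m) \<cdot> (\<I> (P l) \<otimes> \<gamma> m n) \<cdot> \<a> (P l) (P m) (P n) =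
        (\<gamma> m n \<otimes> \<I> (P l)) \<cdot> \<a>\<inverse> (P m) (P n) (P l) \<cdot> (\<I> (P m) \<otimes> \<gamma> l n) \<cdot> \<a> (P m) (P l) (P n) \<cdot>
          (\<gamma> l m \<otimes> \<I> (P n))) \<and>
     (\<forall>l m n. l \<noteq> 0 \<longrightarrow> m \<noteq> 0 \<longrightarrow>
        (\<I> (P n) \<otimes> \<phi> l m) \<cdot> \<a> (P n) (P l) (P m) \<cdot> (\<gamma> l n \<otimes> \<I> (P m)) \<cdot> \<a>\<inverse> (P l) (P n) (P m) \<cdot>
          (\<I> (P l) \<otimes> \<gamma> m n) \<cdot> \<a> (P l) (P m) (P n) =
        \<gamma> (l + m) n \<cdot> (\<phi> l m \<otimes> \<I> (P n))) \<and>
     (\<forall>l m n. m \<noteq> 0 \<longrightarrow> n \<noteq> 0 \<longrightarrow>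
        (\<phi> m n \<otimes> \<I> (P l)) \<cdot> \<a>\<inverse> (P m) (P n) (P l) \<cdot> (\<I> (P m) \<otimes> \<gamma> l n) \<cdot> \<a> (P m) (P l) (P n) \<cdot>
          (\<gamma> l m \<otimes> \<I> (P n)) \<cdot> \<a>\<inverse> (P l) (P m) (P n) =
        \<gamma> l (m + n) \<cdot> (\<I> (P l) \<otimes> \<phi> m n)) \<and>
     (\<forall>n. \<gamma> 0 n \<cdot> \<l>\<inverse> (P n) = \<r>\<inverse> (P n)) \<and>
     (\<forall>n. \<gamma> n 0 \<cdot> \<r>\<inverse> (P n) = \<l>\<inverse> (P n)) \<and>
     \<gamma> 1 1 = c)"
  for M (structure)

definition graded_braiding ::
  "('o, 'a, 'm) monoidal_scheme \<Rightarrow> 'o \<Rightarrow> 'a \<Rightarrow> nat \<Rightarrow> nat \<Rightarrow> 'a" where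
  "graded_braiding M V c = (THE \<gamma>. is_graded_braiding M V c \<gamma>)"

definition is_T_braiding ::
  "('o, 'a, 'm) monoidal_scheme \<Rightarrow> ('o \<Rightarrow> 'o) \<Rightarrow> ('o \<Rightarrow> nat \<Rightarrow> 'a) \<Rightarrow> 'o \<Rightarrow> 'a \<Rightarrow> 'a \<Rightarrow> bool" where
  "is_T_braiding M S \<alpha> V c c\<^sub>T \<longleftrightarrow>
     c\<^sub>T \<in> hom M (S V \<odot> S V) (S V \<odot> S V) \<and>
     (\<forall>m n. c\<^sub>T \<cdot> (\<alpha> V m \<otimes> \<alpha> V n) = (\<alpha> V n \<otimes> \<alpha> V m) \<cdot> graded_braiding M V c m n)"
  for M (structure)

definition with_braiding :: "'o \<times> 'a \<times> 'a \<Rightarrow> 'a \<Rightarrow> 'o \<times> 'a \<times> 'a \<times> 'a" where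
  "with_braiding B c = (case B of (A, m, u) \<Rightarrow> (A, m, u, c))"

end

theory Submission
  imports Defs
begin

text \<open>
  The category is replaced by a strict one: its arrows are the arrows between left-bracketed tensor
  products of lists of objects, and its tensor product is conjugated by the canonical isomorphisms. The
  equations that define algebras, braided objects, braided algebras and the graded braiding become their
  strict versions, in which no constraint occurs.

  In the strict category the graded braiding is built from \<open>c\<close> by moving one strand at a time, and its
  Yang--Baxter equation says that the braiding with a block of strands is natural for each arrow
  generated by \<open>c\<close>. Tensoring preserves the coproduct of the powers, so arrows out of tensor powers of the
  tensor algebra are determined by, and can be prescribed on, the components. Hence \<open>c\<^sub>T\<close> exists, its
  inverse comes from the inverses of the components, and every axiom of a braided algebra reduces to an
  identity of the graded braiding.

  A braided morphism \<open>g\<close> from \<open>(V, c)\<close> to a braided algebra extends to the arrow with components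
  \<open>x 0 = u\<close>, \<open>x (n + 1) = m (x n \<otimes> g)\<close>; compatibility with the braidings propagates from \<open>g\<close> to all \<open>x n\<close> by
  induction. An algebra morphism out of the tensor algebra is determined by its restriction to \<open>V\<close>, so the
  functor laws, the naturality of the counit and the triangle identities follow from uniqueness.
\<close>

section \<open>Strict monoidal categories\<close>

text \<open>Objects of the strict category are words of objects and their tensor product is
  concatenation, so the associativity and unit laws for sources and targets are computations with
  lists. The equations for \<open>dom\<close> and \<open>cod\<close> of composites and products are
  unconditional, and typing goals become list equations between blocks \<open>replicate n V\<close>.
  Words are bracketed to the left to agree with \<open>tpow\<close>: \<open>replicate n V\<close>
  stands for the n-th power itself, not merely for an isomorphic object, and \<open>tens_iso\<close>
  on such words is \<open>tpow_iso\<close>.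

  The one-letter word on the n-th power and the n-letter word \<open>replicate n V\<close> are
  different objects of the strict category with the same underlying object. The axioms of the graded
  braiding are read on one-letter words, where the identifications \<open>tpow_iso\<close> still
  show, and are then moved to n-letter words, where these become identities. The translations are
  equivalences, because the multiplication and the braidings are defined by \<open>THE\<close>:
  existence and uniqueness both have to return from the strict side.\<close>

locale strict_monoidal_category =
  fixes obs :: "'a set"
    and arr :: "'b \<Rightarrow> bool"
    and dom :: "'b \<Rightarrow> 'a list"
    and cod :: "'b \<Rightarrow> 'a list"
    and idn :: "'a list \<Rightarrow> 'b"
    and cmp :: "'b \<Rightarrow> 'b \<Rightarrow> 'b" (infixr "\<bullet>" 60)
    and ten :: "'b \<Rightarrow> 'b \<Rightarrow> 'b" (infixr "\<boxtimes>" 70)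
  assumes arr_idn [simp]: "arr (idn x) \<longleftrightarrow> set x \<subseteq> obs"
    and dom_idn [simp]: "dom (idn x) = x"
    and cod_idn [simp]: "cod (idn x) = x"
    and dom_cmp [simp]: "dom (g \<bullet> f) = dom f"
    and cod_cmp [simp]: "cod (g \<bullet> f) = cod g"
    and dom_ten [simp]: "dom (f \<boxtimes> g) = dom f @ dom g"
    and cod_ten [simp]: "cod (f \<boxtimes> g) = cod f @ cod g"
    and dom_obs: "arr f \<Longrightarrow> set (dom f) \<subseteq> obs"
    and cod_obs: "arr f \<Longrightarrow> set (cod f) \<subseteq> obs"
    and arr_cmp [simp]: "arr f \<Longrightarrow> arr g \<Longrightarrow> dom g = cod f \<Longrightarrow> arr (g \<bullet> f)"
    and arr_ten [simp]: "arr f \<Longrightarrow> arr g \<Longrightarrow> arr (f \<boxtimes> g)"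
    and cmp_idn [simp]: "arr f \<Longrightarrow> dom f = x \<Longrightarrow> f \<bullet> idn x = f"
    and idn_cmp [simp]: "arr f \<Longrightarrow> cod f = x \<Longrightarrow> idn x \<bullet> f = f"
    and cmp_assoc [simp]: "arr f \<Longrightarrow> arr g \<Longrightarrow> arr h \<Longrightarrow> dom g = cod f \<Longrightarrow> dom h = cod g \<Longrightarrow>
      (h \<bullet> g) \<bullet> f = h \<bullet> g \<bullet> f"
    and interchange: "arr f \<Longrightarrow> arr f' \<Longrightarrow> arr g \<Longrightarrow> arr g' \<Longrightarrow> dom f' = cod f \<Longrightarrow> dom g' = cod g \<Longrightarrow>
      (f' \<boxtimes> g') \<bullet> (f \<boxtimes> g) = (f' \<bullet> f) \<boxtimes> (g' \<bullet> g)"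
    and idn_ten_idn [simp]: "set x \<subseteq> obs \<Longrightarrow> set y \<subseteq> obs \<Longrightarrow> idn x \<boxtimes> idn y = idn (x @ y)"
    and ten_assoc [simp]: "arr f \<Longrightarrow> arr g \<Longrightarrow> arr h \<Longrightarrow> (f \<boxtimes> g) \<boxtimes> h = f \<boxtimes> g \<boxtimes> h"
    and idn_Nil_ten [simp]: "arr f \<Longrightarrow> idn [] \<boxtimes> f = f"
    and ten_idn_Nil [simp]: "arr f \<Longrightarrow> f \<boxtimes> idn [] = f"
begin

text \<open>Merges adjacent identities at the head of a right-nested product, where
  \<open>idn_ten_idn\<close> does not match.\<close>

lemma idn_ten_idn_ten [simp]:
  assumes "set x \<subseteq> obs" "set y \<subseteq> obs" "arr f"
  shows "idn x \<boxtimes> idn y \<boxtimes> f = idn (x @ y) \<boxtimes> f"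
  using assms ten_assoc[of "idn x" "idn y" f] by simp

lemma idn_ten_cmp:
  assumes "arr f" "arr g" "dom g = cod f" "set x \<subseteq> obs"
  shows "idn x \<boxtimes> (g \<bullet> f) = (idn x \<boxtimes> g) \<bullet> (idn x \<boxtimes> f)"
  using assms by (simp add: interchange)

lemma cmp_ten_idn:
  assumes "arr f" "arr g" "dom g = cod f" "set x \<subseteq> obs"
  shows "(g \<bullet> f) \<boxtimes> idn x = (g \<boxtimes> idn x) \<bullet> (f \<boxtimes> idn x)"
  using assms by (simp add: interchange)

text \<open>Composites are kept nested to the right, so a known equation for
  \<open>g \<bullet> f\<close> is not visible in a longer composite. This form applies it in front
  of a tail \<open>k\<close>.\<close>

lemma cmp_eq_cmp_assoc:
  assumes "g \<bullet> f = h" "arr f" "arr g" "arr k" "dom g = cod f" "dom f = cod k"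
  shows "g \<bullet> f \<bullet> k = h \<bullet> k"
  using assms by (metis cmp_assoc)

text \<open>A commuting square stays commuting beside an independent factor \<open>z\<close>. The
  lists \<open>y\<close> and \<open>w\<close> are tied to \<open>z\<close> by equations only, so
  that any expression equal to the target or source of \<open>z\<close> may be used.\<close>

lemma slide_left:
  assumes "g \<bullet> f = f' \<bullet> g'" "arr f" "arr g" "arr f'" "arr g'" "arr z"
    and "dom g = cod f" "dom f' = cod g'" "y = cod z" "w = dom z"
  shows "(g \<boxtimes> idn y) \<bullet> (f \<boxtimes> z) = (f' \<boxtimes> z) \<bullet> (g' \<boxtimes> idn w)"
  using assms dom_obs[of z] cod_obs[of z] by (simp add: interchange)

lemma slide_right:
  assumes "g \<bullet> f = f' \<bullet> g'" "arr f" "arr g" "arr f'" "arr g'" "arr z"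
    and "dom g = cod f" "dom f' = cod g'" "y = cod z" "w = dom z"
  shows "(idn y \<boxtimes> g) \<bullet> (z \<boxtimes> f) = (z \<boxtimes> f') \<bullet> (idn w \<boxtimes> g')"
  using assms dom_obs[of z] cod_obs[of z] by (simp add: interchange)

text \<open>Both sides equal \<open>f \<boxtimes> g\<close>: arrows on disjoint strands
  commute.\<close>

lemma ten_commute:
  assumes "arr f" "arr g" "x = dom f" "x' = cod f" "y = dom g" "y' = cod g"
  shows "(f \<boxtimes> idn y') \<bullet> (idn x \<boxtimes> g) = (idn x' \<boxtimes> g) \<bullet> (f \<boxtimes> idn y)"
  using assms dom_obs[of f] cod_obs[of f] dom_obs[of g] cod_obs[of g] by (simp add: interchange)

section \<open>Isomorphisms and cancellation in a strict monoidal category\<close>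

definition iso :: "'b \<Rightarrow> bool" where
  "iso f \<longleftrightarrow> arr f \<and> (\<exists>g. arr g \<and> dom g = cod f \<and> cod g = dom f \<and>
     g \<bullet> f = idn (dom f) \<and> f \<bullet> g = idn (cod f))"

lemma isoI:
  assumes "arr f" "arr g" "dom g = cod f" "cod g = dom f" "g \<bullet> f = idn (dom f)" "f \<bullet> g = idn (cod f)"
  shows "iso f"
  using assms unfolding iso_def by blast

lemma iso_arr: "iso f \<Longrightarrow> arr f"
  by (simp add: iso_def)

lemma isoE:
  assumes "iso f"
  obtains g where "arr g" "dom g = cod f" "cod g = dom f" "g \<bullet> f = idn (dom f)" "f \<bullet> g = idn (cod f)"
  using assms unfolding iso_def by blast

lemma iso_idn: "set x \<subseteq> obs \<Longrightarrow> iso (idn x)"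
  by (rule isoI[where g = "idn x"]) auto

lemma iso_cmp:
  assumes "iso f" "iso g" "dom g = cod f"
  shows "iso (g \<bullet> f)"
proof -
  obtain f' where f: "arr f'" "dom f' = cod f" "cod f' = dom f" "f' \<bullet> f = idn (dom f)" "f \<bullet> f' = idn (cod f)"
    using assms(1) by (rule isoE)
  obtain g' where g: "arr g'" "dom g' = cod g" "cod g' = dom g" "g' \<bullet> g = idn (dom g)" "g \<bullet> g' = idn (cod g)"
    using assms(2) by (rule isoE)
  note [simp] = iso_arr[OF assms(1)] iso_arr[OF assms(2)] assms(3)
  show ?thesis
  proof (rule isoI[where g = "f' \<bullet> g'"])
    show "(f' \<bullet> g') \<bullet> g \<bullet> f = idn (dom (g \<bullet> f))"
      using f g cmp_eq_cmp_assoc[OF g(4), of f] by simp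
    show "(g \<bullet> f) \<bullet> f' \<bullet> g' = idn (cod (g \<bullet> f))"
      using f g cmp_eq_cmp_assoc[OF f(5), of g'] by simp
  qed (use f g in auto)
qed

lemma iso_ten:
  assumes "iso f" "iso g"
  shows "iso (f \<boxtimes> g)"
proof -
  obtain f' where f: "arr f'" "dom f' = cod f" "cod f' = dom f" "f' \<bullet> f = idn (dom f)" "f \<bullet> f' = idn (cod f)"
    using assms(1) by (rule isoE)
  obtain g' where g: "arr g'" "dom g' = cod g" "cod g' = dom g" "g' \<bullet> g = idn (dom g)" "g \<bullet> g' = idn (cod g)"
    using assms(2) by (rule isoE)
  note arrs = iso_arr[OF assms(1)] iso_arr[OF assms(2)]
  show ?thesis
    by (rule isoI[where g = "f' \<boxtimes> g'"])
      (use f g arrs dom_obs[of f] cod_obs[of f] dom_obs[of g] cod_obs[of g] in \<open>auto simp: interchange\<close>)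
qed

lemma iso_cancel_right:
  assumes "iso k" "f \<bullet> k = g \<bullet> k" "arr f" "arr g" "dom f = cod k" "dom g = cod k"
  shows "f = g"
proof -
  obtain k' where k: "arr k'" "dom k' = cod k" "cod k' = dom k" "k \<bullet> k' = idn (cod k)"
    using assms(1) by (rule isoE)
  have "f = (f \<bullet> k) \<bullet> k'"
    using k assms(3,5) iso_arr[OF assms(1)] by simp
  also have "\<dots> = (g \<bullet> k) \<bullet> k'"
    by (simp only: assms(2))
  also have "\<dots> = g"
    using k assms(4,6) iso_arr[OF assms(1)] by simp
  finally show ?thesis .
qed

lemma iso_cancel_left:
  assumes "iso k" "k \<bullet> f = k \<bullet> g" "arr f" "arr g" "dom k = cod f" "dom k = cod g"
  shows "f = g"
proof -
  obtain k' where k: "arr k'" "dom k' = cod k" "cod k' = dom k" "k' \<bullet> k = idn (dom k)"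
    using assms(1) by (rule isoE)
  have "f = (k' \<bullet> k) \<bullet> f"
    using k assms(3,5) by simp
  also have "\<dots> = k' \<bullet> k \<bullet> f"
    using k assms(3,5) iso_arr[OF assms(1)] by (intro cmp_assoc) auto
  also have "\<dots> = k' \<bullet> k \<bullet> g"
    by (simp only: assms(2))
  also have "\<dots> = (k' \<bullet> k) \<bullet> g"
    using k assms(4,6) iso_arr[OF assms(1)] by (intro cmp_assoc[symmetric]) auto
  also have "\<dots> = g"
    using k assms(4,6) by simp
  finally show ?thesis .
qed

lemma iso_cancel_left_iff:
  "iso k \<Longrightarrow> arr f \<Longrightarrow> arr g \<Longrightarrow> dom k = cod f \<Longrightarrow> dom k = cod g \<Longrightarrow> k \<bullet> f = k \<bullet> g \<longleftrightarrow> f = g"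
  using iso_cancel_left by blast

lemma iso_cancel_right_iff:
  "iso k \<Longrightarrow> arr f \<Longrightarrow> arr g \<Longrightarrow> dom f = cod k \<Longrightarrow> dom g = cod k \<Longrightarrow> f \<bullet> k = g \<bullet> k \<longleftrightarrow> f = g"
  using iso_cancel_right by blast

text \<open>Rewriting with these rules turns an arrow into a composite of whiskered arrows \<open>idn x \<boxtimes> f \<boxtimes> idn y\<close>.\<close>

lemmas layers = idn_ten_cmp cmp_ten_idn

end


section \<open>The braiding of powers\<close>

lemma replicate_append_replicate_append:
  "replicate m x @ replicate n x @ xs = replicate (m + n) x @ xs"
  by (simp add: replicate_add)

text \<open>A normal form for words in one letter: adjacent blocks merge into one
  \<open>replicate\<close> whose length is a sorted sum, and single letters move to the front.
  Sources and targets can then be compared syntactically.\<close>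

lemmas replicate_simps = replicate_add[symmetric] replicate_append_replicate_append
  replicate_app_Cons_same add_ac

locale strict_powers = strict_monoidal_category +
  fixes V :: 'a
  assumes V_obs [simp]: "V \<in> obs"
begin

lemma set_replicate_V [simp]: "set (replicate n V) \<subseteq> obs"
  by (auto simp: set_replicate_conv_if)

abbreviation pw :: "nat \<Rightarrow> 'b" where "pw n \<equiv> idn (replicate n V)"

end

locale strict_braided_object = strict_powers +
  fixes c :: 'b
  assumes c_arr [simp]: "arr c"
    and c_dom [simp]: "dom c = [V, V]"
    and c_cod [simp]: "cod c = [V, V]"
    and c_braid: "(c \<boxtimes> idn [V]) \<bullet> (idn [V] \<boxtimes> c) \<bullet> (c \<boxtimes> idn [V]) =
      (idn [V] \<boxtimes> c) \<bullet> (c \<boxtimes> idn [V]) \<bullet> (idn [V] \<boxtimes> c)"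
begin

text \<open>\<open>sig n\<close> moves one strand past \<open>n\<close> strands and \<open>gam m n\<close> moves \<open>m\<close> strands past \<open>n\<close>
  strands. Source and target of \<open>gam m n\<close> are the same list, a power of \<open>V\<close>.\<close>

primrec sig :: "nat \<Rightarrow> 'b" where
  "sig 0 = idn [V]"
| "sig (Suc n) = (pw n \<boxtimes> c) \<bullet> (sig n \<boxtimes> idn [V])"

primrec gam :: "nat \<Rightarrow> nat \<Rightarrow> 'b" where
  "gam 0 n = pw n"
| "gam (Suc m) n = (gam m n \<boxtimes> idn [V]) \<bullet> (pw m \<boxtimes> sig n)"

lemma sig_typing [simp]:
  "arr (sig n)" "dom (sig n) = V # replicate n V" "cod (sig n) = V # replicate n V"
  by (induction n) (auto simp: replicate_simps)

lemma gam_typing [simp]: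
  "arr (gam m n)" "dom (gam m n) = replicate (m + n) V" "cod (gam m n) = replicate (m + n) V"
  by (induction m) (auto simp: replicate_simps)

lemma sig_add: "sig (m + n) = (pw m \<boxtimes> sig n) \<bullet> (sig m \<boxtimes> pw n)"
  by (induction n)
    (simp_all add: layers replicate_simps)

lemma gam_add_left: "gam (l + m) n = (gam l n \<boxtimes> pw m) \<bullet> (pw l \<boxtimes> gam m n)"
  by (induction m)
    (simp_all add: layers replicate_simps)

text \<open>The recursion of \<open>gam\<close> runs over the first block, so this law needs an
  induction on \<open>l\<close>. In the step, the crossing of the old \<open>l\<close> strands with
  the first \<open>m\<close> and the crossing of the new strand with the last \<open>n\<close> act
  on disjoint strands and are exchanged.\<close>

lemma gam_add_right: "gam l (m + n) = (pw m \<boxtimes> gam l n) \<bullet> (gam l m \<boxtimes> pw n)"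
proof (induction l)
  case (Suc l)
  have "gam (Suc l) (m + n) = (pw m \<boxtimes> gam l n \<boxtimes> idn [V]) \<bullet>
      (gam l m \<boxtimes> idn (replicate n V @ [V])) \<bullet> (idn (replicate l V @ replicate m V) \<boxtimes> sig n) \<bullet> (pw l \<boxtimes> sig m \<boxtimes> pw n)"
    by (simp add: Suc sig_add layers replicate_simps)
  also have "(gam l m \<boxtimes> idn (replicate n V @ [V])) \<bullet> (idn (replicate l V @ replicate m V) \<boxtimes> sig n) \<bullet> (pw l \<boxtimes> sig m \<boxtimes> pw n)
     = ((idn (replicate m V @ replicate l V) \<boxtimes> sig n) \<bullet> (gam l m \<boxtimes> idn (V # replicate n V))) \<bullet> (pw l \<boxtimes> sig m \<boxtimes> pw n)"
    by (rule cmp_eq_cmp_assoc, rule ten_commute) (simp_all add: replicate_simps)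
  finally show ?case
    by (simp add: layers replicate_simps)
qed (simp add: replicate_simps)


section \<open>Naturality of block crossings and the Yang-Baxter equation\<close>

lemma sig_c: "(pw n \<boxtimes> c) \<bullet> (sig n \<boxtimes> idn [V]) \<bullet> (idn [V] \<boxtimes> sig n) =
  (sig n \<boxtimes> idn [V]) \<bullet> (idn [V] \<boxtimes> sig n) \<bullet> (c \<boxtimes> pw n)"
proof (induction n)
  case (Suc n)
  \<comment> \<open>The case \<open>n = 1\<close> is the braid equation of \<open>c\<close>. On the
    word \<open>W\<close> the step uses three relations: \<open>s\<close> and \<open>b\<close> act
    on disjoint strands, \<open>a\<close> and \<open>b\<close> satisfy the braid equation, and
    \<open>ast\<close> is the induction hypothesis with one more strand on the right.\<close>
  define W where "W = V # V # V # replicate n V"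
  define a where "a = pw n \<boxtimes> c \<boxtimes> idn [V]"
  define b where "b = pw (Suc n) \<boxtimes> c"
  define s where "s = sig n \<boxtimes> idn [V, V]"
  define t where "t = idn [V] \<boxtimes> sig n \<boxtimes> idn [V]"
  define e where "e = c \<boxtimes> pw (Suc n)"
  have [simp]: "arr a" "dom a = W" "cod a = W" "arr b" "dom b = W" "cod b = W" "arr s" "dom s = W"
    "cod s = W" "arr t" "dom t = W" "cod t = W" "arr e" "dom e = W" "cod e = W"
    by (simp_all add: W_def a_def b_def s_def t_def e_def replicate_simps)
  have sb: "s \<bullet> b = b \<bullet> s"
    unfolding s_def b_def by (rule ten_commute) (simp_all add: replicate_simps)
  have aba: "a \<bullet> b \<bullet> a = b \<bullet> a \<bullet> b"
    using arg_cong[OF c_braid, of "\<lambda>f. pw n \<boxtimes> f"]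
    by (simp add: a_def b_def layers replicate_simps)
  have ast: "a \<bullet> s \<bullet> t = s \<bullet> t \<bullet> e"
    using arg_cong[OF Suc, of "\<lambda>f. f \<boxtimes> idn [V]"]
    by (simp add: a_def s_def t_def e_def layers replicate_simps)
  have "b \<bullet> a \<bullet> s \<bullet> b \<bullet> t = b \<bullet> a \<bullet> b \<bullet> s \<bullet> t"
    by (simp add: cmp_eq_cmp_assoc[OF sb])
  also have "\<dots> = (b \<bullet> a \<bullet> b) \<bullet> s \<bullet> t"
    by simp
  also have "\<dots> = a \<bullet> b \<bullet> a \<bullet> s \<bullet> t"
    by (simp add: aba[symmetric])
  also have "\<dots> = a \<bullet> (b \<bullet> s) \<bullet> t \<bullet> e"
    by (simp add: ast)
  also have "\<dots> = a \<bullet> s \<bullet> b \<bullet> t \<bullet> e"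
    by (simp add: sb[symmetric])
  finally show ?case
    by (simp add: a_def b_def s_def t_def e_def layers replicate_simps)
qed simp

text \<open>An endomorphism of a power of \<open>V\<close> that can be slid through a block of \<open>n\<close> strands. Such arrows are
  closed under composition and whiskering, so they include every \<open>gam l m\<close>; for these, naturality is the
  Yang--Baxter equation.\<close>

definition gam_natural :: "nat \<Rightarrow> nat \<Rightarrow> 'b \<Rightarrow> bool" where
  "gam_natural n k t \<longleftrightarrow> arr t \<and> dom t = replicate k V \<and> cod t = replicate k V \<and>
     (pw n \<boxtimes> t) \<bullet> gam k n = gam k n \<bullet> (t \<boxtimes> pw n)"

lemma gam_natural_cmp:
  assumes "gam_natural n k s" "gam_natural n k t"
  shows "gam_natural n k (s \<bullet> t)"
proof -
  have [simp]: "arr s" "dom s = replicate k V" "cod s = replicate k V"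
    "arr t" "dom t = replicate k V" "cod t = replicate k V"
    and s: "(pw n \<boxtimes> s) \<bullet> gam k n = gam k n \<bullet> (s \<boxtimes> pw n)"
    and t: "(pw n \<boxtimes> t) \<bullet> gam k n = gam k n \<bullet> (t \<boxtimes> pw n)"
    using assms by (auto simp: gam_natural_def)
  have "(pw n \<boxtimes> (s \<bullet> t)) \<bullet> gam k n = (pw n \<boxtimes> s) \<bullet> gam k n \<bullet> (t \<boxtimes> pw n)"
    by (simp add: layers replicate_simps t)
  also have "\<dots> = (gam k n \<bullet> (s \<boxtimes> pw n)) \<bullet> (t \<boxtimes> pw n)"
    by (rule cmp_eq_cmp_assoc[OF s]) (simp_all add: replicate_simps)
  also have "\<dots> = gam k n \<bullet> ((s \<bullet> t) \<boxtimes> pw n)"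
    by (simp add: layers replicate_simps)
  finally show ?thesis
    by (simp add: gam_natural_def)
qed

text \<open>By \<open>gam_add_left\<close> the crossing splits in two. The arrow \<open>t\<close>
  passes the crossing of the last \<open>k\<close> strands by assumption and commutes with that of
  the first \<open>j\<close>, which it does not touch.\<close>

lemma gam_natural_ten_left:
  assumes "gam_natural n k t"
  shows "gam_natural n (j + k) (pw j \<boxtimes> t)"
proof -
  have [simp]: "arr t" "dom t = replicate k V" "cod t = replicate k V"
    and t: "(pw n \<boxtimes> t) \<bullet> gam k n = gam k n \<bullet> (t \<boxtimes> pw n)"
    using assms by (auto simp: gam_natural_def)
  have t': "(pw (n + j) \<boxtimes> t) \<bullet> (pw j \<boxtimes> gam k n) = (pw j \<boxtimes> gam k n) \<bullet> (pw j \<boxtimes> t \<boxtimes> pw n)"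
    using arg_cong[OF t, of "\<lambda>f. pw j \<boxtimes> f"] by (simp add: layers replicate_simps)
  have com: "(pw (n + j) \<boxtimes> t) \<bullet> (gam j n \<boxtimes> pw k) = (gam j n \<boxtimes> pw k) \<bullet> (pw (n + j) \<boxtimes> t)"
    by (rule ten_commute[symmetric]) (simp_all add: replicate_simps)
  have "(pw n \<boxtimes> pw j \<boxtimes> t) \<bullet> gam (j + k) n =
      (pw (n + j) \<boxtimes> t) \<bullet> (gam j n \<boxtimes> pw k) \<bullet> (pw j \<boxtimes> gam k n)"
    by (simp add: gam_add_left replicate_simps)
  also have "\<dots> = ((gam j n \<boxtimes> pw k) \<bullet> (pw (n + j) \<boxtimes> t)) \<bullet> (pw j \<boxtimes> gam k n)"
    by (rule cmp_eq_cmp_assoc[OF com]) (simp_all add: replicate_simps)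
  also have "\<dots> = (gam j n \<boxtimes> pw k) \<bullet> (pw j \<boxtimes> gam k n) \<bullet> (pw j \<boxtimes> t \<boxtimes> pw n)"
    by (simp add: replicate_simps t'[simplified replicate_simps])
  also have "\<dots> = gam (j + k) n \<bullet> ((pw j \<boxtimes> t) \<boxtimes> pw n)"
    by (simp add: gam_add_left replicate_simps)
  finally show ?thesis
    by (simp add: gam_natural_def replicate_simps)
qed

lemma gam_natural_ten_right:
  assumes "gam_natural n k t"
  shows "gam_natural n (k + j) (t \<boxtimes> pw j)"
proof -
  have [simp]: "arr t" "dom t = replicate k V" "cod t = replicate k V"
    and t: "(pw n \<boxtimes> t) \<bullet> gam k n = gam k n \<bullet> (t \<boxtimes> pw n)"
    using assms by (auto simp: gam_natural_def)
  have t': "(pw n \<boxtimes> t \<boxtimes> pw j) \<bullet> (gam k n \<boxtimes> pw j) = (gam k n \<boxtimes> pw j) \<bullet> (t \<boxtimes> pw (n + j))"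
    using arg_cong[OF t, of "\<lambda>f. f \<boxtimes> pw j"] by (simp add: layers replicate_simps)
  have com: "(t \<boxtimes> pw (n + j)) \<bullet> (pw k \<boxtimes> gam j n) = (pw k \<boxtimes> gam j n) \<bullet> (t \<boxtimes> pw (n + j))"
    by (rule ten_commute) (simp_all add: replicate_simps)
  have "(pw n \<boxtimes> t \<boxtimes> pw j) \<bullet> gam (k + j) n =
      (pw n \<boxtimes> t \<boxtimes> pw j) \<bullet> (gam k n \<boxtimes> pw j) \<bullet> (pw k \<boxtimes> gam j n)"
    by (simp only: gam_add_left)
  also have "\<dots> = ((gam k n \<boxtimes> pw j) \<bullet> (t \<boxtimes> pw (n + j))) \<bullet> (pw k \<boxtimes> gam j n)"
    by (rule cmp_eq_cmp_assoc[OF t']) (simp_all add: replicate_simps)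
  also have "\<dots> = (gam k n \<boxtimes> pw j) \<bullet> (t \<boxtimes> pw (n + j)) \<bullet> (pw k \<boxtimes> gam j n)"
    by (simp add: replicate_simps)
  also have "\<dots> = (gam k n \<boxtimes> pw j) \<bullet> (pw k \<boxtimes> gam j n) \<bullet> (t \<boxtimes> pw (n + j))"
    by (simp only: com)
  also have "\<dots> = gam (k + j) n \<bullet> ((t \<boxtimes> pw j) \<boxtimes> pw n)"
    unfolding gam_add_left[of k j n] by (simp add: replicate_simps)
  finally show ?thesis
    by (simp add: gam_natural_def replicate_simps)
qed

lemma gam_natural_c: "gam_natural n 2 c"
  using sig_c[of n] by (simp add: gam_natural_def numeral_2_eq_2 replicate_simps)

lemma gam_natural_sig: "gam_natural n (Suc m) (sig m)"
proof (induction m)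
  case (Suc m)
  have "gam_natural n (Suc (Suc m)) (pw m \<boxtimes> c)"
    using gam_natural_ten_left[OF gam_natural_c, of n m] by simp
  moreover have "gam_natural n (Suc (Suc m)) (sig m \<boxtimes> idn [V])"
    using gam_natural_ten_right[OF Suc, of 1] by simp
  ultimately show ?case
    by (simp add: gam_natural_cmp)
qed (simp add: gam_natural_def replicate_simps)

lemma gam_natural_gam: "gam_natural n (l + m) (gam l m)"
proof (induction l)
  case (Suc l)
  have "gam_natural n (Suc (l + m)) (gam l m \<boxtimes> idn [V])"
    using gam_natural_ten_right[OF Suc, of 1] by simp
  moreover have "gam_natural n (Suc (l + m)) (pw l \<boxtimes> sig m)"
    using gam_natural_ten_left[OF gam_natural_sig, of n l m] by simp
  ultimately show ?case
    by (simp add: gam_natural_cmp)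
qed (simp add: gam_natural_def replicate_simps)

lemma gam_yang_baxter:
  "(pw n \<boxtimes> gam l m) \<bullet> (gam l n \<boxtimes> pw m) \<bullet> (pw l \<boxtimes> gam m n) =
   (gam m n \<boxtimes> pw l) \<bullet> (pw m \<boxtimes> gam l n) \<bullet> (gam l m \<boxtimes> pw n)"
proof -
  \<comment> \<open>The same crossing is written with \<open>l + m\<close> on the left and
    \<open>m + l\<close> on the right, so that \<open>gam_add_left\<close> splits it in the order
    that each side of the goal requires.\<close>
  have "(pw n \<boxtimes> gam l m) \<bullet> gam (l + m) n = gam (m + l) n \<bullet> (gam l m \<boxtimes> pw n)"
    using gam_natural_gam[of n l m] by (simp add: gam_natural_def add_ac)
  then show ?thesis
    unfolding gam_add_left by (simp add: replicate_simps)
qed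

lemma gam_0_right [simp]: "gam n 0 = pw n"
  by (induction n) (simp_all add: replicate_simps)

lemma gam_1_1: "gam 1 1 = c"
  by simp

text \<open>The additivity laws for nonempty blocks reproduce the two recursions:
  \<open>add_right\<close> builds \<open>sig n\<close> from \<open>c\<close>, and then
  \<open>add_left\<close> builds \<open>gam m n\<close> from \<open>sig n\<close>. Empty blocks are
  settled by the unit equations, whence the case distinctions at 0.\<close>

lemma gam_unique:
  assumes typing: "\<And>m n. arr (G m n)" "\<And>m n. dom (G m n) = replicate (m + n) V"
      "\<And>m n. cod (G m n) = replicate (m + n) V"
    and add_left: "\<And>l m n. l \<noteq> 0 \<Longrightarrow> m \<noteq> 0 \<Longrightarrow> G (l + m) n = (G l n \<boxtimes> pw m) \<bullet> (pw l \<boxtimes> G m n)"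
    and add_right: "\<And>l m n. m \<noteq> 0 \<Longrightarrow> n \<noteq> 0 \<Longrightarrow> G l (m + n) = (pw m \<boxtimes> G l n) \<bullet> (G l m \<boxtimes> pw n)"
    and "\<And>n. G 0 n = pw n" "\<And>n. G n 0 = pw n" "G 1 1 = c"
  shows "G = gam"
proof -
  have G1: "G 1 n = sig n" for n
  proof (induction n)
    case (Suc n)
    then show ?case
      using assms(8) add_right[of n 1 1] by (cases "n = 0") simp_all
  qed (simp add: assms)
  have "G m n = gam m n" for m n
  proof (induction m)
    case (Suc m)
    then show ?case
      using G1 add_left[of m 1 n] by (cases "m = 0") (simp_all add: replicate_simps)
  qed (simp add: assms)
  then show ?thesis by blast
qed

lemma iso_gam:
  assumes "iso c"
  shows "iso (gam m n)"
proof -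
  have iso_sig: "iso (sig k)" for k
    by (induction k) (auto simp: replicate_simps intro!: iso_cmp iso_ten iso_idn assms)
  show ?thesis
    by (induction m) (auto simp: replicate_simps intro!: iso_cmp iso_ten iso_idn iso_sig)
qed

end

section \<open>The tensor algebra in a strict monoidal category\<close>

context strict_monoidal_category
begin

section \<open>Algebras, braided algebras and iterated multiplication\<close>

definition algebra :: "'a \<Rightarrow> 'b \<Rightarrow> 'b \<Rightarrow> bool" where
  "algebra A m u \<longleftrightarrow>
     arr m \<and> dom m = [A, A] \<and> cod m = [A] \<and> arr u \<and> dom u = [] \<and> cod u = [A] \<and>
     m \<bullet> (m \<boxtimes> idn [A]) = m \<bullet> (idn [A] \<boxtimes> m) \<and>
     m \<bullet> (u \<boxtimes> idn [A]) = idn [A] \<and> m \<bullet> (idn [A] \<boxtimes> u) = idn [A]"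

definition braided_object :: "'a \<Rightarrow> 'b \<Rightarrow> bool" where
  "braided_object V c \<longleftrightarrow> dom c = [V, V] \<and> cod c = [V, V] \<and> iso c \<and>
     (c \<boxtimes> idn [V]) \<bullet> (idn [V] \<boxtimes> c) \<bullet> (c \<boxtimes> idn [V]) =
     (idn [V] \<boxtimes> c) \<bullet> (c \<boxtimes> idn [V]) \<bullet> (idn [V] \<boxtimes> c)"

definition braided_algebra :: "'a \<Rightarrow> 'b \<Rightarrow> 'b \<Rightarrow> 'b \<Rightarrow> bool" where
  "braided_algebra A m u c \<longleftrightarrow> algebra A m u \<and> braided_object A c \<and>
     c \<bullet> (m \<boxtimes> idn [A]) = (idn [A] \<boxtimes> m) \<bullet> (c \<boxtimes> idn [A]) \<bullet> (idn [A] \<boxtimes> c) \<and>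
     c \<bullet> (idn [A] \<boxtimes> m) = (m \<boxtimes> idn [A]) \<bullet> (idn [A] \<boxtimes> c) \<bullet> (c \<boxtimes> idn [A]) \<and>
     c \<bullet> (u \<boxtimes> idn [A]) = idn [A] \<boxtimes> u \<and> c \<bullet> (idn [A] \<boxtimes> u) = u \<boxtimes> idn [A]"

text \<open>In contrast to \<open>iter_mult\<close> there is no separate clause at 1:
  \<open>iter m u g 1\<close> is \<open>m \<bullet> (u \<boxtimes> g)\<close>, which equals
  \<open>g\<close> by the left unit law of an algebra. One step rule then serves all
  inductions.\<close>

primrec iter :: "'b \<Rightarrow> 'b \<Rightarrow> 'b \<Rightarrow> nat \<Rightarrow> 'b" where
  "iter m u g 0 = u"
| "iter m u g (Suc n) = m \<bullet> (iter m u g n \<boxtimes> g)"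

primrec power_arr :: "'b \<Rightarrow> nat \<Rightarrow> 'b" where
  "power_arr f 0 = idn []"
| "power_arr f (Suc n) = power_arr f n \<boxtimes> f"

lemma iter_typing:
  assumes "algebra A m u" "arr g" "dom g = [V]" "cod g = [A]"
  shows "arr (iter m u g n)" "dom (iter m u g n) = replicate n V" "cod (iter m u g n) = [A]"
  using assms by (induction n) (auto simp: algebra_def replicate_append_same)

lemma power_arr_typing:
  assumes "arr f" "dom f = [V]" "cod f = [W]"
  shows "arr (power_arr f n)" "dom (power_arr f n) = replicate n V" "cod (power_arr f n) = replicate n W"
  using assms by (induction n) (auto simp: replicate_append_same)

text \<open>Induction on \<open>b\<close>: the base case is the right unit law, and associativity
  detaches the last factor \<open>g\<close> in the step.\<close>

lemma mult_iter:
  assumes alg: "algebra A m u" and g: "arr g" "dom g = [V]" "cod g = [A]"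
  shows "m \<bullet> (iter m u g a \<boxtimes> iter m u g b) = iter m u g (a + b)"
proof -
  let ?x = "iter m u g"
  note [simp] = g iter_typing[OF alg g]
  have [simp]: "arr m" "dom m = [A, A]" "cod m = [A]" "arr u" "dom u = []" "cod u = [A]" "A \<in> obs"
    and assoc: "m \<bullet> (m \<boxtimes> idn [A]) = m \<bullet> (idn [A] \<boxtimes> m)" and unit: "m \<bullet> (idn [A] \<boxtimes> u) = idn [A]"
    using alg cod_obs[of m] by (auto simp: algebra_def)
  show ?thesis
  proof (induction b)
    case 0
    have "m \<bullet> (?x a \<boxtimes> u) = m \<bullet> (idn [A] \<boxtimes> u) \<bullet> ?x a"
      using interchange[of "?x a" "idn [A]" "idn []" u] by simp
    then show ?case
      using cmp_eq_cmp_assoc[OF unit, of "?x a"] by simp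
  next
    case (Suc b)
    have "m \<bullet> (?x a \<boxtimes> ?x (Suc b)) = m \<bullet> (idn [A] \<boxtimes> m) \<bullet> (?x a \<boxtimes> ?x b \<boxtimes> g)"
      by (simp add: interchange)
    also have "\<dots> = m \<bullet> (m \<boxtimes> idn [A]) \<bullet> (?x a \<boxtimes> ?x b \<boxtimes> g)"
      using cmp_eq_cmp_assoc[OF assoc, of "?x a \<boxtimes> ?x b \<boxtimes> g"] by simp
    also have "\<dots> = m \<bullet> ((m \<bullet> (?x a \<boxtimes> ?x b)) \<boxtimes> g)"
      using interchange[of "?x a \<boxtimes> ?x b" m g "idn [A]"] by simp
    finally show ?case
      by (simp add: Suc)
  qed
qed

text \<open>With the injections of the tensor algebra of \<open>W\<close> for \<beta>, the
  components of \<open>T f\<close> are those of the extension of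
  \<open>\<beta> 1 \<bullet> f\<close>. The action of the tensor algebra on arrows thus becomes an
  instance of its universal property.\<close>

lemma power_arr_iter:
  assumes f: "arr f" "dom f = [V]" "cod f = [W]"
    and m: "arr m" "dom m = [A, A]" "cod m = [A]"
    and \<beta>: "\<And>n. arr (\<beta> n)" "\<And>n. dom (\<beta> n) = replicate n W" "\<And>n. cod (\<beta> n) = [A]"
    and \<beta>_Suc: "\<And>n. m \<bullet> (\<beta> n \<boxtimes> \<beta> 1) = \<beta> (Suc n)"
  shows "\<beta> n \<bullet> power_arr f n = iter m (\<beta> 0) (\<beta> 1 \<bullet> f) n"
proof (induction n)
  note [simp] = f m \<beta> power_arr_typing[OF f]
  case (Suc n)
  have "\<beta> (Suc n) \<bullet> power_arr f (Suc n) = (m \<bullet> (\<beta> n \<boxtimes> \<beta> 1)) \<bullet> (power_arr f n \<boxtimes> f)"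
    by (simp only: \<beta>_Suc power_arr.simps)
  also have "\<dots> = m \<bullet> (\<beta> n \<boxtimes> \<beta> 1) \<bullet> (power_arr f n \<boxtimes> f)"
    by (rule cmp_assoc) (simp_all add: replicate_append_same)
  also have "\<dots> = m \<bullet> (iter m (\<beta> 0) (\<beta> 1 \<bullet> f) n \<boxtimes> (\<beta> 1 \<bullet> f))"
    using Suc by (subst interchange) simp_all
  finally show ?case
    by simp
qed (use \<beta>[of 0] in simp)

end

text \<open>The condition \<open>c\<^sub>B \<bullet> (g \<boxtimes> g) = (g \<boxtimes> g) \<bullet> c\<close> propagates from the generator to all powers, by peeling
  off one factor at a time with the compatibility of \<open>c\<^sub>B\<close> and the multiplication.\<close>

lemma (in strict_braided_object) iter_braided:
  assumes B: "braided_algebra A m u d" and g: "arr g" "dom g = [V]" "cod g = [A]"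
    and braided: "d \<bullet> (g \<boxtimes> g) = (g \<boxtimes> g) \<bullet> c"
  shows "d \<bullet> (iter m u g a \<boxtimes> iter m u g b) = (iter m u g b \<boxtimes> iter m u g a) \<bullet> gam a b"
proof -
  let ?x = "iter m u g"
  have alg: "algebra A m u" using B by (simp add: braided_algebra_def)
  note [simp] = g iter_typing[OF alg g]
  have [simp]: "arr m" "dom m = [A, A]" "cod m = [A]" "arr u" "dom u = []" "cod u = [A]" "A \<in> obs"
    using alg cod_obs[of m] by (auto simp: algebra_def)
  have [simp]: "arr d" "dom d = [A, A]" "cod d = [A, A]"
    and dm: "d \<bullet> (m \<boxtimes> idn [A]) = (idn [A] \<boxtimes> m) \<bullet> (d \<boxtimes> idn [A]) \<bullet> (idn [A] \<boxtimes> d)"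
    and md: "d \<bullet> (idn [A] \<boxtimes> m) = (m \<boxtimes> idn [A]) \<bullet> (idn [A] \<boxtimes> d) \<bullet> (d \<boxtimes> idn [A])"
    and du: "d \<bullet> (u \<boxtimes> idn [A]) = idn [A] \<boxtimes> u" and ud: "d \<bullet> (idn [A] \<boxtimes> u) = u \<boxtimes> idn [A]"
    using B iso_arr[of d] by (auto simp: braided_algebra_def braided_object_def)
  \<comment> \<open>A single factor \<open>g\<close> crosses all powers first; this provides the
    crossing \<open>sig b\<close> that the recursion of \<open>gam\<close> asks for in the induction
    on \<open>a\<close>.\<close>
  have gx: "d \<bullet> (g \<boxtimes> ?x b) = (?x b \<boxtimes> g) \<bullet> sig b" for b
  proof (induction b)
    case 0
    have "d \<bullet> (g \<boxtimes> u) = d \<bullet> (idn [A] \<boxtimes> u) \<bullet> g"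
      using interchange[of g "idn [A]" "idn []" u] by simp
    also have "\<dots> = (u \<boxtimes> idn [A]) \<bullet> g"
      using cmp_eq_cmp_assoc[OF ud, of g] by simp
    also have "\<dots> = u \<boxtimes> g"
      using interchange[of "idn []" u g "idn [A]"] by simp
    finally show ?case by simp
  next
    case (Suc b)
    have "d \<bullet> (g \<boxtimes> ?x (Suc b)) = d \<bullet> (idn [A] \<boxtimes> m) \<bullet> (g \<boxtimes> ?x b \<boxtimes> g)"
      by (simp add: interchange)
    also have "\<dots> = (m \<boxtimes> idn [A]) \<bullet> (idn [A] \<boxtimes> d) \<bullet> (d \<boxtimes> idn [A]) \<bullet> (g \<boxtimes> ?x b \<boxtimes> g)"
      using cmp_eq_cmp_assoc[OF md, of "g \<boxtimes> ?x b \<boxtimes> g"] by simp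
    also have "(d \<boxtimes> idn [A]) \<bullet> (g \<boxtimes> ?x b \<boxtimes> g) = (?x b \<boxtimes> g \<boxtimes> g) \<bullet> (sig b \<boxtimes> idn [V])"
      using slide_left[OF Suc, where z = g] by (simp add: replicate_simps)
    also have "(idn [A] \<boxtimes> d) \<bullet> \<dots> = ((?x b \<boxtimes> g \<boxtimes> g) \<bullet> (pw b \<boxtimes> c)) \<bullet> (sig b \<boxtimes> idn [V])"
      using slide_right[OF braided, where z = "?x b"]
      by (intro cmp_eq_cmp_assoc) (simp_all add: replicate_simps)
    also have "(m \<boxtimes> idn [A]) \<bullet> \<dots> = ((m \<boxtimes> idn [A]) \<bullet> (?x b \<boxtimes> g \<boxtimes> g)) \<bullet> sig (Suc b)"
      by (simp add: replicate_simps)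
    also have "(m \<boxtimes> idn [A]) \<bullet> (?x b \<boxtimes> g \<boxtimes> g) = ?x (Suc b) \<boxtimes> g"
      using interchange[of "?x b \<boxtimes> g" m g "idn [A]"] by simp
    finally show ?case .
  qed
  show ?thesis
  proof (induction a)
    case 0
    have "d \<bullet> (u \<boxtimes> ?x b) = d \<bullet> (u \<boxtimes> idn [A]) \<bullet> ?x b"
      using interchange[of "idn []" u "?x b" "idn [A]"] by simp
    also have "\<dots> = (idn [A] \<boxtimes> u) \<bullet> ?x b"
      using cmp_eq_cmp_assoc[OF du, of "?x b"] by simp
    also have "\<dots> = ?x b \<boxtimes> u"
      using interchange[of "?x b" "idn [A]" "idn []" u] by simp
    finally show ?case by simp
  next
    case (Suc a)
    have "d \<bullet> (?x (Suc a) \<boxtimes> ?x b) = d \<bullet> (m \<boxtimes> idn [A]) \<bullet> (?x a \<boxtimes> g \<boxtimes> ?x b)"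
      using interchange[of "?x a \<boxtimes> g" m "?x b" "idn [A]"] by simp
    also have "\<dots> = (idn [A] \<boxtimes> m) \<bullet> (d \<boxtimes> idn [A]) \<bullet> (idn [A] \<boxtimes> d) \<bullet> (?x a \<boxtimes> g \<boxtimes> ?x b)"
      using cmp_eq_cmp_assoc[OF dm, of "?x a \<boxtimes> g \<boxtimes> ?x b"] by simp
    also have "(idn [A] \<boxtimes> d) \<bullet> (?x a \<boxtimes> g \<boxtimes> ?x b) = (?x a \<boxtimes> ?x b \<boxtimes> g) \<bullet> (pw a \<boxtimes> sig b)"
      using slide_right[OF gx, where z = "?x a"] by (simp add: replicate_simps)
    also have "(d \<boxtimes> idn [A]) \<bullet> \<dots> = ((?x b \<boxtimes> ?x a \<boxtimes> g) \<bullet> (gam a b \<boxtimes> idn [V])) \<bullet> (pw a \<boxtimes> sig b)"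
      using slide_left[OF Suc, where z = g]
      by (intro cmp_eq_cmp_assoc) (simp_all add: replicate_simps)
    also have "(idn [A] \<boxtimes> m) \<bullet> \<dots> = ((idn [A] \<boxtimes> m) \<bullet> (?x b \<boxtimes> ?x a \<boxtimes> g)) \<bullet> gam (Suc a) b"
      by (simp add: replicate_simps)
    also have "(idn [A] \<boxtimes> m) \<bullet> (?x b \<boxtimes> ?x a \<boxtimes> g) = ?x b \<boxtimes> ?x (Suc a)"
      by (simp add: interchange)
    finally show ?case .
  qed
qed

text \<open>Preservation of the coproduct is assumed with arbitrary words on both sides. With powers
  of \<open>V\<close> and copies of \<open>S\<close> as these words, arrows out of products of
  several copies of \<open>S\<close> are handled one factor at a time.\<close>

locale strict_tensor_algebra = strict_powers +
  fixes S :: 'a and \<alpha> :: "nat \<Rightarrow> 'b"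
  assumes \<alpha>_arr [simp]: "arr (\<alpha> n)"
    and \<alpha>_dom [simp]: "dom (\<alpha> n) = replicate n V"
    and \<alpha>_cod [simp]: "cod (\<alpha> n) = [S]"
    and coproduct: "set x \<subseteq> obs \<Longrightarrow> set y \<subseteq> obs \<Longrightarrow> set z \<subseteq> obs \<Longrightarrow> (\<And>n. arr (g n)) \<Longrightarrow>
      (\<And>n. dom (g n) = x @ replicate n V @ y) \<Longrightarrow> (\<And>n. cod (g n) = z) \<Longrightarrow>
      \<exists>!h. arr h \<and> dom h = x @ [S] @ y \<and> cod h = z \<and> (\<forall>n. h \<bullet> (idn x \<boxtimes> \<alpha> n \<boxtimes> idn y) = g n)"
begin

lemma S_obs [simp]: "S \<in> obs"
  using cod_obs[of "\<alpha> 0"] by simp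

lemma \<alpha>_epi_whiskered:
  assumes "set x \<subseteq> obs" "set y \<subseteq> obs" "arr f" "arr g" "dom f = x @ [S] @ y" "dom g = x @ [S] @ y" "cod f = cod g"
    and "\<And>n. f \<bullet> (idn x \<boxtimes> \<alpha> n \<boxtimes> idn y) = g \<bullet> (idn x \<boxtimes> \<alpha> n \<boxtimes> idn y)"
  shows "f = g"
proof -
  have "\<exists>!h. arr h \<and> dom h = x @ [S] @ y \<and> cod h = cod g \<and>
      (\<forall>n. h \<bullet> (idn x \<boxtimes> \<alpha> n \<boxtimes> idn y) = g \<bullet> (idn x \<boxtimes> \<alpha> n \<boxtimes> idn y))"
    by (rule coproduct) (use assms cod_obs in auto)
  moreover have "arr f \<and> dom f = x @ [S] @ y \<and> cod f = cod g \<and>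
      (\<forall>n. f \<bullet> (idn x \<boxtimes> \<alpha> n \<boxtimes> idn y) = g \<bullet> (idn x \<boxtimes> \<alpha> n \<boxtimes> idn y))"
    using assms by blast
  ultimately show ?thesis
    using assms by blast
qed

lemma \<alpha>_epi:
  assumes "arr f" "arr g" "dom f = [S]" "dom g = [S]" "cod f = cod g" "\<And>n. f \<bullet> \<alpha> n = g \<bullet> \<alpha> n"
  shows "f = g"
  using \<alpha>_epi_whiskered[of "[]" "[]" f g] assms by simp

text \<open>The arrow \<open>\<alpha> m \<boxtimes> \<alpha> n\<close> is
  \<open>\<alpha> m \<boxtimes> idn [S]\<close> after \<open>pw m \<boxtimes> \<alpha> n\<close>,
  and each of these two whiskered families is jointly epic.\<close>

lemma \<alpha>2_epi:
  assumes "arr f" "arr g" "dom f = [S, S]" "dom g = [S, S]" "cod f = cod g"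
    and "\<And>m n. f \<bullet> (\<alpha> m \<boxtimes> \<alpha> n) = g \<bullet> (\<alpha> m \<boxtimes> \<alpha> n)"
  shows "f = g"
proof (rule \<alpha>_epi_whiskered[of "[]" "[S]"])
  fix m
  have "f \<bullet> (\<alpha> m \<boxtimes> idn [S]) = g \<bullet> (\<alpha> m \<boxtimes> idn [S])"
  proof (rule \<alpha>_epi_whiskered[of "replicate m V" "[]"])
    fix n
    have "(\<alpha> m \<boxtimes> idn [S]) \<bullet> (pw m \<boxtimes> \<alpha> n) = \<alpha> m \<boxtimes> \<alpha> n"
      by (simp add: interchange)
    then show "(f \<bullet> (\<alpha> m \<boxtimes> idn [S])) \<bullet> (pw m \<boxtimes> \<alpha> n \<boxtimes> idn []) =
        (g \<bullet> (\<alpha> m \<boxtimes> idn [S])) \<bullet> (pw m \<boxtimes> \<alpha> n \<boxtimes> idn [])"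
      using assms by simp
  qed (use assms in auto)
  then show "f \<bullet> (idn [] \<boxtimes> \<alpha> m \<boxtimes> idn [S]) = g \<bullet> (idn [] \<boxtimes> \<alpha> m \<boxtimes> idn [S])"
    by simp
qed (use assms in auto)

lemma \<alpha>3_epi:
  assumes "arr f" "arr g" "dom f = [S, S, S]" "dom g = [S, S, S]" "cod f = cod g"
    and "\<And>l m n. f \<bullet> (\<alpha> l \<boxtimes> \<alpha> m \<boxtimes> \<alpha> n) = g \<bullet> (\<alpha> l \<boxtimes> \<alpha> m \<boxtimes> \<alpha> n)"
  shows "f = g"
proof (rule \<alpha>_epi_whiskered[of "[]" "[S, S]"])
  fix l
  have "f \<bullet> (\<alpha> l \<boxtimes> idn [S, S]) = g \<bullet> (\<alpha> l \<boxtimes> idn [S, S])"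
  proof (rule \<alpha>_epi_whiskered[of "replicate l V" "[S]"])
    fix m
    have "(f \<bullet> (\<alpha> l \<boxtimes> idn [S, S])) \<bullet> (pw l \<boxtimes> \<alpha> m \<boxtimes> idn [S]) =
        (g \<bullet> (\<alpha> l \<boxtimes> idn [S, S])) \<bullet> (pw l \<boxtimes> \<alpha> m \<boxtimes> idn [S])"
    proof (rule \<alpha>_epi_whiskered[of "replicate l V @ replicate m V" "[]"])
      fix n
      have "(\<alpha> l \<boxtimes> idn [S, S]) \<bullet> (pw l \<boxtimes> \<alpha> m \<boxtimes> idn [S]) \<bullet> (pw l \<boxtimes> pw m \<boxtimes> \<alpha> n) = \<alpha> l \<boxtimes> \<alpha> m \<boxtimes> \<alpha> n"
        \<comment> \<open>The identities on the first two blocks have to stay separate factors here,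
          since the interchange law pairs factors with matching boundaries.\<close>
        using interchange[of "pw l" "\<alpha> l" "\<alpha> m \<boxtimes> \<alpha> n" "idn [S, S]"]
        by (simp add: interchange del: idn_ten_idn_ten)
      then show "((f \<bullet> (\<alpha> l \<boxtimes> idn [S, S])) \<bullet> (pw l \<boxtimes> \<alpha> m \<boxtimes> idn [S])) \<bullet>
            (idn (replicate l V @ replicate m V) \<boxtimes> \<alpha> n \<boxtimes> idn []) =
          ((g \<bullet> (\<alpha> l \<boxtimes> idn [S, S])) \<bullet> (pw l \<boxtimes> \<alpha> m \<boxtimes> idn [S])) \<bullet>
            (idn (replicate l V @ replicate m V) \<boxtimes> \<alpha> n \<boxtimes> idn [])"
        using assms by simp
    qed (use assms in auto)
    then show "(f \<bullet> (\<alpha> l \<boxtimes> idn [S, S])) \<bullet> (pw l \<boxtimes> \<alpha> m \<boxtimes> idn [S]) =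
        (g \<bullet> (\<alpha> l \<boxtimes> idn [S, S])) \<bullet> (pw l \<boxtimes> \<alpha> m \<boxtimes> idn [S])" .
  qed (use assms in auto)
  then show "f \<bullet> (idn [] \<boxtimes> \<alpha> l \<boxtimes> idn [S, S]) = g \<bullet> (idn [] \<boxtimes> \<alpha> l \<boxtimes> idn [S, S])"
    by simp
qed (use assms in auto)

text \<open>For fixed \<open>m\<close> the components assemble over \<open>n\<close> to an arrow
  \<open>k m\<close> out of the m-th power followed by \<open>S\<close>; the arrows
  \<open>k m\<close> then assemble over \<open>m\<close>.\<close>

lemma ex1_from_S2:
  assumes z: "set z \<subseteq> obs" and g: "\<And>m n. arr (g m n)" "\<And>m n. dom (g m n) = replicate (m + n) V" "\<And>m n. cod (g m n) = z"
  shows "\<exists>!h. arr h \<and> dom h = [S, S] \<and> cod h = z \<and> (\<forall>m n. h \<bullet> (\<alpha> m \<boxtimes> \<alpha> n) = g m n)"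
proof -
  have "\<exists>h. arr h \<and> dom h = replicate m V @ [S] \<and> cod h = z \<and> (\<forall>n. h \<bullet> (pw m \<boxtimes> \<alpha> n) = g m n)" for m
    using coproduct[of "replicate m V" "[]" z "g m"] z g by (auto simp: replicate_add)
  then obtain k where k: "arr (k m)" "dom (k m) = replicate m V @ [S]" "cod (k m) = z"
    "k m \<bullet> (pw m \<boxtimes> \<alpha> n) = g m n" for m n
    by metis
  obtain h where h: "arr h" "dom h = [S, S]" "cod h = z" "\<And>m. h \<bullet> (\<alpha> m \<boxtimes> idn [S]) = k m"
    using coproduct[of "[]" "[S]" z k] z k by auto
  have "h \<bullet> (\<alpha> m \<boxtimes> \<alpha> n) = g m n" for m n
  proof -
    have "h \<bullet> (\<alpha> m \<boxtimes> \<alpha> n) = h \<bullet> (\<alpha> m \<boxtimes> idn [S]) \<bullet> (pw m \<boxtimes> \<alpha> n)"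
      by (simp add: interchange)
    also have "\<dots> = k m \<bullet> (pw m \<boxtimes> \<alpha> n)"
      by (rule cmp_eq_cmp_assoc) (use h in auto)
    finally show ?thesis by (simp add: k)
  qed
  with h show ?thesis
    using \<alpha>2_epi by (intro ex1I[of _ h]) auto
qed

lemma mult_ex1:
  "\<exists>!\<mu>. arr \<mu> \<and> dom \<mu> = [S, S] \<and> cod \<mu> = [S] \<and> (\<forall>m n. \<mu> \<bullet> (\<alpha> m \<boxtimes> \<alpha> n) = \<alpha> (m + n))"
  by (rule ex1_from_S2) auto

end

section \<open>Algebra structure on the coproduct of powers\<close>

locale strict_tensor_algebra_mult = strict_tensor_algebra +
  fixes \<mu> :: 'b
  assumes \<mu>_arr [simp]: "arr \<mu>"
    and \<mu>_dom [simp]: "dom \<mu> = [S, S]"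
    and \<mu>_cod [simp]: "cod \<mu> = [S]"
    and \<mu>_\<alpha>: "\<mu> \<bullet> (\<alpha> m \<boxtimes> \<alpha> n) = \<alpha> (m + n)"
begin

lemma \<mu>_left: "(\<mu> \<boxtimes> idn [S]) \<bullet> (\<alpha> l \<boxtimes> \<alpha> m \<boxtimes> \<alpha> n) = \<alpha> (l + m) \<boxtimes> \<alpha> n"
  using interchange[of "\<alpha> l \<boxtimes> \<alpha> m" \<mu> "\<alpha> n" "idn [S]"] by (simp add: \<mu>_\<alpha>)

lemma \<mu>_right: "(idn [S] \<boxtimes> \<mu>) \<bullet> (\<alpha> l \<boxtimes> \<alpha> m \<boxtimes> \<alpha> n) = \<alpha> l \<boxtimes> \<alpha> (m + n)"
  by (simp add: interchange \<mu>_\<alpha>)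

lemma algebra_S: "algebra S \<mu> (\<alpha> 0)"
proof -
  have "\<mu> \<bullet> (\<mu> \<boxtimes> idn [S]) = \<mu> \<bullet> (idn [S] \<boxtimes> \<mu>)"
    by (rule \<alpha>3_epi) (simp_all add: \<mu>_left \<mu>_right \<mu>_\<alpha> add_ac)
  moreover have "\<mu> \<bullet> (\<alpha> 0 \<boxtimes> idn [S]) = idn [S]"
  proof (rule \<alpha>_epi)
    fix n
    show "(\<mu> \<bullet> (\<alpha> 0 \<boxtimes> idn [S])) \<bullet> \<alpha> n = idn [S] \<bullet> \<alpha> n"
      using interchange[of "idn []" "\<alpha> 0" "\<alpha> n" "idn [S]"] by (simp add: \<mu>_\<alpha>)
  qed simp_all
  moreover have "\<mu> \<bullet> (idn [S] \<boxtimes> \<alpha> 0) = idn [S]"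
  proof (rule \<alpha>_epi)
    fix n
    show "(\<mu> \<bullet> (idn [S] \<boxtimes> \<alpha> 0)) \<bullet> \<alpha> n = idn [S] \<bullet> \<alpha> n"
      using interchange[of "\<alpha> n" "idn [S]" "idn []" "\<alpha> 0"] by (simp add: \<mu>_\<alpha>)
  qed simp_all
  ultimately show ?thesis
    by (simp add: algebra_def)
qed

text \<open>Since \<open>\<alpha> (Suc n)\<close> is
  \<open>\<mu> \<bullet> (\<alpha> n \<boxtimes> \<alpha> 1)\<close>, multiplicativity forces the
  recursion of \<open>iter\<close>. This is the uniqueness half of the universal property.\<close>

lemma algebra_mor_iter:
  assumes h: "arr h" "dom h = [S]" "cod h = [A]"
    and alg: "algebra A m u" and mult: "h \<bullet> \<mu> = m \<bullet> (h \<boxtimes> h)" and unit: "h \<bullet> \<alpha> 0 = u"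
  shows "h \<bullet> \<alpha> n = iter m u (h \<bullet> \<alpha> 1) n"
proof (induction n)
  note [simp] = h
  have [simp]: "arr m" "dom m = [A, A]" "cod m = [A]"
    using alg by (auto simp: algebra_def)
  case (Suc n)
  have "h \<bullet> \<alpha> (Suc n) = h \<bullet> \<mu> \<bullet> (\<alpha> n \<boxtimes> \<alpha> 1)"
    by (simp add: \<mu>_\<alpha>)
  also have "\<dots> = m \<bullet> (h \<boxtimes> h) \<bullet> (\<alpha> n \<boxtimes> \<alpha> 1)"
    using cmp_eq_cmp_assoc[OF mult, of "\<alpha> n \<boxtimes> \<alpha> 1"] by simp
  also have "\<dots> = m \<bullet> ((h \<bullet> \<alpha> n) \<boxtimes> (h \<bullet> \<alpha> 1))"
    by (simp add: interchange)
  finally show ?case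
    by (simp add: Suc)
qed (simp add: unit)

lemma algebra_mor_eq:
  assumes "arr h" "dom h = [S]" "cod h = [A]" "h \<bullet> \<mu> = m \<bullet> (h \<boxtimes> h)" "h \<bullet> \<alpha> 0 = u"
    and "arr k" "dom k = [S]" "cod k = [A]" "k \<bullet> \<mu> = m \<bullet> (k \<boxtimes> k)" "k \<bullet> \<alpha> 0 = u"
    and "algebra A m u" "h \<bullet> \<alpha> 1 = k \<bullet> \<alpha> 1"
  shows "h = k"
proof (rule \<alpha>_epi)
  fix n
  show "h \<bullet> \<alpha> n = k \<bullet> \<alpha> n"
    using algebra_mor_iter[OF assms(1-3,11,4,5), of n] algebra_mor_iter[OF assms(6-8,11,9,10), of n]
    by (simp only: assms(12))
qed (simp_all add: assms(1-3,6-8))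

text \<open>The existence half of the universal property: on components, multiplicativity is
  \<open>mult_iter\<close>.\<close>

lemma algebra_mor_if_iter:
  assumes h: "arr h" "dom h = [S]" "cod h = [A]"
    and alg: "algebra A m u" and g: "arr g" "dom g = [V]" "cod g = [A]"
    and h_\<alpha>: "\<And>n. h \<bullet> \<alpha> n = iter m u g n"
  shows "h \<bullet> \<mu> = m \<bullet> (h \<boxtimes> h)"
proof -
  note [simp] = h
  have [simp]: "arr m" "dom m = [A, A]" "cod m = [A]"
    using alg by (auto simp: algebra_def)
  show ?thesis
    by (rule \<alpha>2_epi) (simp_all add: \<mu>_\<alpha> interchange h_\<alpha> mult_iter[OF alg g])
qed

end

section \<open>Braided algebra structure on the coproduct of powers\<close>

locale strict_braided_tensor_algebra = strict_tensor_algebra + strict_braided_object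
begin

lemma braiding_ex1:
  "\<exists>!d. arr d \<and> dom d = [S, S] \<and> cod d = [S, S] \<and> (\<forall>m n. d \<bullet> (\<alpha> m \<boxtimes> \<alpha> n) = (\<alpha> n \<boxtimes> \<alpha> m) \<bullet> gam m n)"
  by (rule ex1_from_S2) (auto simp: replicate_simps)

end

locale strict_braided_tensor_algebra_mult = strict_braided_tensor_algebra + strict_tensor_algebra_mult +
  fixes d :: 'b
  assumes iso_c: "iso c"
    and d_arr [simp]: "arr d"
    and d_dom [simp]: "dom d = [S, S]"
    and d_cod [simp]: "cod d = [S, S]"
    and d_\<alpha>: "d \<bullet> (\<alpha> m \<boxtimes> \<alpha> n) = (\<alpha> n \<boxtimes> \<alpha> m) \<bullet> gam m n"
begin

lemma iso_d: "iso d"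
proof -
  have "\<exists>k. arr k \<and> dom k = replicate (m + n) V \<and> cod k = replicate (m + n) V \<and>
      k \<bullet> gam m n = pw (m + n) \<and> gam m n \<bullet> k = pw (m + n)" for m n
    by (rule isoE[OF iso_gam[OF iso_c, of m n]]) auto
  then obtain k where k [simp]: "arr (k m n)" "dom (k m n) = replicate (m + n) V" "cod (k m n) = replicate (m + n) V"
    "k m n \<bullet> gam m n = pw (m + n)" "gam m n \<bullet> k m n = pw (m + n)" for m n
    by metis
  \<comment> \<open>The indices of \<open>k\<close> are swapped because \<open>d\<close> sends the
    component (n, m) to (m, n): there the inverse has to undo \<open>gam n m\<close>.\<close>
  have "\<exists>!e. arr e \<and> dom e = [S, S] \<and> cod e = [S, S] \<and> (\<forall>m n. e \<bullet> (\<alpha> m \<boxtimes> \<alpha> n) = (\<alpha> n \<boxtimes> \<alpha> m) \<bullet> k n m)"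
    by (rule ex1_from_S2) (auto simp: replicate_simps)
  then obtain e where [simp]: "arr e" "dom e = [S, S]" "cod e = [S, S]"
    and e_\<alpha>: "\<And>m n. e \<bullet> (\<alpha> m \<boxtimes> \<alpha> n) = (\<alpha> n \<boxtimes> \<alpha> m) \<bullet> k n m"
    by blast
  show ?thesis
  proof (rule isoI[of d e])
    show "e \<bullet> d = idn (dom d)"
    proof (rule \<alpha>2_epi)
      fix m n
      have "(e \<bullet> d) \<bullet> (\<alpha> m \<boxtimes> \<alpha> n) = e \<bullet> (\<alpha> n \<boxtimes> \<alpha> m) \<bullet> gam m n"
        by (simp add: d_\<alpha>)
      also have "\<dots> = ((\<alpha> m \<boxtimes> \<alpha> n) \<bullet> k m n) \<bullet> gam m n"
        by (rule cmp_eq_cmp_assoc[OF e_\<alpha>]) (simp_all add: replicate_simps)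
      also have "\<dots> = idn (dom d) \<bullet> (\<alpha> m \<boxtimes> \<alpha> n)"
        by (simp add: replicate_simps)
      finally show "(e \<bullet> d) \<bullet> (\<alpha> m \<boxtimes> \<alpha> n) = idn (dom d) \<bullet> (\<alpha> m \<boxtimes> \<alpha> n)" .
    qed simp_all
    show "d \<bullet> e = idn (cod d)"
    proof (rule \<alpha>2_epi)
      fix m n
      have "(d \<bullet> e) \<bullet> (\<alpha> m \<boxtimes> \<alpha> n) = d \<bullet> (\<alpha> n \<boxtimes> \<alpha> m) \<bullet> k n m"
        by (simp add: e_\<alpha>)
      also have "\<dots> = ((\<alpha> m \<boxtimes> \<alpha> n) \<bullet> gam n m) \<bullet> k n m"
        by (rule cmp_eq_cmp_assoc[OF d_\<alpha>]) (simp_all add: replicate_simps)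
      also have "\<dots> = idn (cod d) \<bullet> (\<alpha> m \<boxtimes> \<alpha> n)"
        by (simp add: replicate_simps)
      finally show "(d \<bullet> e) \<bullet> (\<alpha> m \<boxtimes> \<alpha> n) = idn (cod d) \<bullet> (\<alpha> m \<boxtimes> \<alpha> n)" .
    qed simp_all
  qed simp_all
qed

text \<open>The tail \<open>k\<close> makes this usable inside right-nested composites. Together
  with \<open>d_right\<close> it pulls every \<open>d\<close> through the injections, which leaves
  an identity between crossings of blocks.\<close>

lemma d_left:
  assumes "arr k" "cod k = replicate (l + m + n) V"
  shows "(d \<boxtimes> idn [S]) \<bullet> (\<alpha> l \<boxtimes> \<alpha> m \<boxtimes> \<alpha> n) \<bullet> k = (\<alpha> m \<boxtimes> \<alpha> l \<boxtimes> \<alpha> n) \<bullet> (gam l m \<boxtimes> pw n) \<bullet> k"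
proof -
  have "(d \<boxtimes> idn [S]) \<bullet> ((\<alpha> l \<boxtimes> \<alpha> m) \<boxtimes> \<alpha> n) = ((\<alpha> m \<boxtimes> \<alpha> l) \<boxtimes> \<alpha> n) \<bullet> (gam l m \<boxtimes> pw n)"
    by (rule slide_left[OF d_\<alpha>]) (simp_all add: replicate_simps)
  then have "(d \<boxtimes> idn [S]) \<bullet> (\<alpha> l \<boxtimes> \<alpha> m \<boxtimes> \<alpha> n) = (\<alpha> m \<boxtimes> \<alpha> l \<boxtimes> \<alpha> n) \<bullet> (gam l m \<boxtimes> pw n)"
    by simp
  from cmp_eq_cmp_assoc[OF this, of k] show ?thesis
    using assms by (simp add: replicate_simps)
qed

lemma d_right:
  assumes "arr k" "cod k = replicate (l + m + n) V"
  shows "(idn [S] \<boxtimes> d) \<bullet> (\<alpha> l \<boxtimes> \<alpha> m \<boxtimes> \<alpha> n) \<bullet> k = (\<alpha> l \<boxtimes> \<alpha> n \<boxtimes> \<alpha> m) \<bullet> (pw l \<boxtimes> gam m n) \<bullet> k"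
proof -
  have "(idn [S] \<boxtimes> d) \<bullet> (\<alpha> l \<boxtimes> \<alpha> m \<boxtimes> \<alpha> n) = (\<alpha> l \<boxtimes> \<alpha> n \<boxtimes> \<alpha> m) \<bullet> (pw l \<boxtimes> gam m n)"
    by (rule slide_right[OF d_\<alpha>]) (simp_all add: replicate_simps)
  from cmp_eq_cmp_assoc[OF this, of k] show ?thesis
    using assms by (simp add: replicate_simps)
qed

lemma d_left': "(d \<boxtimes> idn [S]) \<bullet> (\<alpha> l \<boxtimes> \<alpha> m \<boxtimes> \<alpha> n) = (\<alpha> m \<boxtimes> \<alpha> l \<boxtimes> \<alpha> n) \<bullet> (gam l m \<boxtimes> pw n)"
  using d_left[of "pw (l + m + n)" l m n] by (simp add: replicate_simps)

lemma d_right': "(idn [S] \<boxtimes> d) \<bullet> (\<alpha> l \<boxtimes> \<alpha> m \<boxtimes> \<alpha> n) = (\<alpha> l \<boxtimes> \<alpha> n \<boxtimes> \<alpha> m) \<bullet> (pw l \<boxtimes> gam m n)"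
  using d_right[of "pw (l + m + n)" l m n] by (simp add: replicate_simps)

lemma braided_object_S: "braided_object S d"
proof -
  have "(d \<boxtimes> idn [S]) \<bullet> (idn [S] \<boxtimes> d) \<bullet> (d \<boxtimes> idn [S]) = (idn [S] \<boxtimes> d) \<bullet> (d \<boxtimes> idn [S]) \<bullet> (idn [S] \<boxtimes> d)"
    by (rule \<alpha>3_epi)
      (simp_all add: d_left d_left' d_right d_right' gam_yang_baxter replicate_simps)
  then show ?thesis
    by (simp add: braided_object_def iso_d)
qed

text \<open>On components the compatibilities with \<mu> are \<open>gam_add_left\<close> and
  \<open>gam_add_right\<close>; those with the unit say that crossing an empty block is the
  identity.\<close>

lemma braided_algebra_S: "braided_algebra S \<mu> (\<alpha> 0) d"
proof -
  have "d \<bullet> (\<mu> \<boxtimes> idn [S]) = (idn [S] \<boxtimes> \<mu>) \<bullet> (d \<boxtimes> idn [S]) \<bullet> (idn [S] \<boxtimes> d)"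
  proof (rule \<alpha>3_epi)
    fix l m n
    have "((idn [S] \<boxtimes> \<mu>) \<bullet> (d \<boxtimes> idn [S]) \<bullet> (idn [S] \<boxtimes> d)) \<bullet> (\<alpha> l \<boxtimes> \<alpha> m \<boxtimes> \<alpha> n) =
        (idn [S] \<boxtimes> \<mu>) \<bullet> (\<alpha> n \<boxtimes> \<alpha> l \<boxtimes> \<alpha> m) \<bullet> (gam l n \<boxtimes> pw m) \<bullet> (pw l \<boxtimes> gam m n)"
      by (simp add: d_left d_left' d_right d_right' replicate_simps)
    also have "\<dots> = (\<alpha> n \<boxtimes> \<alpha> (l + m)) \<bullet> (gam l n \<boxtimes> pw m) \<bullet> (pw l \<boxtimes> gam m n)"
      by (rule cmp_eq_cmp_assoc[OF \<mu>_right]) (simp_all add: replicate_simps)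
    also have "\<dots> = (d \<bullet> (\<mu> \<boxtimes> idn [S])) \<bullet> (\<alpha> l \<boxtimes> \<alpha> m \<boxtimes> \<alpha> n)"
      by (simp add: \<mu>_left d_\<alpha> gam_add_left)
    finally show "(d \<bullet> (\<mu> \<boxtimes> idn [S])) \<bullet> (\<alpha> l \<boxtimes> \<alpha> m \<boxtimes> \<alpha> n) =
      ((idn [S] \<boxtimes> \<mu>) \<bullet> (d \<boxtimes> idn [S]) \<bullet> (idn [S] \<boxtimes> d)) \<bullet> (\<alpha> l \<boxtimes> \<alpha> m \<boxtimes> \<alpha> n)" by (rule sym)
  qed simp_all
  moreover have "d \<bullet> (idn [S] \<boxtimes> \<mu>) = (\<mu> \<boxtimes> idn [S]) \<bullet> (idn [S] \<boxtimes> d) \<bullet> (d \<boxtimes> idn [S])"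
  proof (rule \<alpha>3_epi)
    fix l m n
    have "((\<mu> \<boxtimes> idn [S]) \<bullet> (idn [S] \<boxtimes> d) \<bullet> (d \<boxtimes> idn [S])) \<bullet> (\<alpha> l \<boxtimes> \<alpha> m \<boxtimes> \<alpha> n) =
        (\<mu> \<boxtimes> idn [S]) \<bullet> (\<alpha> m \<boxtimes> \<alpha> n \<boxtimes> \<alpha> l) \<bullet> (pw m \<boxtimes> gam l n) \<bullet> (gam l m \<boxtimes> pw n)"
      by (simp add: d_left d_left' d_right d_right' replicate_simps)
    also have "\<dots> = (\<alpha> (m + n) \<boxtimes> \<alpha> l) \<bullet> (pw m \<boxtimes> gam l n) \<bullet> (gam l m \<boxtimes> pw n)"
      by (rule cmp_eq_cmp_assoc[OF \<mu>_left]) (simp_all add: replicate_simps)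
    also have "\<dots> = (d \<bullet> (idn [S] \<boxtimes> \<mu>)) \<bullet> (\<alpha> l \<boxtimes> \<alpha> m \<boxtimes> \<alpha> n)"
      by (simp add: \<mu>_right d_\<alpha> gam_add_right)
    finally show "(d \<bullet> (idn [S] \<boxtimes> \<mu>)) \<bullet> (\<alpha> l \<boxtimes> \<alpha> m \<boxtimes> \<alpha> n) =
      ((\<mu> \<boxtimes> idn [S]) \<bullet> (idn [S] \<boxtimes> d) \<bullet> (d \<boxtimes> idn [S])) \<bullet> (\<alpha> l \<boxtimes> \<alpha> m \<boxtimes> \<alpha> n)" by (rule sym)
  qed simp_all
  moreover have "d \<bullet> (\<alpha> 0 \<boxtimes> idn [S]) = idn [S] \<boxtimes> \<alpha> 0"
  proof (rule \<alpha>_epi)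
    fix n
    show "(d \<bullet> (\<alpha> 0 \<boxtimes> idn [S])) \<bullet> \<alpha> n = (idn [S] \<boxtimes> \<alpha> 0) \<bullet> \<alpha> n"
      using interchange[of "idn []" "\<alpha> 0" "\<alpha> n" "idn [S]"] interchange[of "\<alpha> n" "idn [S]" "idn []" "\<alpha> 0"]
      by (simp add: d_\<alpha>)
  qed simp_all
  moreover have "d \<bullet> (idn [S] \<boxtimes> \<alpha> 0) = \<alpha> 0 \<boxtimes> idn [S]"
  proof (rule \<alpha>_epi)
    fix n
    show "(d \<bullet> (idn [S] \<boxtimes> \<alpha> 0)) \<bullet> \<alpha> n = (\<alpha> 0 \<boxtimes> idn [S]) \<bullet> \<alpha> n"
      using interchange[of "idn []" "\<alpha> 0" "\<alpha> n" "idn [S]"] interchange[of "\<alpha> n" "idn [S]" "idn []" "\<alpha> 0"]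
      by (simp add: d_\<alpha>)
  qed simp_all
  ultimately show ?thesis
    by (simp add: braided_algebra_def algebra_S braided_object_S)
qed

lemma \<alpha>1_braided: "d \<bullet> (\<alpha> 1 \<boxtimes> \<alpha> 1) = (\<alpha> 1 \<boxtimes> \<alpha> 1) \<bullet> c"
  by (subst d_\<alpha>) simp

lemma braided_mor_if_iter:
  assumes h: "arr h" "dom h = [S]" "cod h = [A]"
    and B: "braided_algebra A m u e" and g: "arr g" "dom g = [V]" "cod g = [A]"
    and braided: "e \<bullet> (g \<boxtimes> g) = (g \<boxtimes> g) \<bullet> c"
    and h_\<alpha>: "\<And>n. h \<bullet> \<alpha> n = iter m u g n"
  shows "e \<bullet> (h \<boxtimes> h) = (h \<boxtimes> h) \<bullet> d"
proof (rule \<alpha>2_epi)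
  note [simp] = h
  have [simp]: "arr e" "dom e = [A, A]" "cod e = [A, A]"
    using B by (auto simp: braided_algebra_def braided_object_def iso_arr)
  show "arr (e \<bullet> (h \<boxtimes> h))" "arr ((h \<boxtimes> h) \<bullet> d)" "dom (e \<bullet> (h \<boxtimes> h)) = [S, S]"
    "dom ((h \<boxtimes> h) \<bullet> d) = [S, S]" "cod (e \<bullet> (h \<boxtimes> h)) = cod ((h \<boxtimes> h) \<bullet> d)"
    by simp_all
  fix m' n
  have "(e \<bullet> (h \<boxtimes> h)) \<bullet> (\<alpha> m' \<boxtimes> \<alpha> n) = e \<bullet> (iter m u g m' \<boxtimes> iter m u g n)"
    by (simp add: interchange h_\<alpha>)
  also have "\<dots> = (iter m u g n \<boxtimes> iter m u g m') \<bullet> gam m' n"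
    by (rule iter_braided[OF B g braided])
  also have "\<dots> = ((h \<boxtimes> h) \<bullet> (\<alpha> n \<boxtimes> \<alpha> m')) \<bullet> gam m' n"
    by (simp add: interchange h_\<alpha>)
  also have "\<dots> = ((h \<boxtimes> h) \<bullet> d) \<bullet> (\<alpha> m' \<boxtimes> \<alpha> n)"
    by (simp add: d_\<alpha> replicate_simps)
  finally show "(e \<bullet> (h \<boxtimes> h)) \<bullet> (\<alpha> m' \<boxtimes> \<alpha> n) = ((h \<boxtimes> h) \<bullet> d) \<bullet> (\<alpha> m' \<boxtimes> \<alpha> n)" .
qed

end

text \<open>Transport of the equations of a graded braiding from objects \<open>P n\<close> isomorphic to the powers of \<open>V\<close>
  to these powers.\<close>

locale strict_power_transport = strict_powers +
  fixes P :: "nat \<Rightarrow> 'a" and \<kappa> :: "nat \<Rightarrow> 'b" and \<phi> \<gamma> G :: "nat \<Rightarrow> nat \<Rightarrow> 'b"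
  assumes P_obs [simp]: "P n \<in> obs"
    and \<kappa>_iso: "iso (\<kappa> n)"
    and \<kappa>_dom [simp]: "dom (\<kappa> n) = [P n]"
    and \<kappa>_cod [simp]: "cod (\<kappa> n) = replicate n V"
    and \<phi>_typing [simp]: "arr (\<phi> m n)" "dom (\<phi> m n) = [P m, P n]" "cod (\<phi> m n) = [P (m + n)]"
    and \<kappa>_\<phi>: "\<kappa> (m + n) \<bullet> \<phi> m n = \<kappa> m \<boxtimes> \<kappa> n"
    and \<gamma>_typing [simp]: "arr (\<gamma> m n)" "dom (\<gamma> m n) = [P m, P n]" "cod (\<gamma> m n) = [P n, P m]"
    and G_typing [simp]: "arr (G m n)" "dom (G m n) = replicate (m + n) V" "cod (G m n) = replicate (m + n) V"
    and \<kappa>_\<gamma>: "(\<kappa> n \<boxtimes> \<kappa> m) \<bullet> \<gamma> m n = G m n \<bullet> (\<kappa> m \<boxtimes> \<kappa> n)"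
begin

lemma \<kappa>_arr [simp]: "arr (\<kappa> n)"
  by (rule iso_arr[OF \<kappa>_iso])

lemma \<kappa>2_iso: "iso (\<kappa> m \<boxtimes> \<kappa> n)"
  by (simp add: \<kappa>_iso iso_ten)

lemma \<kappa>3_iso: "iso (\<kappa> l \<boxtimes> \<kappa> m \<boxtimes> \<kappa> n)"
  by (simp add: \<kappa>_iso iso_ten)

lemma \<gamma>_left: "(\<kappa> m \<boxtimes> \<kappa> l \<boxtimes> \<kappa> n) \<bullet> (\<gamma> l m \<boxtimes> idn [P n]) = (G l m \<boxtimes> pw n) \<bullet> (\<kappa> l \<boxtimes> \<kappa> m \<boxtimes> \<kappa> n)"
  using slide_left[OF \<kappa>_\<gamma>[symmetric, of l m], where z = "\<kappa> n"] by (simp add: replicate_simps)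

lemma \<gamma>_right: "(\<kappa> l \<boxtimes> \<kappa> n \<boxtimes> \<kappa> m) \<bullet> (idn [P l] \<boxtimes> \<gamma> m n) = (pw l \<boxtimes> G m n) \<bullet> (\<kappa> l \<boxtimes> \<kappa> m \<boxtimes> \<kappa> n)"
  using slide_right[OF \<kappa>_\<gamma>[symmetric, of m n], where z = "\<kappa> l"] by (simp add: replicate_simps)

lemma \<gamma>_left_Cmp:
  assumes "arr k" "cod k = [P l, P m, P n]"
  shows "(\<kappa> m \<boxtimes> \<kappa> l \<boxtimes> \<kappa> n) \<bullet> (\<gamma> l m \<boxtimes> idn [P n]) \<bullet> k = (G l m \<boxtimes> pw n) \<bullet> (\<kappa> l \<boxtimes> \<kappa> m \<boxtimes> \<kappa> n) \<bullet> k"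
  using cmp_eq_cmp_assoc[OF \<gamma>_left, where k = k] assms by (simp add: replicate_simps)

lemma \<gamma>_right_Cmp:
  assumes "arr k" "cod k = [P l, P m, P n]"
  shows "(\<kappa> l \<boxtimes> \<kappa> n \<boxtimes> \<kappa> m) \<bullet> (idn [P l] \<boxtimes> \<gamma> m n) \<bullet> k = (pw l \<boxtimes> G m n) \<bullet> (\<kappa> l \<boxtimes> \<kappa> m \<boxtimes> \<kappa> n) \<bullet> k"
  using cmp_eq_cmp_assoc[OF \<gamma>_right, where k = k] assms by (simp add: replicate_simps)

text \<open>Composing either side with \<open>?j\<close> at the target moves the isomorphisms
  \<kappa> through all crossings until they become \<open>?k\<close> at the source. Cancelling
  \<open>?j\<close> and \<open>?k\<close> gives both directions.\<close>

lemma yang_baxter_transport: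
  "(idn [P n] \<boxtimes> \<gamma> l m) \<bullet> (\<gamma> l n \<boxtimes> idn [P m]) \<bullet> (idn [P l] \<boxtimes> \<gamma> m n) =
   (\<gamma> m n \<boxtimes> idn [P l]) \<bullet> (idn [P m] \<boxtimes> \<gamma> l n) \<bullet> (\<gamma> l m \<boxtimes> idn [P n]) \<longleftrightarrow>
   (pw n \<boxtimes> G l m) \<bullet> (G l n \<boxtimes> pw m) \<bullet> (pw l \<boxtimes> G m n) =
   (G m n \<boxtimes> pw l) \<bullet> (pw m \<boxtimes> G l n) \<bullet> (G l m \<boxtimes> pw n)" (is "?L = ?R \<longleftrightarrow> ?L' = ?R'")
proof -
  let ?j = "\<kappa> n \<boxtimes> \<kappa> m \<boxtimes> \<kappa> l" and ?k = "\<kappa> l \<boxtimes> \<kappa> m \<boxtimes> \<kappa> n"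
  have "?j \<bullet> ?L = ?L' \<bullet> ?k" "?j \<bullet> ?R = ?R' \<bullet> ?k"
    by (simp_all add: \<gamma>_left \<gamma>_right \<gamma>_left_Cmp \<gamma>_right_Cmp replicate_simps)
  moreover have "?j \<bullet> ?L = ?j \<bullet> ?R \<longleftrightarrow> ?L = ?R"
    by (rule iso_cancel_left_iff) (simp_all add: \<kappa>3_iso)
  moreover have "?L' \<bullet> ?k = ?R' \<bullet> ?k \<longleftrightarrow> ?L' = ?R'"
    by (rule iso_cancel_right_iff) (simp_all add: \<kappa>3_iso replicate_simps)
  ultimately show ?thesis by simp
qed

text \<open>Here \<phi> is absorbed by \<open>\<kappa>_\<phi>\<close>: on n-letter words, the
  identification of a product of powers with a power is the identity.\<close>

lemma add_left_transport:
  "(idn [P n] \<boxtimes> \<phi> l m) \<bullet> (\<gamma> l n \<boxtimes> idn [P m]) \<bullet> (idn [P l] \<boxtimes> \<gamma> m n) = \<gamma> (l + m) n \<bullet> (\<phi> l m \<boxtimes> idn [P n]) \<longleftrightarrow>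
   G (l + m) n = (G l n \<boxtimes> pw m) \<bullet> (pw l \<boxtimes> G m n)" (is "?L = ?R \<longleftrightarrow> ?R' = ?L'")
proof -
  let ?j = "\<kappa> n \<boxtimes> \<kappa> (l + m)" and ?k = "\<kappa> l \<boxtimes> \<kappa> m \<boxtimes> \<kappa> n"
  have \<phi>1: "(\<kappa> n \<boxtimes> \<kappa> (l + m)) \<bullet> (idn [P n] \<boxtimes> \<phi> l m) = \<kappa> n \<boxtimes> \<kappa> l \<boxtimes> \<kappa> m"
    by (simp add: interchange \<kappa>_\<phi>)
  have \<phi>2: "(\<kappa> (l + m) \<boxtimes> \<kappa> n) \<bullet> (\<phi> l m \<boxtimes> idn [P n]) = \<kappa> l \<boxtimes> \<kappa> m \<boxtimes> \<kappa> n"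
    using interchange[of "\<phi> l m" "\<kappa> (l + m)" "idn [P n]" "\<kappa> n"] by (simp add: \<kappa>_\<phi>)
  have "?j \<bullet> ?L = ?L' \<bullet> ?k"
    using cmp_eq_cmp_assoc[OF \<phi>1, of "(\<gamma> l n \<boxtimes> idn [P m]) \<bullet> (idn [P l] \<boxtimes> \<gamma> m n)"]
    by (simp add: \<gamma>_right \<gamma>_left_Cmp replicate_simps)
  moreover have "?j \<bullet> ?R = ?R' \<bullet> ?k"
    using cmp_eq_cmp_assoc[OF \<kappa>_\<gamma>[of n "l + m"], of "\<phi> l m \<boxtimes> idn [P n]"]
    by (simp add: \<phi>2 replicate_simps)
  moreover have "?j \<bullet> ?L = ?j \<bullet> ?R \<longleftrightarrow> ?L = ?R"
    by (rule iso_cancel_left_iff) (simp_all add: \<kappa>2_iso)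
  moreover have "?L' \<bullet> ?k = ?R' \<bullet> ?k \<longleftrightarrow> ?L' = ?R'"
    by (rule iso_cancel_right_iff) (simp_all add: \<kappa>3_iso replicate_simps)
  ultimately show ?thesis by metis
qed

lemma add_right_transport:
  "(\<phi> m n \<boxtimes> idn [P l]) \<bullet> (idn [P m] \<boxtimes> \<gamma> l n) \<bullet> (\<gamma> l m \<boxtimes> idn [P n]) = \<gamma> l (m + n) \<bullet> (idn [P l] \<boxtimes> \<phi> m n) \<longleftrightarrow>
   G l (m + n) = (pw m \<boxtimes> G l n) \<bullet> (G l m \<boxtimes> pw n)" (is "?L = ?R \<longleftrightarrow> ?R' = ?L'")
proof -
  let ?j = "\<kappa> (m + n) \<boxtimes> \<kappa> l" and ?k = "\<kappa> l \<boxtimes> \<kappa> m \<boxtimes> \<kappa> n"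
  have \<phi>1: "(\<kappa> l \<boxtimes> \<kappa> (m + n)) \<bullet> (idn [P l] \<boxtimes> \<phi> m n) = \<kappa> l \<boxtimes> \<kappa> m \<boxtimes> \<kappa> n"
    by (simp add: interchange \<kappa>_\<phi>)
  have \<phi>2: "(\<kappa> (m + n) \<boxtimes> \<kappa> l) \<bullet> (\<phi> m n \<boxtimes> idn [P l]) = \<kappa> m \<boxtimes> \<kappa> n \<boxtimes> \<kappa> l"
    using interchange[of "\<phi> m n" "\<kappa> (m + n)" "idn [P l]" "\<kappa> l"] by (simp add: \<kappa>_\<phi>)
  have "?j \<bullet> ?L = ?L' \<bullet> ?k"
    using cmp_eq_cmp_assoc[OF \<phi>2, of "(idn [P m] \<boxtimes> \<gamma> l n) \<bullet> (\<gamma> l m \<boxtimes> idn [P n])"]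
    by (simp add: \<gamma>_left \<gamma>_right_Cmp replicate_simps)
  moreover have "?j \<bullet> ?R = ?R' \<bullet> ?k"
    using cmp_eq_cmp_assoc[OF \<kappa>_\<gamma>[of "m + n" l], of "idn [P l] \<boxtimes> \<phi> m n"]
    by (simp add: \<phi>1 replicate_simps)
  moreover have "?j \<bullet> ?L = ?j \<bullet> ?R \<longleftrightarrow> ?L = ?R"
    by (rule iso_cancel_left_iff) (simp_all add: \<kappa>2_iso)
  moreover have "?L' \<bullet> ?k = ?R' \<bullet> ?k \<longleftrightarrow> ?L' = ?R'"
    by (rule iso_cancel_right_iff) (simp_all add: \<kappa>3_iso replicate_simps)
  ultimately show ?thesis by metis
qed

end

section \<open>Isomorphisms and unit coherence\<close>

context category
begin

lemma homD:
  assumes "f \<in> hom C X Y"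
  shows "f \<in> Ar C" "Src C f = X" "Tgt C f = Y"
  using assms by (auto simp: hom_def)

lemma Ob_Src_Tgt [simp]: "f \<in> Ar C \<Longrightarrow> Src C f \<in> Ob C" "f \<in> Ar C \<Longrightarrow> Tgt C f \<in> Ob C"
  by (simp_all add: Src_Ob Tgt_Ob)

lemma Idn_typing [simp]:
  "X \<in> Ob C \<Longrightarrow> \<I> X \<in> Ar C" "X \<in> Ob C \<Longrightarrow> Src C (\<I> X) = X" "X \<in> Ob C \<Longrightarrow> Tgt C (\<I> X) = X"
  using Idn_hom by (auto simp: hom_def)

lemma Cmp_typing [simp]:
  assumes "f \<in> Ar C" "g \<in> Ar C" "Src C g = Tgt C f"
  shows "g \<cdot> f \<in> Ar C" "Src C (g \<cdot> f) = Src C f" "Tgt C (g \<cdot> f) = Tgt C g"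
  using Cmp_hom[of f "Src C f" "Tgt C f" g "Tgt C g"] assms by (auto simp: hom_def)

lemma Cmp_Idn_Src [simp]: "f \<in> Ar C \<Longrightarrow> Src C f = X \<Longrightarrow> f \<cdot> \<I> X = f"
  using Cmp_Idn by (auto simp: hom_def)

lemma Idn_Cmp_Tgt [simp]: "f \<in> Ar C \<Longrightarrow> Tgt C f = X \<Longrightarrow> \<I> X \<cdot> f = f"
  using Idn_Cmp by (auto simp: hom_def)

lemma Cmp_assoc_Ar [simp]:
  assumes "f \<in> Ar C" "g \<in> Ar C" "h \<in> Ar C" "Src C g = Tgt C f" "Src C h = Tgt C g"
  shows "(h \<cdot> g) \<cdot> f = h \<cdot> (g \<cdot> f)"
  using assms by (intro Cmp_assoc) (auto simp: hom_def)

lemma Cmp_eq_Cmp_assoc: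
  assumes "g \<cdot> f = h" "f \<in> Ar C" "g \<in> Ar C" "k \<in> Ar C" "Src C g = Tgt C f" "Src C f = Tgt C k"
  shows "g \<cdot> (f \<cdot> k) = h \<cdot> k"
  using assms by (metis Cmp_assoc_Ar)

lemma inverse_arrows_unique:
  assumes "inverse_arrows C f g" "inverse_arrows C f h"
  shows "g = h"
proof -
  note f = assms[unfolded inverse_arrows_def hom_def]
  have "g = (h \<cdot> f) \<cdot> g"
    using f by simp
  also have "\<dots> = h \<cdot> (f \<cdot> g)"
    by (rule Cmp_assoc_Ar) (use f in simp_all)
  also have "\<dots> = h"
    using f by simp
  finally show ?thesis .
qed

lemma inverse_arrows_inv_ar: "is_iso C f \<Longrightarrow> inverse_arrows C f (inv_ar C f)"
  unfolding is_iso_def inv_ar_def using inverse_arrows_unique by (metis theI)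

lemma inv_ar_eqI: "inverse_arrows C f g \<Longrightarrow> inv_ar C f = g"
  using inverse_arrows_inv_ar inverse_arrows_unique is_iso_def by metis

lemma is_iso_Ar [simp]: "is_iso C f \<Longrightarrow> f \<in> Ar C"
  by (auto simp: is_iso_def inverse_arrows_def)

lemma inv_ar_typing [simp]:
  assumes "is_iso C f"
  shows "inv_ar C f \<in> Ar C" "Src C (inv_ar C f) = Tgt C f" "Tgt C (inv_ar C f) = Src C f"
  using inverse_arrows_inv_ar[OF assms] by (auto simp: inverse_arrows_def hom_def)

lemma inv_ar_Cmp [simp]:
  assumes "is_iso C f"
  shows "inv_ar C f \<cdot> f = \<I> (Src C f)" "f \<cdot> inv_ar C f = \<I> (Tgt C f)"
  using inverse_arrows_inv_ar[OF assms] by (auto simp: inverse_arrows_def)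

lemma inv_ar_Cmp_Cmp [simp]:
  assumes "is_iso C f" "k \<in> Ar C"
  shows "Tgt C k = Src C f \<Longrightarrow> inv_ar C f \<cdot> (f \<cdot> k) = k" "Tgt C k = Tgt C f \<Longrightarrow> f \<cdot> (inv_ar C f \<cdot> k) = k"
  using assms Cmp_eq_Cmp_assoc[OF inv_ar_Cmp(1)[OF assms(1)], of k]
    Cmp_eq_Cmp_assoc[OF inv_ar_Cmp(2)[OF assms(1)], of k] by simp_all

lemma is_isoI:
  assumes "f \<in> Ar C" "g \<in> Ar C" "Src C g = Tgt C f" "Tgt C g = Src C f" "g \<cdot> f = \<I> (Src C f)" "f \<cdot> g = \<I> (Tgt C f)"
  shows "is_iso C f"
  using assms unfolding is_iso_def inverse_arrows_def hom_def by blast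

lemma is_iso_Idn [simp]: "X \<in> Ob C \<Longrightarrow> is_iso C (\<I> X)"
  by (rule is_isoI[of _ "\<I> X"]) simp_all

lemma inv_ar_Idn [simp]: "X \<in> Ob C \<Longrightarrow> inv_ar C (\<I> X) = \<I> X"
  by (rule inv_ar_eqI) (simp add: inverse_arrows_def hom_def)

lemma is_iso_Cmp [simp]: "is_iso C f \<Longrightarrow> is_iso C g \<Longrightarrow> Src C g = Tgt C f \<Longrightarrow> is_iso C (g \<cdot> f)"
  by (rule is_isoI[of _ "inv_ar C f \<cdot> inv_ar C g"]) simp_all

lemma is_iso_inv_ar [simp]: "is_iso C f \<Longrightarrow> is_iso C (inv_ar C f)"
  by (rule is_isoI[of _ f]) simp_all

lemma inv_ar_inv_ar [simp]: "is_iso C f \<Longrightarrow> inv_ar C (inv_ar C f) = f"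
  by (rule inv_ar_eqI) (simp add: inverse_arrows_def hom_def)

lemma is_iso_cancel_right:
  assumes "is_iso C k" "f \<cdot> k = g \<cdot> k" "f \<in> Ar C" "g \<in> Ar C" "Src C f = Tgt C k" "Src C g = Tgt C k"
  shows "f = g"
proof -
  have "f = (f \<cdot> k) \<cdot> inv_ar C k"
    using assms(1,3,5) by simp
  also have "\<dots> = (g \<cdot> k) \<cdot> inv_ar C k"
    by (simp only: assms(2))
  also have "\<dots> = g"
    using assms(1,4,6) by simp
  finally show ?thesis .
qed

lemma is_iso_cancel_left:
  assumes "is_iso C k" "k \<cdot> f = k \<cdot> g" "f \<in> Ar C" "g \<in> Ar C" "Src C k = Tgt C f" "Src C k = Tgt C g"
  shows "f = g"
  using assms inv_ar_Cmp_Cmp(1) by metis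

end

section \<open>Interchange and Kelly's unit coherences\<close>

context monoidal_category
begin

lemma TenO_Ob_simp [simp]: "X \<in> Ob M \<Longrightarrow> Y \<in> Ob M \<Longrightarrow> X \<odot> Y \<in> Ob M"
  by (rule TenO_Ob)

lemma TenA_typing [simp]:
  assumes "f \<in> Ar M" "g \<in> Ar M"
  shows "f \<otimes> g \<in> Ar M" "Src M (f \<otimes> g) = Src M f \<odot> Src M g" "Tgt M (f \<otimes> g) = Tgt M f \<odot> Tgt M g"
  using TenA_hom[of f "Src M f" "Tgt M f" g "Src M g" "Tgt M g"] assms by (auto simp: hom_def)

lemma Unt_Ob_simp [simp]: "\<one> \<in> Ob M"
  by (rule Unt_Ob)

lemma TenA_Idn_simp [simp]: "X \<in> Ob M \<Longrightarrow> Y \<in> Ob M \<Longrightarrow> \<I> X \<otimes> \<I> Y = \<I> (X \<odot> Y)"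
  by (rule TenA_Idn)

lemma TenA_Cmp_TenA:
  assumes "f \<in> Ar M" "f' \<in> Ar M" "g \<in> Ar M" "g' \<in> Ar M" "Src M f' = Tgt M f" "Src M g' = Tgt M g"
  shows "(f' \<otimes> g') \<cdot> (f \<otimes> g) = (f' \<cdot> f) \<otimes> (g' \<cdot> g)"
  using assms TenA_Cmp[of f "Src M f" "Tgt M f" f' "Tgt M f'" g "Src M g" "Tgt M g" g' "Tgt M g'"]
  by (simp add: hom_def)

lemma TenA_Cmp_TenA_Cmp:
  assumes "f \<in> Ar M" "f' \<in> Ar M" "g \<in> Ar M" "g' \<in> Ar M" "Src M f' = Tgt M f" "Src M g' = Tgt M g"
    and "k \<in> Ar M" "Tgt M k = Src M f \<odot> Src M g"
  shows "(f' \<otimes> g') \<cdot> ((f \<otimes> g) \<cdot> k) = ((f' \<cdot> f) \<otimes> (g' \<cdot> g)) \<cdot> k"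
  by (rule Cmp_eq_Cmp_assoc[OF TenA_Cmp_TenA]) (use assms in simp_all)

lemmas TenA_merge = TenA_Cmp_TenA TenA_Cmp_TenA_Cmp

lemma is_iso_TenA [simp]: "is_iso M f \<Longrightarrow> is_iso M g \<Longrightarrow> is_iso M (f \<otimes> g)"
  by (rule is_isoI[of _ "inv_ar M f \<otimes> inv_ar M g"]) (simp_all add: TenA_Cmp_TenA)

lemma Asc_typing [simp]:
  assumes "X \<in> Ob M" "Y \<in> Ob M" "Z \<in> Ob M"
  shows "\<a> X Y Z \<in> Ar M" "Src M (\<a> X Y Z) = (X \<odot> Y) \<odot> Z" "Tgt M (\<a> X Y Z) = X \<odot> (Y \<odot> Z)"
    "is_iso M (\<a> X Y Z)"
  using Asc_hom[OF assms] Asc_iso[OF assms] by (auto simp: hom_def)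

lemma Lun_typing [simp]:
  assumes "X \<in> Ob M"
  shows "\<l> X \<in> Ar M" "Src M (\<l> X) = \<one> \<odot> X" "Tgt M (\<l> X) = X" "is_iso M (\<l> X)"
  using Lun_hom[OF assms] Lun_iso[OF assms] by (auto simp: hom_def)

lemma Run_typing [simp]:
  assumes "X \<in> Ob M"
  shows "\<r> X \<in> Ar M" "Src M (\<r> X) = X \<odot> \<one>" "Tgt M (\<r> X) = X" "is_iso M (\<r> X)"
  using Run_hom[OF assms] Run_iso[OF assms] by (auto simp: hom_def)

lemma Asc_nat_Ar:
  assumes "f \<in> Ar M" "g \<in> Ar M" "h \<in> Ar M" "X = Tgt M f" "Y = Tgt M g" "Z = Tgt M h"
  shows "\<a> X Y Z \<cdot> ((f \<otimes> g) \<otimes> h) = (f \<otimes> (g \<otimes> h)) \<cdot> \<a> (Src M f) (Src M g) (Src M h)"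
  using assms by (intro Asc_nat[of _ _ "X" _ _ "Y" _ _ "Z"]) (auto simp: hom_def)

lemma Lun_nat_Ar: "f \<in> Ar M \<Longrightarrow> X = Tgt M f \<Longrightarrow> \<l> X \<cdot> (\<I> \<one> \<otimes> f) = f \<cdot> \<l> (Src M f)"
  by (rule Lun_nat) (auto simp: hom_def)

lemma Run_nat_Ar: "f \<in> Ar M \<Longrightarrow> X = Tgt M f \<Longrightarrow> \<r> X \<cdot> (f \<otimes> \<I> \<one>) = f \<cdot> \<r> (Src M f)"
  by (rule Run_nat) (auto simp: hom_def)

text \<open>By naturality, \<r> turns \<open>f \<otimes> \<I> \<one>\<close> back into
  \<open>f\<close>. Unit coherences may therefore be proved after tensoring with the unit object,
  where the pentagon and the triangle apply.\<close>

lemma TenA_Unt_right_cancel: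
  assumes "f \<otimes> \<I> \<one> = g \<otimes> \<I> \<one>" "f \<in> Ar M" "g \<in> Ar M" "Src M f = Src M g" "Tgt M f = Tgt M g"
  shows "f = g"
proof (rule is_iso_cancel_right[of "\<r> (Src M f)"])
  show "f \<cdot> \<r> (Src M f) = g \<cdot> \<r> (Src M f)"
    using Run_nat_Ar[of f "Tgt M f"] Run_nat_Ar[of g "Tgt M f"] assms by simp
qed (use assms in simp_all)

lemma TenA_Unt_left_cancel:
  assumes "\<I> \<one> \<otimes> f = \<I> \<one> \<otimes> g" "f \<in> Ar M" "g \<in> Ar M" "Src M f = Src M g" "Tgt M f = Tgt M g"
  shows "f = g"
proof (rule is_iso_cancel_right[of "\<l> (Src M f)"])
  show "f \<cdot> \<l> (Src M f) = g \<cdot> \<l> (Src M f)"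
    using Lun_nat_Ar[of f "Tgt M f"] Lun_nat_Ar[of g "Tgt M f"] assms by simp
qed (use assms in simp_all)

text \<open>Kelly's argument: after tensoring with the unit object on the right, the claim follows
  from the pentagon at X, Y and two units, two triangles and naturality, up to an associator that
  cancels.\<close>

lemma Run_TenO:
  assumes [simp]: "X \<in> Ob M" "Y \<in> Ob M"
  shows "(\<I> X \<otimes> \<r> Y) \<cdot> \<a> X Y \<one> = \<r> (X \<odot> Y)"
proof (rule TenA_Unt_right_cancel)
  let ?U = "\<I> \<one>"
  have "\<a> X Y \<one> \<cdot> (((\<I> X \<otimes> \<r> Y) \<cdot> \<a> X Y \<one>) \<otimes> ?U) = \<a> X Y \<one> \<cdot> ((\<I> X \<otimes> \<r> Y) \<otimes> ?U) \<cdot> (\<a> X Y \<one> \<otimes> ?U)"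
    by (simp add: TenA_Cmp_TenA)
  also have "\<dots> = ((\<I> X \<otimes> (\<r> Y \<otimes> ?U)) \<cdot> \<a> X (Y \<odot> \<one>) \<one>) \<cdot> (\<a> X Y \<one> \<otimes> ?U)"
    using Asc_nat_Ar[of "\<I> X" "\<r> Y" ?U] by (intro Cmp_eq_Cmp_assoc) simp_all
  also have "\<dots> = (\<I> X \<otimes> (\<I> Y \<otimes> \<l> \<one>)) \<cdot> (\<I> X \<otimes> \<a> Y \<one> \<one>) \<cdot> \<a> X (Y \<odot> \<one>) \<one> \<cdot> (\<a> X Y \<one> \<otimes> ?U)"
    by (simp add: triangle[symmetric] TenA_Cmp_TenA_Cmp)
  also have "\<dots> = (\<I> X \<otimes> (\<I> Y \<otimes> \<l> \<one>)) \<cdot> \<a> X Y (\<one> \<odot> \<one>) \<cdot> \<a> (X \<odot> Y) \<one> \<one>"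
    by (simp add: pentagon)
  also have "\<dots> = (\<a> X Y \<one> \<cdot> ((\<I> X \<otimes> \<I> Y) \<otimes> \<l> \<one>)) \<cdot> \<a> (X \<odot> Y) \<one> \<one>"
    using Asc_nat_Ar[of "\<I> X" "\<I> Y" "\<l> \<one>", symmetric] by (intro Cmp_eq_Cmp_assoc) simp_all
  also have "\<dots> = \<a> X Y \<one> \<cdot> (\<r> (X \<odot> Y) \<otimes> ?U)"
    by (simp add: triangle)
  finally show "((\<I> X \<otimes> \<r> Y) \<cdot> \<a> X Y \<one>) \<otimes> ?U = \<r> (X \<odot> Y) \<otimes> ?U"
    by (rule is_iso_cancel_left[rotated]) simp_all
qed simp_all

lemma Lun_TenO:
  assumes [simp]: "X \<in> Ob M" "Y \<in> Ob M"
  shows "\<l> (X \<odot> Y) \<cdot> \<a> \<one> X Y = \<l> X \<otimes> \<I> Y"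
proof (rule TenA_Unt_left_cancel)
  let ?U = "\<I> \<one>"
  let ?k = "\<a> \<one> (\<one> \<odot> X) Y \<cdot> (\<a> \<one> \<one> X \<otimes> \<I> Y)"
  have "(?U \<otimes> (\<l> (X \<odot> Y) \<cdot> \<a> \<one> X Y)) \<cdot> ?k =
      (?U \<otimes> \<l> (X \<odot> Y)) \<cdot> (?U \<otimes> \<a> \<one> X Y) \<cdot> \<a> \<one> (\<one> \<odot> X) Y \<cdot> (\<a> \<one> \<one> X \<otimes> \<I> Y)"
    by (simp add: TenA_Cmp_TenA_Cmp)
  also have "\<dots> = (?U \<otimes> \<l> (X \<odot> Y)) \<cdot> \<a> \<one> \<one> (X \<odot> Y) \<cdot> \<a> (\<one> \<odot> \<one>) X Y"
    by (simp add: pentagon)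
  also have "\<dots> = (\<r> \<one> \<otimes> \<I> (X \<odot> Y)) \<cdot> \<a> (\<one> \<odot> \<one>) X Y"
    by (rule Cmp_eq_Cmp_assoc[OF triangle]) simp_all
  also have "\<dots> = \<a> \<one> X Y \<cdot> ((\<r> \<one> \<otimes> \<I> X) \<otimes> \<I> Y)"
    using Asc_nat_Ar[of "\<r> \<one>" "\<I> X" "\<I> Y"] by simp
  also have "\<dots> = \<a> \<one> X Y \<cdot> ((?U \<otimes> \<l> X) \<otimes> \<I> Y) \<cdot> (\<a> \<one> \<one> X \<otimes> \<I> Y)"
    by (simp add: triangle[symmetric] TenA_Cmp_TenA)
  also have "\<dots> = ((?U \<otimes> (\<l> X \<otimes> \<I> Y)) \<cdot> \<a> \<one> (\<one> \<odot> X) Y) \<cdot> (\<a> \<one> \<one> X \<otimes> \<I> Y)"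
    using Asc_nat_Ar[of ?U "\<l> X" "\<I> Y"] by (intro Cmp_eq_Cmp_assoc) simp_all
  finally have "(?U \<otimes> (\<l> (X \<odot> Y) \<cdot> \<a> \<one> X Y)) \<cdot> ?k = (?U \<otimes> (\<l> X \<otimes> \<I> Y)) \<cdot> ?k"
    by simp
  then show "?U \<otimes> (\<l> (X \<odot> Y) \<cdot> \<a> \<one> X Y) = ?U \<otimes> (\<l> X \<otimes> \<I> Y)"
    by (rule is_iso_cancel_right[rotated]) simp_all
qed simp_all

text \<open>Naturality of \<l> along itself gives \<open>\<I> \<one> \<otimes> \<l> \<one> = \<l>
  (\<one> \<odot> \<one>)\<close>; then \<open>Lun_TenO\<close> and the triangle finish. The
  equality lets \<open>tens_iso\<close> take the right unit constraint at an empty second word even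
  if the first word is empty.\<close>

lemma Lun_Unt: "\<l> \<one> = \<r> \<one>"
proof (rule TenA_Unt_right_cancel)
  have "\<l> \<one> \<cdot> (\<I> \<one> \<otimes> \<l> \<one>) = \<l> \<one> \<cdot> \<l> (\<one> \<odot> \<one>)"
    by (simp add: Lun_nat_Ar)
  then have "\<I> \<one> \<otimes> \<l> \<one> = \<l> (\<one> \<odot> \<one>)"
    by (rule is_iso_cancel_left[rotated]) simp_all
  then have "\<l> \<one> \<otimes> \<I> \<one> = (\<I> \<one> \<otimes> \<l> \<one>) \<cdot> \<a> \<one> \<one> \<one>"
    by (simp add: Lun_TenO)
  then show "\<l> \<one> \<otimes> \<I> \<one> = \<r> \<one> \<otimes> \<I> \<one>"
    by (simp add: triangle)
qed simp_all

end

section \<open>Strictification\<close>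

text \<open>An arrow of the strictification is an arrow of the category between the left-bracketed tensor products
  of two lists of objects. The tensor product of arrows is conjugated by the canonical isomorphisms
  \<open>tens_iso u v : tens u \<odot> tens v \<rightarrow> tens (u @ v)\<close>, whose shape is that of \<^const>\<open>tpow_iso\<close>.\<close>

context monoidal_category
begin

text \<open>The fold starts at the first letter and not at the unit object, so that a one-letter
  word stands for its letter without a unit factor.\<close>

definition tens :: "'o list \<Rightarrow> 'o" where
  "tens u = (case u of [] \<Rightarrow> \<one> | X # xs \<Rightarrow> foldl (TenO M) X xs)"

text \<open>The second word is given in reverse, because the outermost factor of a left-bracketed
  product is the last letter.\<close>

primrec tens_iso_rev :: "'o list \<Rightarrow> 'o list \<Rightarrow> 'a" where
  "tens_iso_rev u [] = \<r> (tens u)"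
| "tens_iso_rev u (X # xs) = (if xs = [] then \<I> (tens u \<odot> X)
     else (tens_iso_rev u xs \<otimes> \<I> X) \<cdot> \<a>\<inverse> (tens u) (tens (rev xs)) X)"

definition tens_iso :: "'o list \<Rightarrow> 'o list \<Rightarrow> 'a" where
  "tens_iso u v = (if u = [] then \<l> (tens v) else tens_iso_rev u (rev v))"

lemma tens_simps [simp]:
  "tens [] = \<one>" "tens [X] = X" "tens [X, Y] = X \<odot> Y" "tens [X, Y, Z] = (X \<odot> Y) \<odot> Z"
  by (simp_all add: tens_def)

lemma tens_snoc [simp]: "u \<noteq> [] \<Longrightarrow> tens (u @ [X]) = tens u \<odot> X"
  by (cases u) (simp_all add: tens_def)

lemma tens_Ob [simp]: "set u \<subseteq> Ob M \<Longrightarrow> tens u \<in> Ob M"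
proof (induction u rule: rev_induct)
  case (snoc X u)
  then show ?case by (cases "u = []") simp_all
qed simp

lemma tens_replicate: "tens (replicate n V) = tpow M V n"
proof (induction n rule: induct_nat_012)
  case (ge2 n)
  then show ?case
    using tens_snoc[of "replicate (Suc n) V" V] by (simp add: replicate_append_same)
qed simp_all

lemma tens_iso_Nil_left: "tens_iso [] v = \<l> (tens v)"
  by (simp add: tens_iso_def)

lemma tens_iso_Nil_right: "tens_iso u [] = \<r> (tens u)"
  by (simp add: tens_iso_def Lun_Unt)

lemma tens_iso_single: "u \<noteq> [] \<Longrightarrow> tens_iso u [X] = \<I> (tens u \<odot> X)"
  by (simp add: tens_iso_def)

lemma tens_iso_snoc:
  "u \<noteq> [] \<Longrightarrow> v \<noteq> [] \<Longrightarrow> tens_iso u (v @ [X]) = (tens_iso u v \<otimes> \<I> X) \<cdot> inv_ar M (\<a> (tens u) (tens v) X)"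
  by (simp add: tens_iso_def Asc_inv_def)

lemma tens_iso_typing [simp]:
  assumes "set u \<subseteq> Ob M" "set v \<subseteq> Ob M"
  shows "is_iso M (tens_iso u v)" "Src M (tens_iso u v) = tens u \<odot> tens v"
    "Tgt M (tens_iso u v) = tens (u @ v)" "tens_iso u v \<in> Ar M"
proof -
  have "is_iso M (tens_iso u v) \<and> Src M (tens_iso u v) = tens u \<odot> tens v \<and> Tgt M (tens_iso u v) = tens (u @ v)"
  proof (cases "u = []")
    case False
    then show ?thesis
      using assms(2)
    proof (induction v rule: rev_induct)
      case (snoc X v)
      then show ?case
        using assms(1) tens_snoc[of "u @ v" X]
        by (cases "v = []") (simp_all add: tens_iso_single tens_iso_snoc del: append_assoc add: append_assoc[symmetric])
    qed (use assms in \<open>simp add: tens_iso_Nil_right\<close>)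
  qed (use assms in \<open>simp add: tens_iso_Nil_left\<close>)
  then show "is_iso M (tens_iso u v)" "Src M (tens_iso u v) = tens u \<odot> tens v"
    "Tgt M (tens_iso u v) = tens (u @ v)" "tens_iso u v \<in> Ar M"
    by simp_all
qed

lemma tens_iso_replicate: "tens_iso (replicate m V) (replicate n V) = tpow_iso M V m n"
proof (cases m)
  case (Suc k)
  show ?thesis
  proof (induction n rule: induct_nat_012)
    case (ge2 n)
    then show ?case
      using Suc tens_iso_snoc[of "replicate m V" "replicate (Suc n) V" V]
      by (simp add: replicate_append_same tens_replicate[of "Suc _", simplified] Asc_inv_def)
  qed (use Suc tens_iso_single[of "replicate m V" V] tens_iso_Nil_right[of "replicate m V"]
      tens_replicate[of "Suc k" V] in simp_all)
qed (simp add: tens_iso_Nil_left tens_replicate)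

text \<open>This coherence makes the strict tensor product associative. Empty words are covered by
  \<open>Lun_TenO\<close>, the triangle and \<open>Run_TenO\<close>; otherwise the last letter of
  \<open>w\<close> is removed by the pentagon and naturality of the associator.\<close>

lemma tens_iso_assoc:
  assumes [simp]: "set u \<subseteq> Ob M" "set v \<subseteq> Ob M" and w: "set w \<subseteq> Ob M"
  shows "tens_iso (u @ v) w \<cdot> (tens_iso u v \<otimes> \<I> (tens w)) =
    tens_iso u (v @ w) \<cdot> (\<I> (tens u) \<otimes> tens_iso v w) \<cdot> \<a> (tens u) (tens v) (tens w)"
proof -
  consider "u = []" | "v = []" | "u \<noteq> []" "v \<noteq> []" by blast
  then show ?thesis
  proof cases
    case 1
    have "\<l> (tens (v @ w)) \<cdot> (\<I> \<one> \<otimes> tens_iso v w) \<cdot> \<a> \<one> (tens v) (tens w) =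
        (tens_iso v w \<cdot> \<l> (tens v \<odot> tens w)) \<cdot> \<a> \<one> (tens v) (tens w)"
      using w Lun_nat_Ar[of "tens_iso v w" "tens (v @ w)"] by (intro Cmp_eq_Cmp_assoc) simp_all
    then show ?thesis
      using 1 w by (simp add: tens_iso_Nil_left Lun_TenO)
  next
    case 2
    then show ?thesis
      using w by (simp add: tens_iso_Nil_left tens_iso_Nil_right triangle)
  next
    case 3
    from w show ?thesis
    proof (induction w rule: rev_induct)
      case Nil
      show ?case
        using Run_nat_Ar[of "tens_iso u v" "tens (u @ v)"] by (simp add: tens_iso_Nil_right Run_TenO)
    next
      case (snoc X w)
      then have [simp]: "X \<in> Ob M" "set w \<subseteq> Ob M" by simp_all
      show ?case
      proof (cases "w = []")
        case True
        then show ?thesis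
          using 3 tens_iso_snoc[of u v X] by (simp add: tens_iso_single)
      next
        case False
        let ?u = "tens u" and ?v = "tens v" and ?w = "tens w"
        \<comment> \<open>Precomposition with this associator creates the outer side of the
          pentagon; it is cancelled at the end.\<close>
        let ?k = "\<a> (?u \<odot> ?v) ?w X"
        have "(tens_iso (u @ v) (w @ [X]) \<cdot> (tens_iso u v \<otimes> \<I> (?w \<odot> X))) \<cdot> ?k =
            (tens_iso (u @ v) w \<otimes> \<I> X) \<cdot> inv_ar M (\<a> (tens (u @ v)) ?w X) \<cdot> (tens_iso u v \<otimes> (\<I> ?w \<otimes> \<I> X)) \<cdot> ?k"
          using 3 False by (simp add: tens_iso_snoc del: append_assoc)
        also have "(tens_iso u v \<otimes> (\<I> ?w \<otimes> \<I> X)) \<cdot> ?k = \<a> (tens (u @ v)) ?w X \<cdot> ((tens_iso u v \<otimes> \<I> ?w) \<otimes> \<I> X)"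
          using Asc_nat_Ar[of "tens_iso u v" "\<I> ?w" "\<I> X"] by simp
        also have "(tens_iso (u @ v) w \<otimes> \<I> X) \<cdot> inv_ar M (\<a> (tens (u @ v)) ?w X) \<cdot> \<dots> =
            (tens_iso (u @ v) w \<cdot> (tens_iso u v \<otimes> \<I> ?w)) \<otimes> \<I> X"
          by (simp add: TenA_Cmp_TenA)
        also have "\<dots> = (tens_iso u (v @ w) \<otimes> \<I> X) \<cdot> ((\<I> ?u \<otimes> tens_iso v w) \<otimes> \<I> X) \<cdot> (\<a> ?u ?v ?w \<otimes> \<I> X)"
          using snoc.IH by (simp add: TenA_Cmp_TenA)
        also have "\<dots> = (tens_iso u (v @ w) \<otimes> \<I> X) \<cdot> inv_ar M (\<a> ?u (tens (v @ w)) X) \<cdot>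
            \<a> ?u (tens (v @ w)) X \<cdot> ((\<I> ?u \<otimes> tens_iso v w) \<otimes> \<I> X) \<cdot> (\<a> ?u ?v ?w \<otimes> \<I> X)"
          by simp
        also have "\<a> ?u (tens (v @ w)) X \<cdot> ((\<I> ?u \<otimes> tens_iso v w) \<otimes> \<I> X) \<cdot> (\<a> ?u ?v ?w \<otimes> \<I> X) =
            ((\<I> ?u \<otimes> (tens_iso v w \<otimes> \<I> X)) \<cdot> \<a> ?u (?v \<odot> ?w) X) \<cdot> (\<a> ?u ?v ?w \<otimes> \<I> X)"
          using Asc_nat_Ar[of "\<I> ?u" "tens_iso v w" "\<I> X"] by (intro Cmp_eq_Cmp_assoc) simp_all
        also have "\<dots> = (\<I> ?u \<otimes> ((tens_iso v w \<otimes> \<I> X) \<cdot> inv_ar M (\<a> ?v ?w X))) \<cdot>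
            (\<I> ?u \<otimes> \<a> ?v ?w X) \<cdot> \<a> ?u (?v \<odot> ?w) X \<cdot> (\<a> ?u ?v ?w \<otimes> \<I> X)"
          by (simp add: TenA_Cmp_TenA_Cmp)
        also have "\<dots> = (\<I> ?u \<otimes> tens_iso v (w @ [X])) \<cdot> \<a> ?u ?v (?w \<odot> X) \<cdot> ?k"
          using 3 False by (simp add: tens_iso_snoc pentagon)
        also have "(tens_iso u (v @ w) \<otimes> \<I> X) \<cdot> inv_ar M (\<a> ?u (tens (v @ w)) X) \<cdot> \<dots> =
            (tens_iso u (v @ w @ [X]) \<cdot> (\<I> ?u \<otimes> tens_iso v (w @ [X])) \<cdot> \<a> ?u ?v (?w \<odot> X)) \<cdot> ?k"
          using 3 False tens_iso_snoc[of u "v @ w" X] tens_snoc[of "v @ w" X] tens_snoc[of w X] by simp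
        finally have "tens_iso (u @ v) (w @ [X]) \<cdot> (tens_iso u v \<otimes> \<I> (?w \<odot> X)) =
            tens_iso u (v @ w @ [X]) \<cdot> (\<I> ?u \<otimes> tens_iso v (w @ [X])) \<cdot> \<a> ?u ?v (?w \<odot> X)"
          by (rule is_iso_cancel_right[rotated]) (use False in simp_all)
        then show ?thesis
          using False by simp
      qed
    qed
  qed
qed

text \<open>Arrows carry their words because different words, such as \<open>[X \<odot> Y]\<close>
  and \<open>[X, Y]\<close>, have the same product, while the words decide how a tensor product of
  arrows is rebracketed.\<close>

definition sarr :: "('o list, 'a) marr \<Rightarrow> bool" where
  "sarr f \<longleftrightarrow> set (msrc f) \<subseteq> Ob M \<and> set (mtgt f) \<subseteq> Ob M \<and> und f \<in> hom M (tens (msrc f)) (tens (mtgt f))"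

definition sidn :: "'o list \<Rightarrow> ('o list, 'a) marr" where
  "sidn u = MArr u (\<I> (tens u)) u"

definition scmp :: "('o list, 'a) marr \<Rightarrow> ('o list, 'a) marr \<Rightarrow> ('o list, 'a) marr" (infixr "\<bullet>" 60) where
  "g \<bullet> f = MArr (msrc f) (und g \<cdot> und f) (mtgt g)"

definition sten :: "('o list, 'a) marr \<Rightarrow> ('o list, 'a) marr \<Rightarrow> ('o list, 'a) marr" (infixr "\<boxtimes>" 70) where
  "f \<boxtimes> g = MArr (msrc f @ msrc g)
     (tens_iso (mtgt f) (mtgt g) \<cdot> (und f \<otimes> und g) \<cdot> inv_ar M (tens_iso (msrc f) (msrc g))) (mtgt f @ mtgt g)"

lemma sarrD:
  assumes "sarr f"
  shows "set (msrc f) \<subseteq> Ob M" "set (mtgt f) \<subseteq> Ob M" "und f \<in> Ar M"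
    "Src M (und f) = tens (msrc f)" "Tgt M (und f) = tens (mtgt f)"
  using assms by (auto simp: sarr_def hom_def)

lemma sten_tens_iso:
  assumes "sarr f" "sarr g"
  shows "und (f \<boxtimes> g) \<cdot> tens_iso (msrc f) (msrc g) = tens_iso (mtgt f) (mtgt g) \<cdot> (und f \<otimes> und g)"
  using assms[THEN sarrD(1)] assms[THEN sarrD(2)] assms[THEN sarrD(3)] assms[THEN sarrD(4)] assms[THEN sarrD(5)]
  by (simp add: sten_def)

lemma sarr_sten: "sarr f \<Longrightarrow> sarr g \<Longrightarrow> sarr (f \<boxtimes> g)"
  unfolding sarr_def sten_def by (auto simp: hom_def)

text \<open>Both sides are compared after the isomorphism \<open>?k\<close>, which removes the
  inverses from \<open>sten\<close>. What remains is \<open>tens_iso_assoc\<close> at source and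
  target and naturality of the associator.\<close>

lemma sten_assoc:
  assumes "sarr f" "sarr g" "sarr h"
  shows "(f \<boxtimes> g) \<boxtimes> h = f \<boxtimes> g \<boxtimes> h"
proof -
  note [simp] = assms[THEN sarrD(1)] assms[THEN sarrD(2)] assms[THEN sarrD(3)] assms[THEN sarrD(4)]
    assms[THEN sarrD(5)]
  note fg = sarr_sten[OF assms(1,2)] and gh = sarr_sten[OF assms(2,3)]
  note [simp] = sarrD(3-5)[OF fg] sarrD(3-5)[OF gh] sarrD(3-5)[OF sarr_sten[OF fg assms(3)]]
    sarrD(3-5)[OF sarr_sten[OF assms(1) gh]]
  have [simp]: "msrc (f' \<boxtimes> g') = msrc f' @ msrc g'" "mtgt (f' \<boxtimes> g') = mtgt f' @ mtgt g'" for f' g'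
    by (simp_all add: sten_def)
  let ?u = "msrc f" and ?v = "msrc g" and ?w = "msrc h" and ?u' = "mtgt f" and ?v' = "mtgt g" and ?w' = "mtgt h"
  let ?k = "tens_iso (?u @ ?v) ?w \<cdot> (tens_iso ?u ?v \<otimes> \<I> (tens ?w))"
  have "und ((f \<boxtimes> g) \<boxtimes> h) \<cdot> ?k =
      (tens_iso (?u' @ ?v') ?w' \<cdot> (und (f \<boxtimes> g) \<otimes> und h)) \<cdot> (tens_iso ?u ?v \<otimes> \<I> (tens ?w))"
    using sten_tens_iso[OF fg assms(3)] by (intro Cmp_eq_Cmp_assoc) simp_all
  also have "\<dots> = tens_iso (?u' @ ?v') ?w' \<cdot> ((tens_iso ?u' ?v' \<cdot> (und f \<otimes> und g)) \<otimes> und h)"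
    using sten_tens_iso[OF assms(1,2)] by (simp add: TenA_Cmp_TenA)
  also have "\<dots> = (tens_iso (?u' @ ?v') ?w' \<cdot> (tens_iso ?u' ?v' \<otimes> \<I> (tens ?w'))) \<cdot> ((und f \<otimes> und g) \<otimes> und h)"
    by (simp add: TenA_Cmp_TenA)
  also have "\<dots> = tens_iso ?u' (?v' @ ?w') \<cdot> (\<I> (tens ?u') \<otimes> tens_iso ?v' ?w') \<cdot>
      \<a> (tens ?u') (tens ?v') (tens ?w') \<cdot> ((und f \<otimes> und g) \<otimes> und h)"
    by (simp add: tens_iso_assoc)
  also have "\<dots> = tens_iso ?u' (?v' @ ?w') \<cdot> (\<I> (tens ?u') \<otimes> tens_iso ?v' ?w') \<cdot>
      (und f \<otimes> (und g \<otimes> und h)) \<cdot> \<a> (tens ?u) (tens ?v) (tens ?w)"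
    by (simp add: Asc_nat_Ar)
  also have "\<dots> = tens_iso ?u' (?v' @ ?w') \<cdot> (und f \<otimes> und (g \<boxtimes> h)) \<cdot>
      (\<I> (tens ?u) \<otimes> tens_iso ?v ?w) \<cdot> \<a> (tens ?u) (tens ?v) (tens ?w)"
    using sten_tens_iso[OF assms(2,3)] by (simp add: TenA_Cmp_TenA_Cmp)
  also have "\<dots> = (und (f \<boxtimes> g \<boxtimes> h) \<cdot> tens_iso ?u (?v @ ?w)) \<cdot>
      (\<I> (tens ?u) \<otimes> tens_iso ?v ?w) \<cdot> \<a> (tens ?u) (tens ?v) (tens ?w)"
    using sten_tens_iso[OF assms(1) gh] by (intro Cmp_eq_Cmp_assoc) simp_all
  also have "\<dots> = und (f \<boxtimes> g \<boxtimes> h) \<cdot> ?k"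
    by (simp add: tens_iso_assoc)
  finally have "und ((f \<boxtimes> g) \<boxtimes> h) = und (f \<boxtimes> g \<boxtimes> h)"
    by (rule is_iso_cancel_right[rotated]) simp_all
  then show ?thesis
    by (intro marr.expand) simp
qed

sublocale strict: strict_monoidal_category "Ob M" sarr msrc mtgt sidn scmp sten
proof
  fix f f' g g' h :: "('o list, 'a) marr" and x y
  show "sarr (sidn x) \<longleftrightarrow> set x \<subseteq> Ob M"
    by (auto simp: sarr_def sidn_def hom_def)
  show "sarr f \<Longrightarrow> sarr g \<Longrightarrow> msrc g = mtgt f \<Longrightarrow> sarr (g \<bullet> f)"
    unfolding sarr_def scmp_def by (auto simp: hom_def)
  show "sarr f \<Longrightarrow> msrc f = x \<Longrightarrow> f \<bullet> sidn x = f" "sarr f \<Longrightarrow> mtgt f = x \<Longrightarrow> sidn x \<bullet> f = f"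
    by (auto simp: sarr_def scmp_def sidn_def hom_def intro!: marr.expand)
  show "sarr f \<Longrightarrow> sarr g \<Longrightarrow> sarr h \<Longrightarrow> msrc g = mtgt f \<Longrightarrow> msrc h = mtgt g \<Longrightarrow> (h \<bullet> g) \<bullet> f = h \<bullet> g \<bullet> f"
    by (auto simp: sarr_def scmp_def hom_def)
  show "sarr f \<Longrightarrow> sarr f' \<Longrightarrow> sarr g \<Longrightarrow> sarr g' \<Longrightarrow> msrc f' = mtgt f \<Longrightarrow> msrc g' = mtgt g \<Longrightarrow>
      (f' \<boxtimes> g') \<bullet> f \<boxtimes> g = (f' \<bullet> f) \<boxtimes> (g' \<bullet> g)"
    by (auto simp: sarr_def sten_def scmp_def hom_def TenA_merge)
  show "set x \<subseteq> Ob M \<Longrightarrow> set y \<subseteq> Ob M \<Longrightarrow> sidn x \<boxtimes> sidn y = sidn (x @ y)"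
    by (simp add: sten_def sidn_def)
  show "sarr f \<Longrightarrow> sidn [] \<boxtimes> f = f"
  proof -
    assume "sarr f"
    note f [simp] = sarrD[OF this]
    have "\<l> (tens (mtgt f)) \<cdot> (\<I> \<one> \<otimes> und f) \<cdot> inv_ar M (\<l> (tens (msrc f))) =
        (und f \<cdot> \<l> (tens (msrc f))) \<cdot> inv_ar M (\<l> (tens (msrc f)))"
      using Lun_nat_Ar[of "und f" "tens (mtgt f)"] by (intro Cmp_eq_Cmp_assoc) simp_all
    then show "sidn [] \<boxtimes> f = f"
      by (intro marr.expand) (simp add: sten_def sidn_def tens_iso_Nil_left)
  qed
  show "sarr f \<Longrightarrow> f \<boxtimes> sidn [] = f"
  proof -
    assume "sarr f"
    note f [simp] = sarrD[OF this]
    have "\<r> (tens (mtgt f)) \<cdot> (und f \<otimes> \<I> \<one>) \<cdot> inv_ar M (\<r> (tens (msrc f))) =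
        (und f \<cdot> \<r> (tens (msrc f))) \<cdot> inv_ar M (\<r> (tens (msrc f)))"
      using Run_nat_Ar[of "und f" "tens (mtgt f)"] by (intro Cmp_eq_Cmp_assoc) simp_all
    then show "f \<boxtimes> sidn [] = f"
      by (intro marr.expand) (simp add: sten_def sidn_def tens_iso_Nil_right)
  qed
  show "sarr f \<Longrightarrow> sarr g \<Longrightarrow> sarr (f \<boxtimes> g)"
    by (rule sarr_sten)
  show "sarr f \<Longrightarrow> sarr g \<Longrightarrow> sarr h \<Longrightarrow> (f \<boxtimes> g) \<boxtimes> h = f \<boxtimes> g \<boxtimes> h"
    by (rule sten_assoc)
qed (auto simp: sidn_def scmp_def sten_def sarrD)

end

section \<open>Structures in the category and in its strictification\<close>

context monoidal_category
begin

lemma tens_iso_simps [simp]: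
  "tens_iso [] [X] = \<l> X" "tens_iso [X] [] = \<r> X" "tens_iso [X] [Y] = \<I> (X \<odot> Y)"
  "tens_iso [X, Y] [Z] = \<I> ((X \<odot> Y) \<odot> Z)"
  by (simp_all add: tens_iso_Nil_left tens_iso_Nil_right tens_iso_single)

text \<open>Words of length at most three yield only unit constraints, identities and associators.
  Unfolding a strict axiom therefore gives, up to moving a constraint across, the axiom with its
  constraints written out.\<close>

lemma tens_iso_1_2 [simp]:
  "X \<in> Ob M \<Longrightarrow> Y \<in> Ob M \<Longrightarrow> Z \<in> Ob M \<Longrightarrow> tens_iso [X] [Y, Z] = inv_ar M (\<a> X Y Z)"
  using tens_iso_snoc[of "[X]" "[Y]" Z] by simp

lemma iso_strict_iff:
  assumes "sarr f"
  shows "strict.iso f \<longleftrightarrow> is_iso M (und f)"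
proof
  note f = sarrD[OF assms]
  assume "strict.iso f"
  then obtain g where g: "sarr g" "msrc g = mtgt f" "mtgt g = msrc f" "g \<bullet> f = sidn (msrc f)" "f \<bullet> g = sidn (mtgt f)"
    by (rule strict.isoE)
  from g(4,5) have "und g \<cdot> und f = \<I> (tens (msrc f))" "und f \<cdot> und g = \<I> (tens (mtgt f))"
    by (simp_all add: scmp_def sidn_def)
  then show "is_iso M (und f)"
    using f sarrD[OF g(1)] g by (intro is_isoI[of _ "und g"]) simp_all
next
  note f = sarrD[OF assms]
  assume iso: "is_iso M (und f)"
  show "strict.iso f"
    by (rule strict.isoI[where g = "MArr (mtgt f) (inv_ar M (und f)) (msrc f)"])
      (use f iso assms in \<open>simp_all add: sarr_def hom_def scmp_def sidn_def\<close>)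
qed

lemma Cmp_inv_ar_eq_iff:
  assumes "is_iso M k" "f \<in> Ar M" "g \<in> Ar M" "Src M f = Src M k" "Src M g = Tgt M k"
  shows "f \<cdot> inv_ar M k = g \<longleftrightarrow> f = g \<cdot> k"
proof -
  have "f \<cdot> inv_ar M k = g" if "f = g \<cdot> k"
    using that assms by simp
  moreover have "f = g \<cdot> k" if "f \<cdot> inv_ar M k = g"
    using that[symmetric] assms by simp
  ultimately show ?thesis by blast
qed

lemma Cmp_right_iff:
  assumes "is_iso M k" "f \<in> Ar M" "g \<in> Ar M" "Src M f = Tgt M k" "Src M g = Tgt M k"
  shows "f \<cdot> k = g \<cdot> k \<longleftrightarrow> f = g"
  using assms is_iso_cancel_right by blast

lemmas strict_defs = scmp_def sten_def sidn_def sarr_def hom_def Asc_inv_def Lun_inv_def Run_inv_def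

lemma algebra_strict_iff:
  "is_algebra M (A, m, u) \<longleftrightarrow> strict.algebra A (MArr [A, A] m [A]) (MArr [] u [A])"
proof (cases "A \<in> Ob M \<and> m \<in> hom M (A \<odot> A) A \<and> u \<in> hom M \<one> A")
  case True
  then have [simp]: "A \<in> Ob M" "m \<in> Ar M" "Src M m = A \<odot> A" "Tgt M m = A" "u \<in> Ar M" "Src M u = \<one>" "Tgt M u = A"
    by (auto simp: hom_def)
  have "m \<cdot> (u \<otimes> \<I> A) \<cdot> inv_ar M (\<l> A) = \<I> A \<longleftrightarrow> m \<cdot> (u \<otimes> \<I> A) = \<l> A"
    using Cmp_inv_ar_eq_iff[of "\<l> A" "m \<cdot> (u \<otimes> \<I> A)" "\<I> A"] by simp
  moreover have "m \<cdot> (\<I> A \<otimes> u) \<cdot> inv_ar M (\<r> A) = \<I> A \<longleftrightarrow> m \<cdot> (\<I> A \<otimes> u) = \<r> A"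
    using Cmp_inv_ar_eq_iff[of "\<r> A" "m \<cdot> (\<I> A \<otimes> u)" "\<I> A"] by simp
  ultimately show ?thesis
    by (simp add: is_algebra_def strict.algebra_def strict_defs)
qed (auto simp: is_algebra_def strict.algebra_def sarr_def)

lemma braided_object_strict_iff:
  "is_braided_object M (V, c) \<longleftrightarrow> strict.braided_object V (MArr [V, V] c [V, V])"
proof (cases "V \<in> Ob M \<and> c \<in> hom M (V \<odot> V) (V \<odot> V) \<and> is_iso M c")
  case True
  then have [simp]: "V \<in> Ob M" "c \<in> Ar M" "Src M c = V \<odot> V" "Tgt M c = V \<odot> V" "is_iso M c"
    by (auto simp: hom_def)
  have "strict.iso (MArr [V, V] c [V, V])"
    by (subst iso_strict_iff) (simp_all add: sarr_def hom_def)
  then show ?thesis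
    by (simp add: is_braided_object_def strict.braided_object_def strict_defs)
next
  case False
  moreover have "V \<in> Ob M \<and> c \<in> hom M (V \<odot> V) (V \<odot> V) \<and> is_iso M c" if "strict.iso (MArr [V, V] c [V, V])"
    using strict.iso_arr[OF that] that iso_strict_iff[of "MArr [V, V] c [V, V]"] by (simp add: sarr_def)
  ultimately show ?thesis
    by (auto simp: is_braided_object_def strict.braided_object_def)
qed

lemma braided_algebra_strict_iff:
  "is_braided_algebra M (A, m, u, c) \<longleftrightarrow>
     strict.braided_algebra A (MArr [A, A] m [A]) (MArr [] u [A]) (MArr [A, A] c [A, A])"
proof (cases "is_algebra M (A, m, u) \<and> is_braided_object M (A, c)")
  case True
  then have [simp]: "A \<in> Ob M" "m \<in> Ar M" "Src M m = A \<odot> A" "Tgt M m = A" "u \<in> Ar M" "Src M u = \<one>" "Tgt M u = A"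
    "c \<in> Ar M" "Src M c = A \<odot> A" "Tgt M c = A \<odot> A"
    by (auto simp: is_algebra_def is_braided_object_def hom_def)
  \<comment> \<open>This axiom starts at the right-bracketed triple product, whereas the word
    \<open>[A, A, A]\<close> is bracketed to the left; an associator passes between the two
    forms.\<close>
  have "c \<cdot> (\<I> A \<otimes> m) \<cdot> \<a> A A A = (m \<otimes> \<I> A) \<cdot> inv_ar M (\<a> A A A) \<cdot> (\<I> A \<otimes> c) \<cdot> \<a> A A A \<cdot> (c \<otimes> \<I> A) \<longleftrightarrow>
      c \<cdot> (\<I> A \<otimes> m) = (m \<otimes> \<I> A) \<cdot> inv_ar M (\<a> A A A) \<cdot> (\<I> A \<otimes> c) \<cdot> \<a> A A A \<cdot> (c \<otimes> \<I> A) \<cdot> inv_ar M (\<a> A A A)"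
    using Cmp_right_iff[of "\<a> A A A" "c \<cdot> (\<I> A \<otimes> m)"
        "(m \<otimes> \<I> A) \<cdot> inv_ar M (\<a> A A A) \<cdot> (\<I> A \<otimes> c) \<cdot> \<a> A A A \<cdot> (c \<otimes> \<I> A) \<cdot> inv_ar M (\<a> A A A)"]
    by simp
  then show ?thesis
    using True unfolding is_braided_algebra_def strict.braided_algebra_def
    by (simp add: algebra_strict_iff[symmetric] braided_object_strict_iff[symmetric]) (simp add: strict_defs)
qed (auto simp: is_braided_algebra_def strict.braided_algebra_def algebra_strict_iff braided_object_strict_iff)

lemma algebra_mor_strict_iff:
  assumes "is_algebra M (A, m, u)" "is_algebra M (A', m', u')" "f \<in> hom M A A'"
  shows "is_algebra_mor M (A, m, u) f (A', m', u') \<longleftrightarrow>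
    MArr [A] f [A'] \<bullet> MArr [A, A] m [A] = MArr [A', A'] m' [A'] \<bullet> (MArr [A] f [A'] \<boxtimes> MArr [A] f [A']) \<and>
    MArr [A] f [A'] \<bullet> MArr [] u [A] = MArr [] u' [A']"
  using assms by (simp add: is_algebra_mor_def is_algebra_def strict_defs)

lemma braided_mor_strict_iff:
  assumes "is_braided_object M (V, c)" "is_braided_object M (W, d)" "f \<in> hom M V W"
  shows "is_braided_mor M (V, c) f (W, d) \<longleftrightarrow>
    MArr [W, W] d [W, W] \<bullet> (MArr [V] f [W] \<boxtimes> MArr [V] f [W]) =
    (MArr [V] f [W] \<boxtimes> MArr [V] f [W]) \<bullet> MArr [V, V] c [V, V]"
  using assms by (simp add: is_braided_mor_def is_braided_object_def strict_defs)

text \<open>Identifies the components of the counit with the extension of the identity of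
  \<open>A\<close>. The recursions have different base cases, reconciled at 1 by the left unit
  law.\<close>

lemma iter_strict:
  assumes "is_algebra M (A, m, u)"
  shows "strict.iter (MArr [A, A] m [A]) (MArr [] u [A]) (sidn [A]) n = MArr (replicate n A) (iter_mult M (A, m, u) n) [A]"
proof (induction n rule: induct_nat_012)
  case 1
  then show ?case
    using assms unfolding algebra_strict_iff strict.algebra_def by (simp add: sidn_def)
next
  case (ge2 n)
  have A: "A \<in> Ob M" "m \<in> hom M (A \<odot> A) A" "u \<in> hom M \<one> A"
    using assms by (simp_all add: is_algebra_def)
  have "sarr (strict.iter (MArr [A, A] m [A]) (MArr [] u [A]) (sidn [A]) (Suc n))"
    using assms[unfolded algebra_strict_iff] A by (intro strict.iter_typing(1)) simp_all
  then have "sarr (MArr (replicate (Suc n) A) (iter_mult M (A, m, u) (Suc n)) [A])"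
    by (simp only: ge2)
  note this[THEN sarrD(3)] this[THEN sarrD(4)] this[THEN sarrD(5)]
  then show ?case
    using A tens_iso_single[of "replicate (Suc n) A" A] tens_snoc[of "replicate (Suc n) A" A]
    unfolding strict.iter.simps(2)[of _ _ _ "Suc n"] ge2(2)
    by (simp add: scmp_def sten_def sidn_def hom_def replicate_append_same set_replicate_conv_if)
qed simp

lemma power_arr_strict:
  assumes f: "f \<in> hom M V W"
  shows "strict.power_arr (MArr [V] f [W]) n = MArr (replicate n V) (tpow_ar M f n) (replicate n W)"
proof (induction n rule: induct_nat_012)
  case 0
  show ?case by simp (simp add: sidn_def)
next
  case 1
  show ?case
    using f Src_Ob Tgt_Ob by (auto simp: sarr_def hom_def)
next
  case (ge2 n)
  have VW: "V \<in> Ob M" "W \<in> Ob M"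
    using f Src_Ob Tgt_Ob by (auto simp: hom_def)
  have "sarr (strict.power_arr (MArr [V] f [W]) (Suc n))"
    using f VW by (intro strict.power_arr_typing(1)) (simp_all add: sarr_def)
  then have "sarr (MArr (replicate (Suc n) V) (tpow_ar M f (Suc n)) (replicate (Suc n) W))"
    by (simp only: ge2)
  note this[THEN sarrD(3)] this[THEN sarrD(4)] this[THEN sarrD(5)]
  then show ?case
    using f VW tens_iso_single[of "replicate (Suc n) V" V] tens_snoc[of "replicate (Suc n) V" V]
      tens_iso_single[of "replicate (Suc n) W" W] tens_snoc[of "replicate (Suc n) W" W]
    unfolding strict.power_arr.simps(2)[of _ "Suc n"] ge2(2)
    by (simp add: sten_def hom_def replicate_append_same set_replicate_conv_if)
qed

end

section \<open>Coproducts\<close>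

lemma is_coproduct_ex1:
  assumes "is_coproduct C X T j" "Y \<in> Ob C" "\<And>i. g i \<in> hom C (X i) Y"
  shows "\<exists>!h. h \<in> hom C T Y \<and> (\<forall>i. Cmp C h (j i) = g i)"
  using assms(1)[unfolded is_coproduct_def, THEN conjunct2, THEN conjunct2, THEN bspec, OF assms(2), THEN spec, of g]
    assms(3) by simp

text \<open>The tensor functors yield coproducts of objects
  \<open>tens x \<odot> tens (u n)\<close>, but concatenated words stand for
  \<open>tens (x @ u n)\<close>. Conjugation by the canonical isomorphisms, exactly as in
  \<open>sten\<close>, bridges the two.\<close>

lemma (in category) is_coproduct_iso:
  assumes cop: "is_coproduct C X T j"
    and e: "\<And>n. is_iso C (e n)" "\<And>n. Src C (e n) = X' n" "\<And>n. Tgt C (e n) = X n"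
    and e': "is_iso C e'" "Src C e' = T" "Tgt C e' = T'"
  shows "is_coproduct C X' T' (\<lambda>n. e' \<cdot> j n \<cdot> e n)"
proof -
  have j: "j n \<in> Ar C" "Src C (j n) = X n" "Tgt C (j n) = T" for n
    using cop by (auto simp: is_coproduct_def hom_def)
  have "\<exists>!h. h \<in> hom C T' Y \<and> (\<forall>n. h \<cdot> (e' \<cdot> j n \<cdot> e n) = g n)"
    if Y: "Y \<in> Ob C" and g: "\<forall>n. g n \<in> hom C (X' n) Y" for Y g
  proof -
    have g': "g n \<in> Ar C" "Src C (g n) = X' n" "Tgt C (g n) = Y" for n
      using g by (auto simp: hom_def)
    have "\<exists>!h. h \<in> hom C T Y \<and> (\<forall>n. h \<cdot> j n = g n \<cdot> inv_ar C (e n))"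
      using g' e by (intro is_coproduct_ex1[OF cop Y]) (simp add: hom_def)
    then obtain h where h: "h \<in> hom C T Y" "\<forall>n. h \<cdot> j n = g n \<cdot> inv_ar C (e n)"
      and h_unique: "\<And>k. k \<in> hom C T Y \<Longrightarrow> \<forall>n. k \<cdot> j n = g n \<cdot> inv_ar C (e n) \<Longrightarrow> k = h"
      by blast
    have h': "h \<in> Ar C" "Src C h = T" "Tgt C h = Y"
      using h(1) by (auto simp: hom_def)
    show ?thesis
    proof (rule ex1I[of _ "h \<cdot> inv_ar C e'"])
      have "(h \<cdot> inv_ar C e') \<cdot> (e' \<cdot> j n \<cdot> e n) = g n" for n
      proof -
        have "(h \<cdot> inv_ar C e') \<cdot> (e' \<cdot> j n \<cdot> e n) = (h \<cdot> j n) \<cdot> e n"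
          using h' e e' j by simp
        also have "\<dots> = g n"
          using h(2) g' e by simp
        finally show ?thesis .
      qed
      then show "h \<cdot> inv_ar C e' \<in> hom C T' Y \<and> (\<forall>n. (h \<cdot> inv_ar C e') \<cdot> (e' \<cdot> j n \<cdot> e n) = g n)"
        using h' e' by (simp add: hom_def)
    next
      fix k
      assume k: "k \<in> hom C T' Y \<and> (\<forall>n. k \<cdot> (e' \<cdot> j n \<cdot> e n) = g n)"
      then have k': "k \<in> Ar C" "Src C k = T'" "Tgt C k = Y"
        by (auto simp: hom_def)
      have "(k \<cdot> e') \<cdot> j n = g n \<cdot> inv_ar C (e n)" for n
      proof -
        have "g n \<cdot> inv_ar C (e n) = (k \<cdot> (e' \<cdot> j n \<cdot> e n)) \<cdot> inv_ar C (e n)"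
          using k by simp
        also have "\<dots> = (k \<cdot> e') \<cdot> j n"
          using k' e e' j by simp
        finally show ?thesis by simp
      qed
      then have "k \<cdot> e' = h"
        using k' e' by (intro h_unique) (simp_all add: hom_def)
      then show "k = h \<cdot> inv_ar C e'"
        using k' e' by auto
    qed
  qed
  then show ?thesis
    using j e e' cop unfolding is_coproduct_def by (auto simp: hom_def)
qed

locale tensor_power_category = monoidal_category M
  for M :: "('o, 'a, 'm) monoidal_scheme" (structure) +
  fixes S :: "'o \<Rightarrow> 'o" and \<alpha> :: "'o \<Rightarrow> nat \<Rightarrow> 'a"
  assumes left_preserves: "X \<in> Ob M \<Longrightarrow> preserves_denumerable_coproducts M M (tensor_left M X)"
    and right_preserves: "X \<in> Ob M \<Longrightarrow> preserves_denumerable_coproducts M M (tensor_right M X)"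
    and choice: "tensor_power_coproducts M S \<alpha>"
begin

text \<open>The words are kept beside the underlying coproduct, so that whiskering on the left and
  on the right can be combined.\<close>

definition strict_coproduct :: "(nat \<Rightarrow> 'o list) \<Rightarrow> 'o list \<Rightarrow> (nat \<Rightarrow> ('o list, 'a) marr) \<Rightarrow> bool" where
  "strict_coproduct u s j \<longleftrightarrow> (\<forall>n. sarr (j n) \<and> msrc (j n) = u n \<and> mtgt (j n) = s) \<and>
     is_coproduct M (\<lambda>n. tens (u n)) (tens s) (\<lambda>n. und (j n))"

lemma strict_coproduct_left:
  assumes x: "set x \<subseteq> Ob M" and cop: "strict_coproduct u s j"
  shows "strict_coproduct (\<lambda>n. x @ u n) (x @ s) (\<lambda>n. sidn x \<boxtimes> j n)"
proof -
  have j: "sarr (j n)" "msrc (j n) = u n" "mtgt (j n) = s" for n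
    using cop by (simp_all add: strict_coproduct_def)
  then have u: "set (u n) \<subseteq> Ob M" "set s \<subseteq> Ob M" for n
    using sarrD(1,2)[of "j n"] by auto
  have "is_coproduct M (\<lambda>n. tens x \<odot> tens (u n)) (tens x \<odot> tens s) (\<lambda>n. \<I> (tens x) \<otimes> und (j n))"
    using cop left_preserves[of "tens x"] x
    by (auto simp: strict_coproduct_def preserves_denumerable_coproducts_def tensor_left_def)
  then have "is_coproduct M (\<lambda>n. tens (x @ u n)) (tens (x @ s))
      (\<lambda>n. tens_iso x s \<cdot> (\<I> (tens x) \<otimes> und (j n)) \<cdot> inv_ar M (tens_iso x (u n)))"
    by (rule is_coproduct_iso) (use x u in simp_all)
  then show ?thesis
    using x j by (simp add: strict_coproduct_def) (simp add: sten_def sidn_def j)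
qed

lemma strict_coproduct_right:
  assumes x: "set x \<subseteq> Ob M" and cop: "strict_coproduct u s j"
  shows "strict_coproduct (\<lambda>n. u n @ x) (s @ x) (\<lambda>n. j n \<boxtimes> sidn x)"
proof -
  have j: "sarr (j n)" "msrc (j n) = u n" "mtgt (j n) = s" for n
    using cop by (simp_all add: strict_coproduct_def)
  then have u: "set (u n) \<subseteq> Ob M" "set s \<subseteq> Ob M" for n
    using sarrD(1,2)[of "j n"] by auto
  have "is_coproduct M (\<lambda>n. tens (u n) \<odot> tens x) (tens s \<odot> tens x) (\<lambda>n. und (j n) \<otimes> \<I> (tens x))"
    using cop right_preserves[of "tens x"] x
    by (auto simp: strict_coproduct_def preserves_denumerable_coproducts_def tensor_right_def)
  then have "is_coproduct M (\<lambda>n. tens (u n @ x)) (tens (s @ x))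
      (\<lambda>n. tens_iso s x \<cdot> (und (j n) \<otimes> \<I> (tens x)) \<cdot> inv_ar M (tens_iso (u n) x))"
    by (rule is_coproduct_iso) (use x u in simp_all)
  then show ?thesis
    using x j by (simp add: strict_coproduct_def) (simp add: sten_def sidn_def j)
qed

lemma strict_coproduct_ex1:
  assumes cop: "strict_coproduct u s j" and z: "set z \<subseteq> Ob M"
    and g: "\<And>n. sarr (g n)" "\<And>n. msrc (g n) = u n" "\<And>n. mtgt (g n) = z"
  shows "\<exists>!h. sarr h \<and> msrc h = s \<and> mtgt h = z \<and> (\<forall>n. h \<bullet> j n = g n)"
proof -
  have s: "set s \<subseteq> Ob M" and j: "msrc (j n) = u n" "mtgt (j n) = s" for n
    using cop sarrD(2)[of "j 0"] by (auto simp: strict_coproduct_def)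
  have "und (g n) \<in> hom M (tens (u n)) (tens z)" for n
    using g[of n] by (auto simp: sarr_def)
  then have ex1: "\<exists>!h. h \<in> hom M (tens s) (tens z) \<and> (\<forall>n. h \<cdot> und (j n) = und (g n))"
    using cop z unfolding strict_coproduct_def by (intro is_coproduct_ex1[where X = "\<lambda>n. tens (u n)"]) auto
  then obtain h where h: "h \<in> hom M (tens s) (tens z)" "\<And>n. h \<cdot> und (j n) = und (g n)"
    by blast
  show ?thesis
  proof (rule ex1I[of _ "MArr s h z"])
    show "sarr (MArr s h z) \<and> msrc (MArr s h z) = s \<and> mtgt (MArr s h z) = z \<and> (\<forall>n. MArr s h z \<bullet> j n = g n)"
      using h s z j g by (auto simp: sarr_def scmp_def intro!: marr.expand)
  next
    fix k
    assume k: "sarr k \<and> msrc k = s \<and> mtgt k = z \<and> (\<forall>n. k \<bullet> j n = g n)"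
    then have "und k \<cdot> und (j n) = und (g n)" for n
      by (metis scmp_def marr.sel(2))
    then have "und k = h"
      using ex1 h k unfolding sarr_def by blast
    then show "k = MArr s h z"
      using k by (intro marr.expand) simp
  qed
qed

definition s\<alpha> :: "'o \<Rightarrow> nat \<Rightarrow> ('o list, 'a) marr" where
  "s\<alpha> V n = MArr (replicate n V) (\<alpha> V n) [S V]"

lemma \<alpha>_typing:
  assumes "V \<in> Ob M"
  shows "S V \<in> Ob M" "\<alpha> V n \<in> Ar M" "Src M (\<alpha> V n) = tpow M V n" "Tgt M (\<alpha> V n) = S V"
  using assms choice by (auto simp: tensor_power_coproducts_def is_coproduct_def hom_def)

lemma strict_coproduct_s\<alpha>:
  assumes "V \<in> Ob M"
  shows "strict_coproduct (\<lambda>n. replicate n V) [S V] (s\<alpha> V)"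
  using assms choice \<alpha>_typing[OF assms]
  by (auto simp: tensor_power_coproducts_def strict_coproduct_def s\<alpha>_def sarr_def hom_def tens_replicate
      set_replicate_conv_if)

lemma strict_tensor_algebra_s\<alpha>:
  assumes V: "V \<in> Ob M"
  shows "strict_tensor_algebra (Ob M) sarr msrc mtgt sidn scmp sten V (S V) (s\<alpha> V)"
proof
  show "V \<in> Ob M" by fact
  fix n
  show "sarr (s\<alpha> V n)" "msrc (s\<alpha> V n) = replicate n V" "mtgt (s\<alpha> V n) = [S V]"
    using strict_coproduct_s\<alpha>[OF V] by (simp_all add: strict_coproduct_def)
next
  fix x y z g
  assume "set x \<subseteq> Ob M" "set y \<subseteq> Ob M" "set z \<subseteq> Ob M" "\<And>n. sarr (g n)"
    "\<And>n. msrc (g n) = x @ replicate n V @ y" "\<And>n. mtgt (g n) = z"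
  then show "\<exists>!h. sarr h \<and> msrc h = x @ [S V] @ y \<and> mtgt h = z \<and> (\<forall>n. h \<bullet> sidn x \<boxtimes> s\<alpha> V n \<boxtimes> sidn y = g n)"
    by (intro strict_coproduct_ex1[OF strict_coproduct_left[OF _ strict_coproduct_right[OF _ strict_coproduct_s\<alpha>[OF V]]]])
qed

end

section \<open>The graded braiding\<close>

context monoidal_category
begin

lemma Cmp_left_iff:
  assumes "is_iso M k" "f \<in> Ar M" "g \<in> Ar M" "Src M k = Tgt M f" "Src M k = Tgt M g"
  shows "k \<cdot> f = k \<cdot> g \<longleftrightarrow> f = g"
  using assms is_iso_cancel_left by blast

lemma tpow_Ob [simp]: "V \<in> Ob M \<Longrightarrow> tpow M V n \<in> Ob M"
  by (subst tens_replicate[symmetric], rule tens_Ob) (auto simp: set_replicate_conv_if)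

lemma tpow_iso_typing [simp]:
  assumes "V \<in> Ob M"
  shows "is_iso M (tpow_iso M V m n)" "Src M (tpow_iso M V m n) = tpow M V m \<odot> tpow M V n"
    "Tgt M (tpow_iso M V m n) = tpow M V (m + n)" "tpow_iso M V m n \<in> Ar M"
  using assms tens_iso_typing[of "replicate m V" "replicate n V"]
  by (simp_all add: tens_iso_replicate tens_replicate replicate_add[symmetric] set_replicate_conv_if split: if_splits)

abbreviation sgam :: "'o \<Rightarrow> 'a \<Rightarrow> nat \<Rightarrow> nat \<Rightarrow> ('o list, 'a) marr" where
  "sgam V c \<equiv> strict_braided_object.gam sidn scmp sten V (MArr [V, V] c [V, V])"

text \<open>The strict counterpart of a crossing: source and target are both identified with the
  power m + n, where it can be compared with \<open>gam m n\<close>.\<close>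

definition power_lift :: "'o \<Rightarrow> (nat \<Rightarrow> nat \<Rightarrow> 'a) \<Rightarrow> nat \<Rightarrow> nat \<Rightarrow> ('o list, 'a) marr" where
  "power_lift V \<gamma> m n =
     MArr (replicate (m + n) V) (tpow_iso M V n m \<cdot> \<gamma> m n \<cdot> inv_ar M (tpow_iso M V m n)) (replicate (m + n) V)"

lemma strict_braided_object_if:
  assumes "is_braided_object M (V, c)"
  shows "strict_braided_object (Ob M) sarr msrc mtgt sidn scmp sten V (MArr [V, V] c [V, V])"
proof
  show "V \<in> Ob M"
    using assms by (simp add: is_braided_object_def)
  have B: "strict.braided_object V (MArr [V, V] c [V, V])"
    using assms by (simp add: braided_object_strict_iff)
  then show "sarr (MArr [V, V] c [V, V])"
    unfolding strict.braided_object_def by (blast intro: strict.iso_arr)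
qed (use assms in \<open>auto simp: braided_object_strict_iff strict.braided_object_def\<close>)

text \<open>After translation the axioms are identities that \<open>gam\<close> satisfies, and by
  \<open>gam_unique\<close> they determine it. Existence and uniqueness of the graded braiding are
  then a matter of conjugating back.\<close>

lemma is_graded_braiding_iff:
  assumes c: "is_braided_object M (V, c)"
  shows "is_graded_braiding M V c \<gamma> \<longleftrightarrow>
    (\<forall>a b. \<gamma> a b \<in> hom M (tpow M V a \<odot> tpow M V b) (tpow M V b \<odot> tpow M V a)) \<and> power_lift V \<gamma> = sgam V c"
proof (cases "\<forall>a b. \<gamma> a b \<in> hom M (tpow M V a \<odot> tpow M V b) (tpow M V b \<odot> tpow M V a)")
  case True
  have V [simp]: "V \<in> Ob M" and c' [simp]: "c \<in> Ar M" "Src M c = V \<odot> V" "Tgt M c = V \<odot> V"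
    using c by (auto simp: is_braided_object_def hom_def)
  interpret B: strict_braided_object "Ob M" sarr msrc mtgt sidn scmp sten V "MArr [V, V] c [V, V]"
    using c by (rule strict_braided_object_if)
  let ?P = "tpow M V" and ?\<phi> = "tpow_iso M V" and ?G = "power_lift V \<gamma>"
  have \<gamma> [simp]: "\<gamma> a b \<in> Ar M" "Src M (\<gamma> a b) = ?P a \<odot> ?P b" "Tgt M (\<gamma> a b) = ?P b \<odot> ?P a" for a b
    using True by (auto simp: hom_def)
  \<comment> \<open>The underlying arrow is an identity and only the word changes. The arrows \<phi>
    and \<open>g\<close> view the given data on one-letter words.\<close>
  define \<kappa> where "\<kappa> n = MArr [?P n] (\<I> (?P n)) (replicate n V)" for n
  define \<phi> where "\<phi> m n = MArr [?P m, ?P n] (?\<phi> m n) [?P (m + n)]" for m n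
  define g where "g m n = MArr [?P m, ?P n] (\<gamma> m n) [?P n, ?P m]" for m n
  interpret T: strict_power_transport "Ob M" sarr msrc mtgt sidn scmp sten V ?P \<kappa> \<phi> g ?G
  proof
    fix m n
    have \<kappa>_arr: "sarr (\<kappa> n)" for n
      by (simp add: \<kappa>_def sarr_def hom_def tens_replicate)
    then show "strict.iso (\<kappa> n)"
      by (subst iso_strict_iff) (simp_all add: \<kappa>_def)
    show "?P n \<in> Ob M" by simp
    show "msrc (\<kappa> n) = [?P n]" "mtgt (\<kappa> n) = replicate n V" "msrc (\<phi> m n) = [?P m, ?P n]" "mtgt (\<phi> m n) = [?P (m + n)]"
      "msrc (g m n) = [?P m, ?P n]" "mtgt (g m n) = [?P n, ?P m]" "msrc (?G m n) = replicate (m + n) V"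
      "mtgt (?G m n) = replicate (m + n) V"
      by (simp_all add: \<kappa>_def \<phi>_def g_def power_lift_def)
    show "sarr (\<phi> m n)" "sarr (g m n)" "sarr (?G m n)"
      by (simp_all add: \<phi>_def g_def power_lift_def sarr_def hom_def tens_replicate add.commute)
    show "\<kappa> (m + n) \<bullet> \<phi> m n = \<kappa> m \<boxtimes> \<kappa> n"
      by (simp add: \<kappa>_def \<phi>_def scmp_def sten_def tens_iso_replicate replicate_add)
    show "(\<kappa> n \<boxtimes> \<kappa> m) \<bullet> g m n = ?G m n \<bullet> (\<kappa> m \<boxtimes> \<kappa> n)"
      by (simp add: \<kappa>_def g_def power_lift_def scmp_def sten_def tens_iso_replicate replicate_add[symmetric] add.commute)
  qed
  note gd = g_def \<phi>_def strict_defs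
  have yb: "\<a>\<inverse> (?P n) (?P m) (?P l) \<cdot> (\<I> (?P n) \<otimes> \<gamma> l m) \<cdot> \<a> (?P n) (?P l) (?P m) \<cdot> (\<gamma> l n \<otimes> \<I> (?P m)) \<cdot>
        \<a>\<inverse> (?P l) (?P n) (?P m) \<cdot> (\<I> (?P l) \<otimes> \<gamma> m n) \<cdot> \<a> (?P l) (?P m) (?P n) =
      (\<gamma> m n \<otimes> \<I> (?P l)) \<cdot> \<a>\<inverse> (?P m) (?P n) (?P l) \<cdot> (\<I> (?P m) \<otimes> \<gamma> l n) \<cdot> \<a> (?P m) (?P l) (?P n) \<cdot>
        (\<gamma> l m \<otimes> \<I> (?P n)) \<longleftrightarrow>
      (B.pw n \<boxtimes> ?G l m) \<bullet> (?G l n \<boxtimes> B.pw m) \<bullet> (B.pw l \<boxtimes> ?G m n) =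
      (?G m n \<boxtimes> B.pw l) \<bullet> (B.pw m \<boxtimes> ?G l n) \<bullet> (?G l m \<boxtimes> B.pw n)" for l m n
    unfolding T.yang_baxter_transport[symmetric] by (simp add: gd)
  have add_left: "(\<I> (?P n) \<otimes> ?\<phi> l m) \<cdot> \<a> (?P n) (?P l) (?P m) \<cdot> (\<gamma> l n \<otimes> \<I> (?P m)) \<cdot> \<a>\<inverse> (?P l) (?P n) (?P m) \<cdot>
        (\<I> (?P l) \<otimes> \<gamma> m n) \<cdot> \<a> (?P l) (?P m) (?P n) = \<gamma> (l + m) n \<cdot> (?\<phi> l m \<otimes> \<I> (?P n)) \<longleftrightarrow>
      ?G (l + m) n = (?G l n \<boxtimes> B.pw m) \<bullet> (B.pw l \<boxtimes> ?G m n)" for l m n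
    unfolding T.add_left_transport[symmetric] by (simp add: gd)
  have add_right: "(?\<phi> m n \<otimes> \<I> (?P l)) \<cdot> \<a>\<inverse> (?P m) (?P n) (?P l) \<cdot> (\<I> (?P m) \<otimes> \<gamma> l n) \<cdot> \<a> (?P m) (?P l) (?P n) \<cdot>
        (\<gamma> l m \<otimes> \<I> (?P n)) \<cdot> \<a>\<inverse> (?P l) (?P m) (?P n) = \<gamma> l (m + n) \<cdot> (\<I> (?P l) \<otimes> ?\<phi> m n) \<longleftrightarrow>
      ?G l (m + n) = (B.pw m \<boxtimes> ?G l n) \<bullet> (?G l m \<boxtimes> B.pw n)" for l m n
    unfolding T.add_right_transport[symmetric]
    \<comment> \<open>The axiom starts at the right bracketing and the strict equation at the left
      one, so the final associator is moved to the other side.\<close>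
    using Cmp_inv_ar_eq_iff[of "\<a> (?P l) (?P m) (?P n)" "(?\<phi> m n \<otimes> \<I> (?P l)) \<cdot> inv_ar M (\<a> (?P m) (?P n) (?P l)) \<cdot>
        (\<I> (?P m) \<otimes> \<gamma> l n) \<cdot> \<a> (?P m) (?P l) (?P n) \<cdot> (\<gamma> l m \<otimes> \<I> (?P n))" "\<gamma> l (m + n) \<cdot> (\<I> (?P l) \<otimes> ?\<phi> m n)"]
    by (simp add: gd)
  have zero_left: "\<gamma> 0 n \<cdot> \<l>\<inverse> (?P n) = \<r>\<inverse> (?P n) \<longleftrightarrow> ?G 0 n = B.pw n" for n
  proof -
    \<comment> \<open>The identifications at (0, n) and (n, 0) are the unit constraints, so the left
      side is the arrow underlying \<open>?G 0 n\<close> and the right side an identity.\<close>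
    have "\<r> (?P n) \<cdot> (\<gamma> 0 n \<cdot> inv_ar M (\<l> (?P n))) = \<r> (?P n) \<cdot> inv_ar M (\<r> (?P n)) \<longleftrightarrow>
        \<gamma> 0 n \<cdot> inv_ar M (\<l> (?P n)) = inv_ar M (\<r> (?P n))"
      by (rule Cmp_left_iff) simp_all
    moreover have "?\<phi> n 0 = \<r> (?P n)"
      using tens_iso_Nil_right[of "replicate n V"] tens_iso_replicate[of n V 0] by (simp add: tens_replicate)
    ultimately show ?thesis
      by (simp add: power_lift_def sidn_def Lun_inv_def Run_inv_def tens_replicate)
  qed
  have zero_right: "\<gamma> n 0 \<cdot> \<r>\<inverse> (?P n) = \<l>\<inverse> (?P n) \<longleftrightarrow> ?G n 0 = B.pw n" for n
  proof -
    have "\<l> (?P n) \<cdot> (\<gamma> n 0 \<cdot> inv_ar M (\<r> (?P n))) = \<l> (?P n) \<cdot> inv_ar M (\<l> (?P n)) \<longleftrightarrow>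
        \<gamma> n 0 \<cdot> inv_ar M (\<r> (?P n)) = inv_ar M (\<l> (?P n))"
      by (rule Cmp_left_iff) simp_all
    moreover have "?\<phi> n 0 = \<r> (?P n)"
      using tens_iso_Nil_right[of "replicate n V"] tens_iso_replicate[of n V 0] by (simp add: tens_replicate)
    ultimately show ?thesis
      by (simp add: power_lift_def sidn_def Lun_inv_def Run_inv_def tens_replicate)
  qed
  have one: "\<gamma> 1 1 = c \<longleftrightarrow> ?G 1 1 = MArr [V, V] c [V, V]"
    using \<gamma>[of 1 1] by (simp add: power_lift_def numeral_2_eq_2)
  have G_typing: "sarr (?G m n)" "msrc (?G m n) = replicate (m + n) V" "mtgt (?G m n) = replicate (m + n) V" for m n
    by simp_all
  show ?thesis
    unfolding is_graded_braiding_def Let_def yb add_left add_right zero_left zero_right one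
    using True B.gam_unique[of ?G, OF G_typing]
    by (auto simp: B.gam_yang_baxter B.gam_add_left B.gam_add_right B.gam_0_right simp del: B.gam.simps(2) intro: B.gam_1_1[simplified])
qed (auto simp: is_graded_braiding_def Let_def)

lemma graded_braiding:
  assumes c: "is_braided_object M (V, c)"
  shows "graded_braiding M V c m n \<in> hom M (tpow M V m \<odot> tpow M V n) (tpow M V n \<odot> tpow M V m)"
    and "power_lift V (graded_braiding M V c) = sgam V c"
proof -
  have V [simp]: "V \<in> Ob M"
    using c by (auto simp: is_braided_object_def)
  interpret B: strict_braided_object "Ob M" sarr msrc mtgt sidn scmp sten V "MArr [V, V] c [V, V]"
    using c by (rule strict_braided_object_if)
  have gam: "und (sgam V c m n) \<in> Ar M" "Src M (und (sgam V c m n)) = tpow M V (m + n)"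
    "Tgt M (und (sgam V c m n)) = tpow M V (m + n)" for m n
    using sarrD(3-5)[of "sgam V c m n"] by (simp_all add: tens_replicate)
  \<comment> \<open>The only candidate: the strict crossing conjugated back to the products of
    powers.\<close>
  let ?g = "\<lambda>m n. inv_ar M (tpow_iso M V n m) \<cdot> und (sgam V c m n) \<cdot> tpow_iso M V m n"
  have lift: "power_lift V ?g = sgam V c"
    by (intro ext marr.expand) (simp add: power_lift_def gam add.commute)
  have ex: "is_graded_braiding M V c ?g"
    unfolding is_graded_braiding_iff[OF c] using lift by (simp add: hom_def gam add.commute)
  have unique: "\<gamma> = \<gamma>'" if \<gamma>: "is_graded_braiding M V c \<gamma>" "is_graded_braiding M V c \<gamma>'" for \<gamma> \<gamma>'
  proof (intro ext)
    fix m n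
    note \<gamma>' = \<gamma>[unfolded is_graded_braiding_iff[OF c]]
    have "tpow_iso M V n m \<cdot> \<gamma> m n \<cdot> inv_ar M (tpow_iso M V m n) = tpow_iso M V n m \<cdot> \<gamma>' m n \<cdot> inv_ar M (tpow_iso M V m n)"
    proof -
      have "power_lift V \<gamma> m n = power_lift V \<gamma>' m n"
        using \<gamma>' by simp
      then show ?thesis by (simp add: power_lift_def)
    qed
    then have "\<gamma> m n \<cdot> inv_ar M (tpow_iso M V m n) = \<gamma>' m n \<cdot> inv_ar M (tpow_iso M V m n)"
      by (rule is_iso_cancel_left[rotated]) (use \<gamma>' in \<open>simp_all add: hom_def\<close>)
    then show "\<gamma> m n = \<gamma>' m n"
      by (rule is_iso_cancel_right[rotated]) (use \<gamma>' in \<open>simp_all add: hom_def\<close>)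
  qed
  have "is_graded_braiding M V c (graded_braiding M V c)"
    unfolding graded_braiding_def by (rule theI[where P = "is_graded_braiding M V c", OF ex]) (rule unique[OF _ ex])
  then show "graded_braiding M V c m n \<in> hom M (tpow M V m \<odot> tpow M V n) (tpow M V n \<odot> tpow M V m)"
    and "power_lift V (graded_braiding M V c) = sgam V c"
    unfolding is_graded_braiding_iff[OF c] by blast+
qed

end

section \<open>The tensor algebra and its braiding\<close>

context tensor_power_category
begin

lemma T_mult_strict_iff:
  assumes V: "V \<in> Ob M"
  shows "\<mu> \<in> hom M (S V \<odot> S V) (S V) \<and> (\<forall>m n. \<mu> \<cdot> (\<alpha> V m \<otimes> \<alpha> V n) = \<alpha> V (m + n) \<cdot> tpow_iso M V m n) \<longleftrightarrow>
    sarr (MArr [S V, S V] \<mu> [S V]) \<and> (\<forall>m n. MArr [S V, S V] \<mu> [S V] \<bullet> (s\<alpha> V m \<boxtimes> s\<alpha> V n) = s\<alpha> V (m + n))"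
proof (cases "\<mu> \<in> hom M (S V \<odot> S V) (S V)")
  case True
  note [simp] = \<alpha>_typing[OF V] V
  have [simp]: "\<mu> \<in> Ar M" "Src M \<mu> = S V \<odot> S V" "Tgt M \<mu> = S V"
    using True by (auto simp: hom_def)
  have "\<mu> \<cdot> (\<alpha> V m \<otimes> \<alpha> V n) = \<alpha> V (m + n) \<cdot> tpow_iso M V m n \<longleftrightarrow>
      MArr [S V, S V] \<mu> [S V] \<bullet> (s\<alpha> V m \<boxtimes> s\<alpha> V n) = s\<alpha> V (m + n)" for m n
    using Cmp_inv_ar_eq_iff[of "tpow_iso M V m n" "\<mu> \<cdot> (\<alpha> V m \<otimes> \<alpha> V n)" "\<alpha> V (m + n)"]
    by (simp add: s\<alpha>_def scmp_def sten_def tens_iso_replicate replicate_add)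
  then show ?thesis
    by (simp add: sarr_def hom_def)
qed (auto simp: sarr_def)

lemma T_mult:
  assumes V: "V \<in> Ob M"
  shows "strict_tensor_algebra_mult (Ob M) sarr msrc mtgt sidn scmp sten V (S V) (s\<alpha> V)
    (MArr [S V, S V] (T_mult M S \<alpha> V) [S V])"
proof -
  interpret T: strict_tensor_algebra "Ob M" sarr msrc mtgt sidn scmp sten V "S V" "s\<alpha> V"
    using V by (rule strict_tensor_algebra_s\<alpha>)
  have "\<exists>!\<mu>. sarr (MArr [S V, S V] \<mu> [S V]) \<and> (\<forall>m n. MArr [S V, S V] \<mu> [S V] \<bullet> (s\<alpha> V m \<boxtimes> s\<alpha> V n) = s\<alpha> V (m + n))"
  proof -
    obtain \<mu> where \<mu>: "sarr \<mu>" "msrc \<mu> = [S V, S V]" "mtgt \<mu> = [S V]" "\<And>m n. \<mu> \<bullet> (s\<alpha> V m \<boxtimes> s\<alpha> V n) = s\<alpha> V (m + n)"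
      using T.mult_ex1 by blast
    have "MArr [S V, S V] (und \<mu>) [S V] = \<mu>"
      using \<mu> by (intro marr.expand) simp
    then show ?thesis
      using \<mu> T.\<alpha>2_epi[of "MArr [S V, S V] _ [S V]" \<mu>] by (intro ex1I[of _ "und \<mu>"]) auto
  qed
  from theI'[OF this] show ?thesis
    unfolding T_mult_def T_mult_strict_iff[OF V] by unfold_locales auto
qed

lemma T_braiding_strict_iff:
  assumes c: "is_braided_object M (V, c)"
  shows "is_T_braiding M S \<alpha> V c d \<longleftrightarrow> sarr (MArr [S V, S V] d [S V, S V]) \<and>
    (\<forall>m n. MArr [S V, S V] d [S V, S V] \<bullet> (s\<alpha> V m \<boxtimes> s\<alpha> V n) = (s\<alpha> V n \<boxtimes> s\<alpha> V m) \<bullet> sgam V c m n)"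
proof (cases "d \<in> hom M (S V \<odot> S V) (S V \<odot> S V)")
  case True
  have V [simp]: "V \<in> Ob M"
    using c by (auto simp: is_braided_object_def)
  note [simp] = \<alpha>_typing[OF V]
  have [simp]: "d \<in> Ar M" "Src M d = S V \<odot> S V" "Tgt M d = S V \<odot> S V"
    using True by (auto simp: hom_def)
  note [simp] = homD[OF graded_braiding(1)[OF c]]
  have "d \<cdot> (\<alpha> V m \<otimes> \<alpha> V n) = (\<alpha> V n \<otimes> \<alpha> V m) \<cdot> graded_braiding M V c m n \<longleftrightarrow>
      MArr [S V, S V] d [S V, S V] \<bullet> (s\<alpha> V m \<boxtimes> s\<alpha> V n) = (s\<alpha> V n \<boxtimes> s\<alpha> V m) \<bullet> sgam V c m n" for m n
    using Cmp_right_iff[of "inv_ar M (tpow_iso M V m n)" "d \<cdot> (\<alpha> V m \<otimes> \<alpha> V n)"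
        "(\<alpha> V n \<otimes> \<alpha> V m) \<cdot> graded_braiding M V c m n"]
    by (simp add: s\<alpha>_def scmp_def sten_def tens_iso_replicate replicate_add graded_braiding(2)[OF c, symmetric] power_lift_def)
  then show ?thesis
    by (simp add: is_T_braiding_def sarr_def hom_def)
qed (auto simp: is_T_braiding_def sarr_def)

lemma T_braiding:
  assumes c: "is_braided_object M (V, c)" and d: "is_T_braiding M S \<alpha> V c d"
  shows "strict_braided_tensor_algebra_mult (Ob M) sarr msrc mtgt sidn scmp sten V (S V) (s\<alpha> V)
    (MArr [V, V] c [V, V]) (MArr [S V, S V] (T_mult M S \<alpha> V) [S V]) (MArr [S V, S V] d [S V, S V])"
proof -
  have V: "V \<in> Ob M"
    using c by (auto simp: is_braided_object_def)
  interpret T: strict_tensor_algebra_mult "Ob M" sarr msrc mtgt sidn scmp sten V "S V" "s\<alpha> V"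
      "MArr [S V, S V] (T_mult M S \<alpha> V) [S V]"
    using V by (rule T_mult)
  interpret B: strict_braided_object "Ob M" sarr msrc mtgt sidn scmp sten V "MArr [V, V] c [V, V]"
    using c by (rule strict_braided_object_if)
  show ?thesis
    using c d unfolding T_braiding_strict_iff[OF c] braided_object_strict_iff strict.braided_object_def
    by unfold_locales auto
qed

lemma T_braiding_ex1:
  assumes c: "is_braided_object M (V, c)"
  shows "\<exists>!d. is_T_braiding M S \<alpha> V c d"
proof -
  have V: "V \<in> Ob M"
    using c by (auto simp: is_braided_object_def)
  interpret T: strict_tensor_algebra "Ob M" sarr msrc mtgt sidn scmp sten V "S V" "s\<alpha> V"
    using V by (rule strict_tensor_algebra_s\<alpha>)
  interpret B: strict_braided_object "Ob M" sarr msrc mtgt sidn scmp sten V "MArr [V, V] c [V, V]"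
    using c by (rule strict_braided_object_if)
  interpret B: strict_braided_tensor_algebra "Ob M" sarr msrc mtgt sidn scmp sten V "S V" "s\<alpha> V" "MArr [V, V] c [V, V]" ..
  obtain d where d: "sarr d" "msrc d = [S V, S V]" "mtgt d = [S V, S V]"
    "\<And>m n. d \<bullet> (s\<alpha> V m \<boxtimes> s\<alpha> V n) = (s\<alpha> V n \<boxtimes> s\<alpha> V m) \<bullet> sgam V c m n"
    using B.braiding_ex1 by blast
  have "MArr [S V, S V] (und d) [S V, S V] = d"
    using d by (intro marr.expand) simp
  then show ?thesis
    unfolding T_braiding_strict_iff[OF c]
    using d T.\<alpha>2_epi[of "MArr [S V, S V] _ [S V, S V]" d] by (intro ex1I[of _ "und d"]) auto
qed

end

section \<open>Adjunctions from universal arrows\<close>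

lemma is_functorD:
  assumes "is_functor C D F"
  shows "category C" "category D" "X \<in> Ob C \<Longrightarrow> FO F X \<in> Ob D"
    "f \<in> hom C X Y \<Longrightarrow> FA F f \<in> hom D (FO F X) (FO F Y)"
    "X \<in> Ob C \<Longrightarrow> FA F (Idn C X) = Idn D (FO F X)"
    "f \<in> hom C X Y \<Longrightarrow> g \<in> hom C Y Z \<Longrightarrow> FA F (Cmp C g f) = Cmp D (FA F g) (FA F f)"
  using assms unfolding is_functor_def by blast+

lemma is_functorI:
  assumes "category C" "category D" "\<And>X. X \<in> Ob C \<Longrightarrow> FO F X \<in> Ob D"
    "\<And>X Y f. f \<in> hom C X Y \<Longrightarrow> FA F f \<in> hom D (FO F X) (FO F Y)"
    "\<And>X. X \<in> Ob C \<Longrightarrow> FA F (Idn C X) = Idn D (FO F X)"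
    "\<And>X Y Z f g. f \<in> hom C X Y \<Longrightarrow> g \<in> hom C Y Z \<Longrightarrow> FA F (Cmp C g f) = Cmp D (FA F g) (FA F f)"
  shows "is_functor C D F"
  using assms unfolding is_functor_def by simp

lemma fcomp_simps [simp]: "FO (G \<circ>\<^sub>F F) X = FO G (FO F X)" "FA (G \<circ>\<^sub>F F) f = FA G (FA F f)"
  by (simp_all add: fcomp_def)

lemma id_functor_simps [simp]: "FO id_functor X = X" "FA id_functor f = f"
  by (simp_all add: id_functor_def)

lemma is_functor_id: "category C \<Longrightarrow> is_functor C C id_functor"
  by (rule is_functorI) simp_all

lemma is_functor_fcomp:
  assumes F: "is_functor C D F" and G: "is_functor D E G"
  shows "is_functor C E (G \<circ>\<^sub>F F)"
proof (rule is_functorI)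
  fix X Y Z f g
  assume f: "f \<in> hom C X Y" and g: "g \<in> hom C Y Z"
  show "FA (G \<circ>\<^sub>F F) (Cmp C g f) = Cmp E (FA (G \<circ>\<^sub>F F) g) (FA (G \<circ>\<^sub>F F) f)"
    using is_functorD(6)[OF F f g] is_functorD(6)[OF G is_functorD(4)[OF F f] is_functorD(4)[OF F g]] by simp
qed (use is_functorD[OF F] is_functorD[OF G] in simp_all)

text \<open>Functoriality only concerns values on the source category. For the last equality of
  functors it is thus inherited by \<open>T_functor M S \<alpha> \<circ>\<^sub>F H_Br\<close> from
  \<open>H_Alg \<circ>\<^sub>F T_Br\<close>.\<close>

lemma is_functor_cong:
  assumes F: "is_functor C D F" and FO: "\<And>X. X \<in> Ob C \<Longrightarrow> FO G X = FO F X"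
    and FA: "\<And>f. f \<in> Ar C \<Longrightarrow> FA G f = FA F f"
  shows "is_functor C D G"
proof -
  interpret C: category C using is_functorD(1)[OF F] .
  have hom: "f \<in> Ar C" "X \<in> Ob C" "Y \<in> Ob C" if "f \<in> hom C X Y" for f X Y
    using that C.Src_Ob C.Tgt_Ob by (auto simp: hom_def)
  show ?thesis
  proof (rule is_functorI)
    fix X Y f
    assume f: "f \<in> hom C X Y"
    show "FA G f \<in> hom D (FO G X) (FO G Y)"
      using hom[OF f] is_functorD(4)[OF F f] by (simp add: FO FA)
    fix Z g
    assume g: "g \<in> hom C Y Z"
    show "FA G (Cmp C g f) = Cmp D (FA G g) (FA G f)"
      using hom[OF f] hom[OF g] hom[OF C.Cmp_hom[OF f g]] is_functorD(6)[OF F f g] by (simp add: FA)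
  next
    fix X
    assume X: "X \<in> Ob C"
    show "FO G X \<in> Ob D" "FA G (Idn C X) = Idn D (FO G X)"
      using is_functorD(3,5)[OF F X] hom(1)[OF C.Idn_hom[OF X]] X by (simp_all add: FO FA)
  qed (rule is_functorD[OF F])+
qed

text \<open>Functoriality of \<open>L\<close>, naturality of \<epsilon> and the triangle identity at
  \<open>FO L X\<close> are equations between arrows out of a free object. By \<open>unique\<close>
  each may be checked after applying \<open>R\<close> and restricting along \<eta>.\<close>

lemma adjunction_from_universal_arrows:
  assumes C: "category C" and R: "is_functor D C R"
    and L_ob: "\<And>X. X \<in> Ob C \<Longrightarrow> FO L X \<in> Ob D"
    and \<eta>: "\<And>X. X \<in> Ob C \<Longrightarrow> \<eta> X \<in> hom C X (FO R (FO L X))"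
    and L_ar: "\<And>X Y f. f \<in> hom C X Y \<Longrightarrow> FA L f \<in> hom D (FO L X) (FO L Y)"
    and L_\<eta>: "\<And>X Y f. f \<in> hom C X Y \<Longrightarrow> Cmp C (FA R (FA L f)) (\<eta> X) = Cmp C (\<eta> Y) f"
    and \<epsilon>: "\<And>B. B \<in> Ob D \<Longrightarrow> \<epsilon> B \<in> hom D (FO L (FO R B)) B"
    and \<epsilon>_\<eta>: "\<And>B. B \<in> Ob D \<Longrightarrow> Cmp C (FA R (\<epsilon> B)) (\<eta> (FO R B)) = Idn C (FO R B)"
    and unique: "\<And>X B h k. X \<in> Ob C \<Longrightarrow> h \<in> hom D (FO L X) B \<Longrightarrow> k \<in> hom D (FO L X) B \<Longrightarrow>
      Cmp C (FA R h) (\<eta> X) = Cmp C (FA R k) (\<eta> X) \<Longrightarrow> h = k"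
  shows "adjunction C D L R \<eta> \<epsilon>"
proof -
  interpret C: category C by fact
  interpret D: category D using is_functorD(1)[OF R] .
  note R_ob = is_functorD(3)[OF R] and R_ar = is_functorD(4)[OF R] and R_Idn = is_functorD(5)[OF R]
    and R_Cmp = is_functorD(6)[OF R]
  have hom_ob: "X \<in> Ob C" "Y \<in> Ob C" if "f \<in> hom C X Y" for f X Y
    using that C.Src_Ob C.Tgt_Ob by (auto simp: hom_def)
  have hom_ob_D: "X \<in> Ob D" "Y \<in> Ob D" if "f \<in> hom D X Y" for f X Y
    using that D.Src_Ob D.Tgt_Ob by (auto simp: hom_def)
  have L_Idn: "FA L (Idn C X) = Idn D (FO L X)" if X: "X \<in> Ob C" for X
  proof (rule unique[OF X])
    show "FA L (Idn C X) \<in> hom D (FO L X) (FO L X)" "Idn D (FO L X) \<in> hom D (FO L X) (FO L X)"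
      using X L_ar[OF C.Idn_hom] D.Idn_hom[OF L_ob] by auto
    show "Cmp C (FA R (FA L (Idn C X))) (\<eta> X) = Cmp C (FA R (Idn D (FO L X))) (\<eta> X)"
      using X L_\<eta>[OF C.Idn_hom[OF X]] C.Cmp_Idn[OF \<eta>[OF X]] C.Idn_Cmp[OF \<eta>[OF X]] R_Idn[OF L_ob[OF X]] by simp
  qed
  have L_Cmp: "FA L (Cmp C g f) = Cmp D (FA L g) (FA L f)" if f: "f \<in> hom C X Y" and g: "g \<in> hom C Y Z" for X Y Z f g
  proof (rule unique)
    note X = hom_ob(1)[OF f] and Y = hom_ob(2)[OF f] and Z = hom_ob(2)[OF g]
    show "X \<in> Ob C" by fact
    show "FA L (Cmp C g f) \<in> hom D (FO L X) (FO L Z)"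
      by (rule L_ar[OF C.Cmp_hom[OF f g]])
    show "Cmp D (FA L g) (FA L f) \<in> hom D (FO L X) (FO L Z)"
      by (rule D.Cmp_hom[OF L_ar[OF f] L_ar[OF g]])
    have "Cmp C (FA R (Cmp D (FA L g) (FA L f))) (\<eta> X) = Cmp C (FA R (FA L g)) (Cmp C (\<eta> Y) f)"
      unfolding R_Cmp[OF L_ar[OF f] L_ar[OF g]] L_\<eta>[OF f, symmetric]
      by (rule C.Cmp_assoc[OF \<eta>[OF X] R_ar[OF L_ar[OF f]] R_ar[OF L_ar[OF g]]])
    also have "\<dots> = Cmp C (Cmp C (\<eta> Z) g) f"
      unfolding L_\<eta>[OF g, symmetric] by (rule C.Cmp_assoc[OF f \<eta>[OF Y] R_ar[OF L_ar[OF g]], symmetric])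
    also have "\<dots> = Cmp C (FA R (FA L (Cmp C g f))) (\<eta> X)"
      unfolding L_\<eta>[OF C.Cmp_hom[OF f g]] by (rule C.Cmp_assoc[OF f g \<eta>[OF Z]])
    finally show "Cmp C (FA R (FA L (Cmp C g f))) (\<eta> X) = Cmp C (FA R (Cmp D (FA L g) (FA L f))) (\<eta> X)"
      by (rule sym)
  qed
  have L: "is_functor C D L"
    by (rule is_functorI) (use C.category_axioms D.category_axioms L_ob L_ar L_Idn L_Cmp in auto)
  have \<eta>_nat: "nat_trans C C id_functor (R \<circ>\<^sub>F L) \<eta>"
    unfolding nat_trans_def
    using is_functor_id[OF C] is_functor_fcomp[OF L R] \<eta> L_\<eta> by simp
  have "Cmp D (\<epsilon> B') (FA L (FA R f)) = Cmp D f (\<epsilon> B)" if f: "f \<in> hom D B B'" for B B' f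
  proof (rule unique)
    note B = hom_ob_D(1)[OF f] and B' = hom_ob_D(2)[OF f]
    note LRf = L_ar[OF R_ar[OF f]]
    show "FO R B \<in> Ob C" using R_ob[OF B] .
    show "Cmp D (\<epsilon> B') (FA L (FA R f)) \<in> hom D (FO L (FO R B)) B'"
      by (rule D.Cmp_hom[OF LRf \<epsilon>[OF B']])
    show "Cmp D f (\<epsilon> B) \<in> hom D (FO L (FO R B)) B'"
      by (rule D.Cmp_hom[OF \<epsilon>[OF B] f])
    have "Cmp C (FA R (Cmp D (\<epsilon> B') (FA L (FA R f)))) (\<eta> (FO R B)) =
        Cmp C (FA R (\<epsilon> B')) (Cmp C (\<eta> (FO R B')) (FA R f))"
      unfolding R_Cmp[OF LRf \<epsilon>[OF B']] L_\<eta>[OF R_ar[OF f], symmetric]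
      by (rule C.Cmp_assoc[OF \<eta>[OF R_ob[OF B]] R_ar[OF LRf] R_ar[OF \<epsilon>[OF B']]])
    also have "\<dots> = Cmp C (Idn C (FO R B')) (FA R f)"
      unfolding \<epsilon>_\<eta>[OF B', symmetric]
      by (rule C.Cmp_assoc[OF R_ar[OF f] \<eta>[OF R_ob[OF B']] R_ar[OF \<epsilon>[OF B']], symmetric])
    also have "\<dots> = Cmp C (FA R f) (Cmp C (FA R (\<epsilon> B)) (\<eta> (FO R B)))"
      using C.Idn_Cmp[OF R_ar[OF f]] C.Cmp_Idn[OF R_ar[OF f]] \<epsilon>_\<eta>[OF B] by simp
    also have "\<dots> = Cmp C (FA R (Cmp D f (\<epsilon> B))) (\<eta> (FO R B))"
      unfolding R_Cmp[OF \<epsilon>[OF B] f]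
      by (rule C.Cmp_assoc[OF \<eta>[OF R_ob[OF B]] R_ar[OF \<epsilon>[OF B]] R_ar[OF f], symmetric])
    finally show "Cmp C (FA R (Cmp D (\<epsilon> B') (FA L (FA R f)))) (\<eta> (FO R B)) =
      Cmp C (FA R (Cmp D f (\<epsilon> B))) (\<eta> (FO R B))" .
  qed
  then have \<epsilon>_nat: "nat_trans D D (L \<circ>\<^sub>F R) id_functor \<epsilon>"
    unfolding nat_trans_def
    using is_functor_id[OF is_functorD(1)[OF R]] is_functor_fcomp[OF R L] \<epsilon> by simp
  have "Cmp D (\<epsilon> (FO L X)) (FA L (\<eta> X)) = Idn D (FO L X)" if X: "X \<in> Ob C" for X
  proof (rule unique[OF X])
    note LX = L_ob[OF X] and \<eta>X = \<eta>[OF X]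
    show "Cmp D (\<epsilon> (FO L X)) (FA L (\<eta> X)) \<in> hom D (FO L X) (FO L X)"
      by (rule D.Cmp_hom[OF L_ar[OF \<eta>X] \<epsilon>[OF LX]])
    show "Idn D (FO L X) \<in> hom D (FO L X) (FO L X)"
      by (rule D.Idn_hom[OF LX])
    have "Cmp C (FA R (Cmp D (\<epsilon> (FO L X)) (FA L (\<eta> X)))) (\<eta> X) =
        Cmp C (FA R (\<epsilon> (FO L X))) (Cmp C (\<eta> (FO R (FO L X))) (\<eta> X))"
      unfolding R_Cmp[OF L_ar[OF \<eta>X] \<epsilon>[OF LX]] L_\<eta>[OF \<eta>X, symmetric]
      by (rule C.Cmp_assoc[OF \<eta>X R_ar[OF L_ar[OF \<eta>X]] R_ar[OF \<epsilon>[OF LX]]])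
    also have "\<dots> = Cmp C (Idn C (FO R (FO L X))) (\<eta> X)"
      unfolding \<epsilon>_\<eta>[OF LX, symmetric]
      by (rule C.Cmp_assoc[OF \<eta>X \<eta>[OF R_ob[OF LX]] R_ar[OF \<epsilon>[OF LX]], symmetric])
    finally show "Cmp C (FA R (Cmp D (\<epsilon> (FO L X)) (FA L (\<eta> X)))) (\<eta> X) = Cmp C (FA R (Idn D (FO L X))) (\<eta> X)"
      by (simp add: R_Idn[OF LX])
  qed
  then show ?thesis
    unfolding adjunction_def using L R \<eta>_nat \<epsilon>_nat \<epsilon>_\<eta> by simp
qed

section \<open>Categories of structured objects\<close>

lemma hom_structured_cat:
  "h \<in> hom (structured_cat C \<O> U P) X Y \<longleftrightarrow>
    (\<exists>f. h = MArr X f Y \<and> X \<in> \<O> \<and> Y \<in> \<O> \<and> f \<in> hom C (U X) (U Y) \<and> P X f Y)"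
  by (auto simp: hom_def structured_cat_def)

lemma structured_cat_simps [simp]:
  "Ob (structured_cat C \<O> U P) = \<O>"
  "Idn (structured_cat C \<O> U P) X = MArr X (Idn C (U X)) X"
  "Cmp (structured_cat C \<O> U P) g f = MArr (msrc f) (Cmp C (und g) (und f)) (mtgt g)"
  by (simp_all add: structured_cat_def)

lemma Ar_structured_cat:
  "h \<in> Ar (structured_cat C \<O> U P) \<longleftrightarrow> h \<in> hom (structured_cat C \<O> U P) (msrc h) (mtgt h)"
  by (auto simp: structured_cat_def hom_def)

lemma category_structured_cat:
  assumes "category C" and U: "\<And>X. X \<in> \<O> \<Longrightarrow> U X \<in> Ob C"
    and Idn: "\<And>X. X \<in> \<O> \<Longrightarrow> P X (Idn C (U X)) X"
    and Cmp: "\<And>X Y Z f g. X \<in> \<O> \<Longrightarrow> Y \<in> \<O> \<Longrightarrow> Z \<in> \<O> \<Longrightarrow> f \<in> hom C (U X) (U Y) \<Longrightarrow> g \<in> hom C (U Y) (U Z) \<Longrightarrow>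
      P X f Y \<Longrightarrow> P Y g Z \<Longrightarrow> P X (Cmp C g f) Z"
  shows "category (structured_cat C \<O> U P)"
proof -
  interpret category C by fact
  show ?thesis
  proof
    fix f
    assume "f \<in> Ar (structured_cat C \<O> U P)"
    then show "Src (structured_cat C \<O> U P) f \<in> Ob (structured_cat C \<O> U P)"
      "Tgt (structured_cat C \<O> U P) f \<in> Ob (structured_cat C \<O> U P)"
      by (auto simp: structured_cat_def)
  qed (auto simp: hom_structured_cat U Idn_hom Cmp_hom Cmp_Idn Idn_Cmp Cmp_assoc intro: Idn Cmp)
qed

lemma is_functor_underlying:
  assumes cat: "category (structured_cat C \<O> U P)" and C: "category C" and U: "\<And>X. X \<in> \<O> \<Longrightarrow> U X \<in> Ob C"
  shows "is_functor (structured_cat C \<O> U P) C \<lparr>FO = U, FA = und\<rparr>"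
  by (rule is_functorI) (use assms in \<open>auto simp: hom_structured_cat\<close>)

lemma is_functor_structured_cat:
  assumes "category (structured_cat C \<O> U P)" "category (structured_cat C \<O>' U' P')"
    and "\<And>X. X \<in> \<O> \<Longrightarrow> F X \<in> \<O>'" "\<And>X. X \<in> \<O> \<Longrightarrow> U' (F X) = U X"
    and "\<And>X Y f. X \<in> \<O> \<Longrightarrow> Y \<in> \<O> \<Longrightarrow> P X f Y \<Longrightarrow> P' (F X) f (F Y)"
  shows "is_functor (structured_cat C \<O> U P) (structured_cat C \<O>' U' P')
    \<lparr>FO = F, FA = (\<lambda>f. MArr (F (msrc f)) (und f) (F (mtgt f)))\<rparr>"
  by (rule is_functorI) (use assms in \<open>auto simp: hom_structured_cat\<close>)

section \<open>The categories of algebras, braided objects and braided algebras, and their forgetful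
  functors\<close>

context monoidal_category
begin

lemma is_algebra_mor_Idn:
  assumes "is_algebra M (A, m, u)"
  shows "is_algebra_mor M (A, m, u) (\<I> A) (A, m, u)"
  using assms by (auto simp: is_algebra_def is_algebra_mor_def hom_def)

lemma is_algebra_mor_Cmp:
  assumes "is_algebra M (A, m, u)" "is_algebra M (A', m', u')" "is_algebra M (A'', m'', u'')"
    and f: "f \<in> hom M A A'" and g: "g \<in> hom M A' A''"
    and mor: "is_algebra_mor M (A, m, u) f (A', m', u')" "is_algebra_mor M (A', m', u') g (A'', m'', u'')"
  shows "is_algebra_mor M (A, m, u) (g \<cdot> f) (A'', m'', u'')"
proof -
  note [simp] = homD[OF f] homD[OF g]
  have [simp]: "m \<in> Ar M" "Src M m = A \<odot> A" "Tgt M m = A" "u \<in> Ar M" "Src M u = \<one>" "Tgt M u = A"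
    "m' \<in> Ar M" "Src M m' = A' \<odot> A'" "Tgt M m' = A'" "m'' \<in> Ar M" "Src M m'' = A'' \<odot> A''" "Tgt M m'' = A''"
    using assms(1-3) by (auto simp: is_algebra_def hom_def)
  have f_mor: "f \<cdot> m = m' \<cdot> (f \<otimes> f)" "f \<cdot> u = u'" and g_mor: "g \<cdot> m' = m'' \<cdot> (g \<otimes> g)" "g \<cdot> u' = u''"
    using mor by (auto simp: is_algebra_mor_def)
  have "(g \<cdot> f) \<cdot> m = g \<cdot> m' \<cdot> (f \<otimes> f)"
    by (simp add: f_mor)
  also have "\<dots> = (m'' \<cdot> (g \<otimes> g)) \<cdot> (f \<otimes> f)"
    by (rule Cmp_eq_Cmp_assoc[OF g_mor(1)]) simp_all
  also have "\<dots> = m'' \<cdot> ((g \<cdot> f) \<otimes> (g \<cdot> f))"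
    by (simp add: TenA_Cmp_TenA)
  finally show ?thesis
    by (simp add: is_algebra_mor_def f_mor g_mor)
qed

lemma is_braided_mor_Idn:
  assumes "is_braided_object M (V, c)"
  shows "is_braided_mor M (V, c) (\<I> V) (V, c)"
  using assms by (auto simp: is_braided_object_def is_braided_mor_def hom_def)

lemma is_braided_mor_Cmp:
  assumes "is_braided_object M (V, c)" "is_braided_object M (V', c')" "is_braided_object M (V'', c'')"
    and f: "f \<in> hom M V V'" and g: "g \<in> hom M V' V''"
    and mor: "is_braided_mor M (V, c) f (V', c')" "is_braided_mor M (V', c') g (V'', c'')"
  shows "is_braided_mor M (V, c) (g \<cdot> f) (V'', c'')"
proof -
  note [simp] = homD[OF f] homD[OF g]
  have [simp]: "c \<in> Ar M" "Src M c = V \<odot> V" "Tgt M c = V \<odot> V"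
    "c' \<in> Ar M" "Src M c' = V' \<odot> V'" "Tgt M c' = V' \<odot> V'" "c'' \<in> Ar M" "Src M c'' = V'' \<odot> V''" "Tgt M c'' = V'' \<odot> V''"
    using assms(1-3) by (auto simp: is_braided_object_def hom_def)
  have f_mor: "c' \<cdot> (f \<otimes> f) = (f \<otimes> f) \<cdot> c" and g_mor: "c'' \<cdot> (g \<otimes> g) = (g \<otimes> g) \<cdot> c'"
    using mor by (auto simp: is_braided_mor_def)
  have "c'' \<cdot> ((g \<cdot> f) \<otimes> (g \<cdot> f)) = c'' \<cdot> (g \<otimes> g) \<cdot> (f \<otimes> f)"
    by (simp add: TenA_Cmp_TenA)
  also have "\<dots> = ((g \<otimes> g) \<cdot> c') \<cdot> (f \<otimes> f)"
    by (rule Cmp_eq_Cmp_assoc[OF g_mor]) simp_all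
  also have "\<dots> = ((g \<cdot> f) \<otimes> (g \<cdot> f)) \<cdot> c"
    by (simp add: f_mor TenA_Cmp_TenA_Cmp)
  finally show ?thesis
    by (simp add: is_braided_mor_def)
qed

lemma is_algebra_Ob: "is_algebra M B \<Longrightarrow> fst B \<in> Ob M"
  by (auto simp: is_algebra_def)

lemma is_braided_object_Ob: "is_braided_object M X \<Longrightarrow> fst X \<in> Ob M"
  by (auto simp: is_braided_object_def)

lemma is_braided_algebra_Ob: "is_braided_algebra M B \<Longrightarrow> fst B \<in> Ob M"
  by (auto simp: is_braided_algebra_def is_algebra_def)

lemma category_Alg_cat: "category (Alg_cat M)"
  unfolding Alg_cat_def
  by (rule category_structured_cat[OF category_axioms])
    (auto simp: is_algebra_Ob is_algebra_mor_Idn intro: is_algebra_mor_Cmp)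

lemma category_Br_cat: "category (Br_cat M)"
  unfolding Br_cat_def
  by (rule category_structured_cat[OF category_axioms])
    (auto simp: is_braided_object_Ob is_braided_mor_Idn intro: is_braided_mor_Cmp)

lemma category_BrAlg_cat: "category (BrAlg_cat M)"
  unfolding BrAlg_cat_def
  by (rule category_structured_cat[OF category_axioms])
    (auto simp: is_braided_algebra_Ob is_braided_algebra_def is_braided_algebra_mor_def is_algebra_mor_Idn
      is_braided_mor_Idn is_algebra_Ob intro: is_algebra_mor_Cmp is_braided_mor_Cmp)

lemma is_functor_H_Br: "is_functor (Br_cat M) M H_Br"
  using category_Br_cat category_axioms unfolding Br_cat_def H_Br_def
  by (rule is_functor_underlying) (simp add: is_braided_object_Ob)

lemma is_functor_Omega: "is_functor (Alg_cat M) M Omega"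
  using category_Alg_cat category_axioms unfolding Alg_cat_def Omega_def
  by (rule is_functor_underlying) (simp add: is_algebra_Ob)

lemma is_functor_H_Alg: "is_functor (BrAlg_cat M) (Alg_cat M) H_Alg"
  using category_BrAlg_cat category_Alg_cat unfolding BrAlg_cat_def Alg_cat_def H_Alg_def Let_def
  by (rule is_functor_structured_cat) (auto simp: is_braided_algebra_def is_braided_algebra_mor_def)

lemma is_functor_Omega_Br: "is_functor (BrAlg_cat M) (Br_cat M) Omega_Br"
  using category_BrAlg_cat category_Br_cat unfolding BrAlg_cat_def Br_cat_def Omega_Br_def Let_def
  by (rule is_functor_structured_cat) (auto simp: is_braided_algebra_def is_braided_algebra_mor_def)

end

section \<open>The free braided algebra\<close>

context tensor_power_category
begin

definition T_braid :: "'o \<Rightarrow> 'a \<Rightarrow> 'a" where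
  "T_braid V c = (THE d. is_T_braiding M S \<alpha> V c d)"

definition T_Br_ob :: "'o \<times> 'a \<Rightarrow> 'o \<times> 'a \<times> 'a \<times> 'a" where
  "T_Br_ob X = with_braiding (T_ob M S \<alpha> (fst X)) (T_braid (fst X) (snd X))"

lemma T_Br_ob_eq: "T_Br_ob (V, c) = (S V, T_mult M S \<alpha> V, \<alpha> V 0, T_braid V c)"
  by (simp add: T_Br_ob_def with_braiding_def T_ob_def)

lemma T_braid:
  assumes "is_braided_object M (V, c)"
  shows "is_T_braiding M S \<alpha> V c (T_braid V c)"
  unfolding T_braid_def by (rule theI'[OF T_braiding_ex1[OF assms]])

lemma s\<alpha>_0: "s\<alpha> V 0 = MArr [] (\<alpha> V 0) [S V]"
  by (simp add: s\<alpha>_def)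

lemma s\<alpha>_1: "s\<alpha> V 1 = MArr [V] (\<alpha> V 1) [S V]"
  by (simp add: s\<alpha>_def)

lemma is_braided_algebra_T:
  assumes c: "is_braided_object M (V, c)"
  shows "is_braided_algebra M (T_Br_ob (V, c))"
proof -
  interpret T: strict_braided_tensor_algebra_mult "Ob M" sarr msrc mtgt sidn scmp sten V "S V" "s\<alpha> V"
      "MArr [V, V] c [V, V]" "MArr [S V, S V] (T_mult M S \<alpha> V) [S V]" "MArr [S V, S V] (T_braid V c) [S V, S V]"
    by (rule T_braiding[OF c T_braid[OF c]])
  show ?thesis
    using T.braided_algebra_S by (simp add: T_Br_ob_eq braided_algebra_strict_iff s\<alpha>_0)
qed

lemma is_algebra_T:
  assumes "V \<in> Ob M"
  shows "is_algebra M (T_ob M S \<alpha> V)"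
proof -
  interpret T: strict_tensor_algebra_mult "Ob M" sarr msrc mtgt sidn scmp sten V "S V" "s\<alpha> V"
      "MArr [S V, S V] (T_mult M S \<alpha> V) [S V]"
    using assms by (rule T_mult)
  show ?thesis
    using T.algebra_S by (simp add: T_ob_def algebra_strict_iff s\<alpha>_0)
qed

lemma \<alpha>1_braided_mor:
  assumes c: "is_braided_object M (V, c)"
  shows "is_braided_mor M (V, c) (\<alpha> V 1) (S V, T_braid V c)"
proof -
  have V: "V \<in> Ob M"
    using is_braided_object_Ob[OF c] by simp
  have d: "is_braided_object M (S V, T_braid V c)"
    using is_braided_algebra_T[OF c] by (simp add: T_Br_ob_eq is_braided_algebra_def)
  interpret T: strict_braided_tensor_algebra_mult "Ob M" sarr msrc mtgt sidn scmp sten V "S V" "s\<alpha> V"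
      "MArr [V, V] c [V, V]" "MArr [S V, S V] (T_mult M S \<alpha> V) [S V]" "MArr [S V, S V] (T_braid V c) [S V, S V]"
    by (rule T_braiding[OF c T_braid[OF c]])
  have "\<alpha> V 1 \<in> hom M V (S V)"
    using \<alpha>_typing(2-4)[OF V, of 1] by (simp add: hom_def)
  then show ?thesis
    using T.\<alpha>1_braided unfolding s\<alpha>_1 by (simp only: braided_mor_strict_iff[OF c d])
qed

text \<open>One criterion serves twice: \<open>T f\<close> extends
  \<open>\<alpha> W 1 \<cdot> f\<close>, and the counit extends the identity of
  \<open>A\<close>.\<close>

lemma braided_algebra_mor_from_T:
  assumes c: "is_braided_object M (V, c)" and B: "is_braided_algebra M (A, m, u, e)"
    and g: "g \<in> hom M V A" "is_braided_mor M (V, c) g (A, e)"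
    and h: "h \<in> hom M (S V) A"
    and h_\<alpha>: "\<And>n. MArr [S V] h [A] \<bullet> s\<alpha> V n = strict.iter (MArr [A, A] m [A]) (MArr [] u [A]) (MArr [V] g [A]) n"
  shows "is_braided_algebra_mor M (T_Br_ob (V, c)) h (A, m, u, e)"
proof -
  interpret T: strict_braided_tensor_algebra_mult "Ob M" sarr msrc mtgt sidn scmp sten V "S V" "s\<alpha> V"
      "MArr [V, V] c [V, V]" "MArr [S V, S V] (T_mult M S \<alpha> V) [S V]" "MArr [S V, S V] (T_braid V c) [S V, S V]"
    by (rule T_braiding[OF c T_braid[OF c]])
  have TB: "is_algebra M (S V, T_mult M S \<alpha> V, \<alpha> V 0)" "is_braided_object M (S V, T_braid V c)"
    using is_braided_algebra_T[OF c] by (simp_all add: T_Br_ob_eq is_braided_algebra_def)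
  have B': "is_algebra M (A, m, u)" "is_braided_object M (A, e)"
    using B by (simp_all add: is_braided_algebra_def)
  have A: "A \<in> Ob M"
    using is_algebra_Ob[OF B'(1)] by simp
  have h': "sarr (MArr [S V] h [A])" and g': "sarr (MArr [V] g [A])"
    using h g(1) A by (simp_all add: sarr_def)
  have "MArr [S V] h [A] \<bullet> MArr [S V, S V] (T_mult M S \<alpha> V) [S V] =
      MArr [A, A] m [A] \<bullet> (MArr [S V] h [A] \<boxtimes> MArr [S V] h [A])"
    by (rule T.algebra_mor_if_iter[OF h' _ _ B'(1)[unfolded algebra_strict_iff] g' _ _ h_\<alpha>]) simp_all
  moreover have "MArr [S V] h [A] \<bullet> MArr [] (\<alpha> V 0) [S V] = MArr [] u [A]"
    using h_\<alpha>[of 0] by (simp add: s\<alpha>_0)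
  moreover have "MArr [A, A] e [A, A] \<bullet> (MArr [S V] h [A] \<boxtimes> MArr [S V] h [A]) =
      (MArr [S V] h [A] \<boxtimes> MArr [S V] h [A]) \<bullet> MArr [S V, S V] (T_braid V c) [S V, S V]"
    by (rule T.braided_mor_if_iter[OF h' _ _ B[unfolded braided_algebra_strict_iff] g' _ _ _ h_\<alpha>])
      (use g braided_mor_strict_iff[OF c B'(2) g(1)] in simp_all)
  ultimately show ?thesis
    unfolding is_braided_algebra_mor_def T_Br_ob_eq
    using algebra_mor_strict_iff[OF TB(1) B'(1) h] braided_mor_strict_iff[OF TB(2) B'(2) h] by simp
qed

text \<open>Supplies \<open>unique\<close> for the adjunction: braided algebra morphisms are
  compared through their underlying algebra morphisms.\<close>

lemma algebra_mor_from_T_eq: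
  assumes V: "V \<in> Ob M" and B: "is_algebra M (A, m, u)"
    and h: "h \<in> hom M (S V) A" "is_algebra_mor M (T_ob M S \<alpha> V) h (A, m, u)"
    and k: "k \<in> hom M (S V) A" "is_algebra_mor M (T_ob M S \<alpha> V) k (A, m, u)"
    and eq: "h \<cdot> \<alpha> V 1 = k \<cdot> \<alpha> V 1"
  shows "h = k"
proof -
  interpret T: strict_tensor_algebra_mult "Ob M" sarr msrc mtgt sidn scmp sten V "S V" "s\<alpha> V"
      "MArr [S V, S V] (T_mult M S \<alpha> V) [S V]"
    using V by (rule T_mult)
  note TA = is_algebra_T[OF V, unfolded T_ob_def]
  have A: "A \<in> Ob M"
    using is_algebra_Ob[OF B] by simp
  have "MArr [S V] h [A] = MArr [S V] k [A]"
  proof (rule T.algebra_mor_eq)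
    show "sarr (MArr [S V] h [A])" "sarr (MArr [S V] k [A])"
      using h k A by (simp_all add: sarr_def)
    show "strict.algebra A (MArr [A, A] m [A]) (MArr [] u [A])"
      using B by (simp add: algebra_strict_iff)
    show "MArr [S V] h [A] \<bullet> s\<alpha> V 1 = MArr [S V] k [A] \<bullet> s\<alpha> V 1"
      using eq by (simp add: s\<alpha>_def scmp_def)
  qed (use h(2) k(2) algebra_mor_strict_iff[OF TA B h(1)] algebra_mor_strict_iff[OF TA B k(1)] in
      \<open>simp_all add: T_ob_def s\<alpha>_0\<close>)
  then show ?thesis by simp
qed

lemma T_factor_ex1:
  assumes "V \<in> Ob M" "Y \<in> Ob M" "\<And>n. g n \<in> hom M (tpow M V n) Y"
  shows "\<exists>!h. h \<in> hom M (S V) Y \<and> (\<forall>n. h \<cdot> \<alpha> V n = g n)"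
  using assms choice by (intro is_coproduct_ex1[where X = "tpow M V"]) (auto simp: tensor_power_coproducts_def)

lemma tpow_ar_hom:
  assumes f: "f \<in> hom M V W"
  shows "tpow_ar M f n \<in> hom M (tpow M V n) (tpow M W n)"
proof -
  have "sarr (MArr [V] f [W])"
    using f Src_Ob Tgt_Ob by (auto simp: sarr_def hom_def)
  then have "sarr (strict.power_arr (MArr [V] f [W]) n)"
    by (rule strict.power_arr_typing) simp_all
  then show ?thesis
    by (simp add: power_arr_strict[OF f] sarr_def tens_replicate)
qed

lemma iter_mult_hom:
  assumes B: "is_algebra M (A, m, u)"
  shows "iter_mult M (A, m, u) n \<in> hom M (tpow M A n) A"
proof -
  have "sarr (strict.iter (MArr [A, A] m [A]) (MArr [] u [A]) (sidn [A]) n)"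
    using B[unfolded algebra_strict_iff] is_algebra_Ob[OF B] by (intro strict.iter_typing) simp_all
  then show ?thesis
    by (simp add: iter_strict[OF B] sarr_def tens_replicate)
qed

text \<open>Taken from \<open>T_functor\<close> itself, so that the description of the braided
  functor on arrows holds by unfolding.\<close>

definition T_map :: "'a \<Rightarrow> 'a" where
  "T_map f = und (FA (T_functor M S \<alpha>) f)"

lemma T_map:
  assumes f: "f \<in> hom M V W"
  shows "T_map f \<in> hom M (S V) (S W)" "T_map f \<cdot> \<alpha> V n = \<alpha> W n \<cdot> tpow_ar M f n"
proof -
  note f' = homD[OF f]
  have VW: "V \<in> Ob M" "W \<in> Ob M"
    using f Src_Ob Tgt_Ob by (auto simp: hom_def)
  have "\<exists>!h. h \<in> hom M (S V) (S W) \<and> (\<forall>n. h \<cdot> \<alpha> V n = \<alpha> W n \<cdot> tpow_ar M f n)"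
  proof (rule T_factor_ex1[OF VW(1)])
    show "S W \<in> Ob M"
      using \<alpha>_typing[OF VW(2)] by simp
    show "\<alpha> W n \<cdot> tpow_ar M f n \<in> hom M (tpow M V n) (S W)" for n
      using Cmp_hom[OF tpow_ar_hom[OF f]] \<alpha>_typing[OF VW(2)] by (simp add: hom_def)
  qed
  from theI'[OF this]
  show "T_map f \<in> hom M (S V) (S W)" "T_map f \<cdot> \<alpha> V n = \<alpha> W n \<cdot> tpow_ar M f n"
    by (simp_all add: T_map_def T_functor_def Let_def f')
qed

lemma T_functor_FA:
  assumes "f \<in> hom M V W"
  shows "FA (T_functor M S \<alpha>) f = MArr (T_ob M S \<alpha> V) (T_map f) (T_ob M S \<alpha> W)"
  using homD[OF assms] by (simp add: T_functor_def T_map_def Let_def)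

lemma T_map_braided_algebra_mor:
  assumes V: "is_braided_object M (V, c)" and W: "is_braided_object M (W, d)"
    and f: "f \<in> hom M V W" "is_braided_mor M (V, c) f (W, d)"
  shows "is_braided_algebra_mor M (T_Br_ob (V, c)) (T_map f) (T_Br_ob (W, d))"
proof -
  have VW: "V \<in> Ob M" "W \<in> Ob M"
    using is_braided_object_Ob[OF V] is_braided_object_Ob[OF W] by simp_all
  have \<alpha>1: "\<alpha> W 1 \<in> hom M W (S W)"
    using \<alpha>_typing(2-4)[OF VW(2), of 1] by (simp add: hom_def)
  have TW: "is_braided_object M (S W, T_braid W d)"
    using is_braided_algebra_T[OF W] by (simp add: T_Br_ob_eq is_braided_algebra_def)
  interpret T: strict_tensor_algebra_mult "Ob M" sarr msrc mtgt sidn scmp sten W "S W" "s\<alpha> W"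
      "MArr [S W, S W] (T_mult M S \<alpha> W) [S W]"
    using VW(2) by (rule T_mult)
  have f': "sarr (MArr [V] f [W])"
    using f VW by (simp add: sarr_def)
  have "MArr [S V] (T_map f) [S W] \<bullet> s\<alpha> V n = s\<alpha> W n \<bullet> strict.power_arr (MArr [V] f [W]) n" for n
    by (simp add: power_arr_strict[OF f(1)] s\<alpha>_def scmp_def T_map(2)[OF f(1)])
  also have "s\<alpha> W n \<bullet> strict.power_arr (MArr [V] f [W]) n =
      strict.iter (MArr [S W, S W] (T_mult M S \<alpha> W) [S W]) (s\<alpha> W 0) (s\<alpha> W 1 \<bullet> MArr [V] f [W]) n" for n
    by (rule strict.power_arr_iter[OF f', where V = V and W = W and A = "S W"]) (simp_all add: T.\<mu>_\<alpha>)
  finally have "MArr [S V] (T_map f) [S W] \<bullet> s\<alpha> V n =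
      strict.iter (MArr [S W, S W] (T_mult M S \<alpha> W) [S W]) (MArr [] (\<alpha> W 0) [S W]) (MArr [V] (\<alpha> W 1 \<cdot> f) [S W]) n" for n
    by (simp add: s\<alpha>_0 s\<alpha>_def scmp_def)
  then show ?thesis
    unfolding T_Br_ob_eq[of W d]
    using is_braided_algebra_T[OF W] is_braided_mor_Cmp[OF V W TW f(1) \<alpha>1 f(2) \<alpha>1_braided_mor[OF W]]
      Cmp_hom[OF f(1) \<alpha>1] T_map(1)[OF f(1)]
    by (intro braided_algebra_mor_from_T[OF V]) (simp_all add: T_Br_ob_eq)
qed

definition T_eval :: "'o \<times> 'a \<times> 'a \<Rightarrow> 'a" where
  "T_eval B = und (T_counit M S \<alpha> B)"

lemma T_eval:
  assumes B: "is_algebra M (A, m, u)"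
  shows "T_eval (A, m, u) \<in> hom M (S A) A" "T_eval (A, m, u) \<cdot> \<alpha> A n = iter_mult M (A, m, u) n"
proof -
  have A: "A \<in> Ob M"
    using is_algebra_Ob[OF B] by simp
  have "\<exists>!h. h \<in> hom M (S A) A \<and> (\<forall>n. h \<cdot> \<alpha> A n = iter_mult M (A, m, u) n)"
    by (rule T_factor_ex1[OF A A iter_mult_hom[OF B]])
  from theI'[OF this]
  show "T_eval (A, m, u) \<in> hom M (S A) A" "T_eval (A, m, u) \<cdot> \<alpha> A n = iter_mult M (A, m, u) n"
    by (simp_all add: T_eval_def T_counit_def Let_def Omega_def)
qed

lemma T_eval_braided_algebra_mor:
  assumes B: "is_braided_algebra M (A, m, u, e)"
  shows "is_braided_algebra_mor M (T_Br_ob (A, e)) (T_eval (A, m, u)) (A, m, u, e)"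
proof -
  have B': "is_algebra M (A, m, u)" "is_braided_object M (A, e)"
    using B by (simp_all add: is_braided_algebra_def)
  have A: "A \<in> Ob M"
    using is_algebra_Ob[OF B'(1)] by simp
  show ?thesis
  proof (rule braided_algebra_mor_from_T[OF B'(2) B])
    show "\<I> A \<in> hom M A A"
      using A by (rule Idn_hom)
    show "is_braided_mor M (A, e) (\<I> A) (A, e)"
      by (rule is_braided_mor_Idn[OF B'(2)])
    show "T_eval (A, m, u) \<in> hom M (S A) A"
      by (rule T_eval[OF B'(1)])
    show "MArr [S A] (T_eval (A, m, u)) [A] \<bullet> s\<alpha> A n =
        strict.iter (MArr [A, A] m [A]) (MArr [] u [A]) (MArr [A] (\<I> A) [A]) n" for n
      using iter_strict[OF B'(1), of n] T_eval(2)[OF B'(1), of n] by (simp add: sidn_def s\<alpha>_def scmp_def)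
  qed
qed

section \<open>The left adjoint, its unit and its counit\<close>

definition T_Br :: "('o \<times> 'a, ('o \<times> 'a, 'a) marr, 'o \<times> 'a \<times> 'a \<times> 'a, ('o \<times> 'a \<times> 'a \<times> 'a, 'a) marr) cfunctor" where
  "T_Br = \<lparr>FO = T_Br_ob, FA = (\<lambda>f. MArr (T_Br_ob (msrc f)) (T_map (und f)) (T_Br_ob (mtgt f)))\<rparr>"

definition T_Br_unit :: "'o \<times> 'a \<Rightarrow> ('o \<times> 'a, 'a) marr" where
  "T_Br_unit X = MArr X (\<alpha> (fst X) 1) (FO Omega_Br (T_Br_ob X))"

definition T_Br_counit :: "'o \<times> 'a \<times> 'a \<times> 'a \<Rightarrow> ('o \<times> 'a \<times> 'a \<times> 'a, 'a) marr" where
  "T_Br_counit B = MArr (T_Br_ob (FO Omega_Br B)) (T_eval (FO H_Alg B)) B"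

lemma T_Br_simps [simp]:
  "FO T_Br X = T_Br_ob X" "FA T_Br f = MArr (T_Br_ob (msrc f)) (T_map (und f)) (T_Br_ob (mtgt f))"
  by (simp_all add: T_Br_def)

lemma Omega_Br_simps [simp]:
  "FO Omega_Br (A, m, u, c) = (A, c)"
  "FA Omega_Br (MArr (A, m, u, c) f (A', m', u', c')) = MArr (A, c) f (A', c')"
  by (simp_all add: Omega_Br_def Let_def)

lemma H_Alg_simps [simp]:
  "FO H_Alg (A, m, u, c) = (A, m, u)"
  "FA H_Alg (MArr (A, m, u, c) f (A', m', u', c')) = MArr (A, m, u) f (A', m', u')"
  by (simp_all add: H_Alg_def Let_def)

lemma hom_Br_cat_iff:
  "h \<in> hom (Br_cat M) (V, c) (W, d) \<longleftrightarrow> (\<exists>f. h = MArr (V, c) f (W, d) \<and> is_braided_object M (V, c) \<and>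
    is_braided_object M (W, d) \<and> f \<in> hom M V W \<and> is_braided_mor M (V, c) f (W, d))"
  by (simp add: Br_cat_def hom_structured_cat)

lemma hom_BrAlg_cat_iff:
  "h \<in> hom (BrAlg_cat M) (A, m, u, c) (A', m', u', c') \<longleftrightarrow> (\<exists>f. h = MArr (A, m, u, c) f (A', m', u', c') \<and>
    is_braided_algebra M (A, m, u, c) \<and> is_braided_algebra M (A', m', u', c') \<and> f \<in> hom M A A' \<and>
    is_braided_algebra_mor M (A, m, u, c) f (A', m', u', c'))"
  by (simp add: BrAlg_cat_def hom_structured_cat)

lemma Ob_Br_cat [simp]: "Ob (Br_cat M) = Collect (is_braided_object M)"
  by (simp add: Br_cat_def)

lemma Ob_BrAlg_cat [simp]: "Ob (BrAlg_cat M) = Collect (is_braided_algebra M)"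
  by (simp add: BrAlg_cat_def)

lemma Br_cat_simps:
  "Idn (Br_cat M) X = MArr X (\<I> (fst X)) X" "Cmp (Br_cat M) g f = MArr (msrc f) (und g \<cdot> und f) (mtgt g)"
  by (simp_all add: Br_cat_def)

lemma T_Br_adjunction: "adjunction (Br_cat M) (BrAlg_cat M) T_Br Omega_Br T_Br_unit T_Br_counit"
proof (rule adjunction_from_universal_arrows[OF category_Br_cat is_functor_Omega_Br])
  fix X :: "'o \<times> 'a"
  assume X: "X \<in> Ob (Br_cat M)"
  obtain V c where Vc: "X = (V, c)" by (cases X)
  have c: "is_braided_object M (V, c)" using X Vc by simp
  show "FO T_Br X \<in> Ob (BrAlg_cat M)"
    using is_braided_algebra_T[OF c] by (simp add: Vc)
  have V: "V \<in> Ob M"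
    using is_braided_object_Ob[OF c] by simp
  show "T_Br_unit X \<in> hom (Br_cat M) X (FO Omega_Br (FO T_Br X))"
    using c \<alpha>1_braided_mor[OF c] is_braided_algebra_T[OF c] \<alpha>_typing(2-4)[OF V, of 1]
    by (simp add: Vc T_Br_unit_def T_Br_ob_eq hom_Br_cat_iff is_braided_algebra_def) (simp add: hom_def)
  fix B :: "'o \<times> 'a \<times> 'a \<times> 'a" and h k
  assume h: "h \<in> hom (BrAlg_cat M) (FO T_Br X) B" and k: "k \<in> hom (BrAlg_cat M) (FO T_Br X) B"
    and eq: "Cmp (Br_cat M) (FA Omega_Br h) (T_Br_unit X) = Cmp (Br_cat M) (FA Omega_Br k) (T_Br_unit X)"
  obtain A m u e where B: "B = (A, m, u, e)" by (cases B)
  obtain h' where h': "h = MArr (T_Br_ob X) h' B" "is_braided_algebra M B" "h' \<in> hom M (S V) A"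
    "is_braided_algebra_mor M (T_Br_ob X) h' B"
    using h by (auto simp: Vc B T_Br_ob_eq hom_BrAlg_cat_iff)
  obtain k' where k': "k = MArr (T_Br_ob X) k' B" "k' \<in> hom M (S V) A" "is_braided_algebra_mor M (T_Br_ob X) k' B"
    using k by (auto simp: Vc B T_Br_ob_eq hom_BrAlg_cat_iff)
  have "h' = k'"
  proof (rule algebra_mor_from_T_eq[OF V])
    show "is_algebra M (A, m, u)" "h' \<in> hom M (S V) A" "k' \<in> hom M (S V) A"
      using h' k' B by (simp_all add: is_braided_algebra_def)
    show "is_algebra_mor M (T_ob M S \<alpha> V) h' (A, m, u)" "is_algebra_mor M (T_ob M S \<alpha> V) k' (A, m, u)"
      using h'(4) k'(3) by (simp_all add: Vc B T_Br_ob_eq T_ob_def is_braided_algebra_mor_def)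
    show "h' \<cdot> \<alpha> V 1 = k' \<cdot> \<alpha> V 1"
      using eq by (simp add: h'(1) k'(1) Vc B T_Br_ob_eq T_Br_unit_def Br_cat_simps)
  qed
  then show "h = k" by (simp add: h' k')
next
  fix X Y :: "'o \<times> 'a" and f
  assume f: "f \<in> hom (Br_cat M) X Y"
  obtain V c W d where XY: "X = (V, c)" "Y = (W, d)" by (cases X, cases Y)
  obtain f' where f': "f = MArr X f' Y" "is_braided_object M (V, c)" "is_braided_object M (W, d)" "f' \<in> hom M V W"
    "is_braided_mor M (V, c) f' (W, d)"
    using f by (auto simp: XY hom_Br_cat_iff)
  show "FA T_Br f \<in> hom (BrAlg_cat M) (FO T_Br X) (FO T_Br Y)"
    using T_map_braided_algebra_mor[OF f'(2-5)] T_map(1)[OF f'(4)] is_braided_algebra_T[OF f'(2)]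
      is_braided_algebra_T[OF f'(3)]
    by (simp add: f'(1) XY T_Br_ob_eq hom_BrAlg_cat_iff)
  show "Cmp (Br_cat M) (FA Omega_Br (FA T_Br f)) (T_Br_unit X) = Cmp (Br_cat M) (T_Br_unit Y) f"
    using T_map(2)[OF f'(4), of 1] by (simp add: f'(1) XY T_Br_unit_def T_Br_ob_eq Br_cat_simps)
next
  fix B :: "'o \<times> 'a \<times> 'a \<times> 'a"
  assume "B \<in> Ob (BrAlg_cat M)"
  moreover obtain A m u e where B: "B = (A, m, u, e)" by (cases B)
  ultimately have B': "is_braided_algebra M (A, m, u, e)" "is_algebra M (A, m, u)" "is_braided_object M (A, e)"
    by (simp_all add: is_braided_algebra_def)
  show "T_Br_counit B \<in> hom (BrAlg_cat M) (FO T_Br (FO Omega_Br B)) B"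
    using T_eval_braided_algebra_mor[OF B'(1)] T_eval(1)[OF B'(2)] is_braided_algebra_T[OF B'(3)] B'(1)
    by (simp add: B T_Br_counit_def T_Br_ob_eq hom_BrAlg_cat_iff)
  show "Cmp (Br_cat M) (FA Omega_Br (T_Br_counit B)) (T_Br_unit (FO Omega_Br B)) = Idn (Br_cat M) (FO Omega_Br B)"
    using T_eval(2)[OF B'(2), of 1] by (simp add: B T_Br_counit_def T_Br_unit_def T_Br_ob_eq Br_cat_simps)
qed

end

theorem proposition3p1:
  fixes M :: "('o, 'a) monoidal"
    and S :: "'o \<Rightarrow> 'o"
    and \<alpha> :: "'o \<Rightarrow> nat \<Rightarrow> 'a"
  assumes monoidal: "monoidal_category M"
    and coproducts: "has_denumerable_coproducts M"
    and left_preserves: "\<And>X. X \<in> Ob M \<Longrightarrow> preserves_denumerable_coproducts M M (tensor_left M X)"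
    and right_preserves: "\<And>X. X \<in> Ob M \<Longrightarrow> preserves_denumerable_coproducts M M (tensor_right M X)"
    and choice: "tensor_power_coproducts M S \<alpha>"
  shows "\<exists>T_Br \<eta>_Br \<epsilon>_Br.
      adjunction (Br_cat M) (BrAlg_cat M) T_Br Omega_Br \<eta>_Br \<epsilon>_Br \<and>
      (\<forall>V c. (V, c) \<in> Ob (Br_cat M) \<longrightarrow>
         (\<exists>!c\<^sub>T. is_T_braiding M S \<alpha> V c c\<^sub>T) \<and>
         (\<forall>c\<^sub>T. is_T_braiding M S \<alpha> V c c\<^sub>T \<longrightarrow>
            FO T_Br (V, c) = with_braiding (FO (T_functor M S \<alpha>) V) c\<^sub>T)) \<and>
      (\<forall>f\<in>Ar (Br_cat M).
         FA T_Br f = MArr (FO T_Br (msrc f)) (und (FA (T_functor M S \<alpha>) (und f))) (FO T_Br (mtgt f))) \<and>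
      (\<forall>X\<in>Ob (Br_cat M). FA H_Br (\<eta>_Br X) = T_unit \<alpha> (FO H_Br X)) \<and>
      (\<forall>\<eta>'. nat_trans (Br_cat M) (Br_cat M) id_functor (Omega_Br \<circ>\<^sub>F T_Br) \<eta>' \<and>
            (\<forall>X\<in>Ob (Br_cat M). FA H_Br (\<eta>' X) = T_unit \<alpha> (FO H_Br X)) \<longrightarrow>
         (\<forall>X\<in>Ob (Br_cat M). \<eta>' X = \<eta>_Br X)) \<and>
      (\<forall>B\<in>Ob (BrAlg_cat M). FA H_Alg (\<epsilon>_Br B) = T_counit M S \<alpha> (FO H_Alg B)) \<and>
      (\<forall>\<epsilon>'. nat_trans (BrAlg_cat M) (BrAlg_cat M) (T_Br \<circ>\<^sub>F Omega_Br) id_functor \<epsilon>' \<and>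
            (\<forall>B\<in>Ob (BrAlg_cat M). FA H_Alg (\<epsilon>' B) = T_counit M S \<alpha> (FO H_Alg B)) \<longrightarrow>
         (\<forall>B\<in>Ob (BrAlg_cat M). \<epsilon>' B = \<epsilon>_Br B)) \<and>
      functor_eq (BrAlg_cat M) M (H_Br \<circ>\<^sub>F Omega_Br) (Omega \<circ>\<^sub>F H_Alg) \<and>
      functor_eq (Br_cat M) (Alg_cat M) (H_Alg \<circ>\<^sub>F T_Br) (T_functor M S \<alpha> \<circ>\<^sub>F H_Br)"
proof -
  interpret tensor_power_category M S \<alpha>
    by (intro tensor_power_category.intro tensor_power_category_axioms.intro) fact+
  have adj: "adjunction (Br_cat M) (BrAlg_cat M) T_Br Omega_Br T_Br_unit T_Br_counit"
    by (rule T_Br_adjunction)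
  from this[unfolded adjunction_def nat_trans_def fcomp_simps id_functor_simps]
  have T_Br: "is_functor (Br_cat M) (BrAlg_cat M) T_Br"
    and unit: "\<And>X. X \<in> Ob (Br_cat M) \<Longrightarrow> T_Br_unit X \<in> hom (Br_cat M) X (FO Omega_Br (FO T_Br X))"
    and counit: "\<And>B. B \<in> Ob (BrAlg_cat M) \<Longrightarrow> T_Br_counit B \<in> hom (BrAlg_cat M) (FO T_Br (FO Omega_Br B)) B"
    by blast+
  have braid: "T_Br_ob (V, c) = with_braiding (FO (T_functor M S \<alpha>) V) d"
    if "is_braided_object M (V, c)" "is_T_braiding M S \<alpha> V c d" for V c d
    using that T_braid[OF that(1)] T_braiding_ex1[OF that(1)] by (auto simp: T_Br_ob_def T_functor_def)
  have H_unit: "FA H_Br (T_Br_unit X) = T_unit \<alpha> (FO H_Br X)" for X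
    by (simp add: H_Br_def T_Br_unit_def T_unit_def)
  have H_counit: "FA H_Alg (T_Br_counit B) = T_counit M S \<alpha> (FO H_Alg B)" for B
    by (cases B) (simp add: T_Br_counit_def T_Br_ob_eq T_eval_def T_counit_def T_ob_def Omega_def Let_def)
  \<comment> \<open>\<open>H_Br\<close> is faithful: a transformation of the required type fixes
    source and target of each component, and \<open>H_Br\<close> recovers the underlying arrow.
    \<open>H_Alg\<close> plays the same part for the counit.\<close>
  have unit_unique: "\<eta>' X = T_Br_unit X"
    if "nat_trans (Br_cat M) (Br_cat M) id_functor (Omega_Br \<circ>\<^sub>F T_Br) \<eta>'"
      "\<forall>X\<in>Ob (Br_cat M). FA H_Br (\<eta>' X) = T_unit \<alpha> (FO H_Br X)" "X \<in> Ob (Br_cat M)" for \<eta>' X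
  proof -
    have "\<eta>' X \<in> hom (Br_cat M) X (FO Omega_Br (FO T_Br X))"
      using that(1,3) unfolding nat_trans_def fcomp_simps id_functor_simps by blast
    moreover have "und (\<eta>' X) = und (T_Br_unit X)"
      using bspec[OF that(2,3)] H_unit[of X] by (simp add: H_Br_def)
    ultimately show ?thesis
      using unit[OF that(3)] by (auto simp: Br_cat_def hom_structured_cat)
  qed
  have counit_unique: "\<epsilon>' B = T_Br_counit B"
    if "nat_trans (BrAlg_cat M) (BrAlg_cat M) (T_Br \<circ>\<^sub>F Omega_Br) id_functor \<epsilon>'"
      "\<forall>B\<in>Ob (BrAlg_cat M). FA H_Alg (\<epsilon>' B) = T_counit M S \<alpha> (FO H_Alg B)" "B \<in> Ob (BrAlg_cat M)" for \<epsilon>' B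
  proof -
    have "\<epsilon>' B \<in> hom (BrAlg_cat M) (FO T_Br (FO Omega_Br B)) B"
      using that(1,3) unfolding nat_trans_def fcomp_simps id_functor_simps by blast
    moreover have "FA H_Alg (\<epsilon>' B) = FA H_Alg (T_Br_counit B)"
      using bspec[OF that(2,3)] H_counit[of B] by simp
    then have "und (\<epsilon>' B) = und (T_Br_counit B)"
      by (simp add: H_Alg_def Let_def)
    ultimately show ?thesis
      using counit[OF that(3)] by (auto simp: BrAlg_cat_def hom_structured_cat)
  qed
  have forget: "functor_eq (BrAlg_cat M) M (H_Br \<circ>\<^sub>F Omega_Br) (Omega \<circ>\<^sub>F H_Alg)"
    using is_functor_fcomp[OF is_functor_Omega_Br is_functor_H_Br] is_functor_fcomp[OF is_functor_H_Alg is_functor_Omega]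
    by (simp add: functor_eq_def) (auto simp: H_Br_def Omega_Br_def Omega_def H_Alg_def Let_def split: prod.splits)
  have T_ob: "FO (T_functor M S \<alpha> \<circ>\<^sub>F H_Br) X = FO (H_Alg \<circ>\<^sub>F T_Br) X" for X
    by (cases X) (simp add: T_Br_ob_eq T_functor_def T_ob_def H_Br_def)
  have T_ar: "FA (T_functor M S \<alpha> \<circ>\<^sub>F H_Br) f = FA (H_Alg \<circ>\<^sub>F T_Br) f" if "f \<in> Ar (Br_cat M)" for f
  proof -
    obtain V c W d f' where f: "f = MArr (V, c) f' (W, d)"
      by (metis marr.exhaust surj_pair)
    then have "f' \<in> hom M V W"
      using that unfolding Br_cat_def by (auto simp: Ar_structured_cat hom_structured_cat)
    then show ?thesis
      by (simp add: f H_Br_def T_functor_FA T_Br_ob_eq T_ob_def)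
  qed
  have lift: "functor_eq (Br_cat M) (Alg_cat M) (H_Alg \<circ>\<^sub>F T_Br) (T_functor M S \<alpha> \<circ>\<^sub>F H_Br)"
    unfolding functor_eq_def
    using is_functor_fcomp[OF T_Br is_functor_H_Alg]
      is_functor_cong[OF is_functor_fcomp[OF T_Br is_functor_H_Alg] T_ob T_ar] T_ob T_ar by simp
  show ?thesis
    by (rule exI[of _ T_Br], rule exI[of _ T_Br_unit], rule exI[of _ T_Br_counit])
      (intro conjI adj forget lift allI impI ballI,
        simp_all add: T_braiding_ex1 braid H_unit H_counit T_map_def unit_unique counit_unique)
qed

end
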